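(* Let $\mathcal{T}_0$ be the Jeandel-Rao set of 11 Wang tiles, $\Omega_0=\Omega_{\mathcal{T}_0}$ its Wang shift, $\mathcal{U}$ the set of 19 Wang tiles listed in the context and $\Omega_{\mathcal U}$ its Wang shift. There exists an aperiodic and minimal subshift $X_0\subseteq\Omega_0$ such that every tiling in $X_0$ can be decomposed uniquely into 19 distinct patches (two of size 45, four of size 70, six of size 72 and seven of size 112) that are equivalent to the set of 19 Wang tiles $\mathcal{U}$. Precisely: there exist an aperiodic and minimal subshift $X_0\subseteq\Omega_0$, finite sets $S_u\subset\mathbb{Z}^2$ with $\mathbf{0}\in S_u$, pairwise distinct patterns $P_u:S_u\to\mathcal{T}_0$ and vectors $a_u,b_u\in\mathbb{Z}^2$ (for $u\in\mathcal{U}$) such that (1) among the 19 numbers $\#S_u$, exactly two equal 45, four equal 70, six equal 72 and seven equal 112; (2) for every $w\in\Omega_{\mathcal U}$ there is a map $p_w:\mathbb{Z}^2\to\mathbb{Z}^2$ with $p_w(\mathbf 0)=\mathbf 0$, $p_w(\mathbf n+\mathbf e_1)=p_w(\mathbf n)+a_{w(\mathbf n)}$ and $p_w(\mathbf n+\mathbf e_2)=p_w(\mathbf n)+b_{w(\mathbf n)}$ for all $\mathbf n\in\mathbb{Z}^2$, such that the sets $p_w(\mathbf n)+S_{w(\mathbf n)}$ ($\mathbf n\in\mathbb{Z}^2$) form a partition of $\mathbb{Z}^2$, and the tiling $\Psi(w):\mathbb{Z}^2\to\mathcal{T}_0$ defined by $\Psi(w)(p_w(\mathbf n)+\mathbf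 s)=P_{w(\mathbf n)}(\mathbf s)$ for $\mathbf n\in\mathbb{Z}^2$, $\mathbf s\in S_{w(\mathbf n)}$, belongs to $X_0$; (3) for every $x\in X_0$ there is a unique pair $(w,\mathbf k)$ with $w\in\Omega_{\mathcal U}$, $\mathbf k\in S_{w(\mathbf 0)}$ and $x=\sigma^{\mathbf k}\Psi(w)$.
   Context: A Wang tile is a tuple $(a,b,c,d)$ giving the colors of the right, top, left and bottom edges of a unit square, in this order. For a finite set $\mathcal{T}$ of Wang tiles, the Wang shift $\Omega_{\mathcal T}$ is the set of all $x:\mathbb{Z}^2\to\mathcal{T}$ such that for every $\mathbf n$ the right color of $x(\mathbf n)$ equals the left color of $x(\mathbf n+\mathbf e_1)$ and the top color of $x(\mathbf n)$ equals the bottom color of $x(\mathbf n+\mathbf e_2)$, where $\mathbf e_1=(1,0)$, $\mathbf e_2=(0,1)$. The shift is $(\sigma^{\mathbf n}x)_{\mathbf m}=x_{\mathbf m+\mathbf n}$. A subshift is a closed (product topology) shift-invariant set; it is minimal if it contains no nonempty proper closed shift-invariant subset; it is aperiodic if it is nonempty and no element $x$ satisfies $\sigma^{\mathbf n}x=x$ for some $\mathbf n\neq\mathbf 0$. The Jeandel-Rao set is $\mathcal{T}_0=\{(2,4,2,1),(2,2,2,0),(1,1,3,1),(1,2,3,2),(3,1,3,3),(0,1,3,1),(0,0,0,1),(3,1,0,2),(0,2,1,2),(1,2,1,4),(3,3,1,2)\}$. The set $\mathcal{U}$ consists of the 19 tiles (right, top, left, bottom): $(F,O,J,O)$, $(F,O,H,L)$,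 $(J,M,F,P)$, $(D,M,F,K)$, $(H,P,J,P)$, $(H,P,H,N)$, $(H,K,F,P)$, $(H,K,D,P)$, $(B,O,I,O)$, $(G,L,E,O)$, $(G,L,C,L)$, $(A,L,I,O)$, $(E,P,G,P)$, $(E,P,I,P)$, $(I,P,G,K)$, $(I,P,I,K)$, $(I,K,B,M)$, $(I,K,A,K)$, $(C,N,I,P)$, where the letters are distinct colors. *)

theory Defs
  imports "HOL-Analysis.Analysis"
begin

text \<open>A Wang tile is the tuple of its right, top, left and bottom colours, in this order.\<close>

type_synonym 'c tile = "'c \<times> 'c \<times> 'c \<times> 'c"

fun right_color :: "'c tile \<Rightarrow> 'c" where "right_color (a, b, c, d) = a"
fun top_color :: "'c tile \<Rightarrow> 'c" where "top_color (a, b, c, d) = b"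
fun left_color :: "'c tile \<Rightarrow> 'c" where "left_color (a, b, c, d) = c"
fun bottom_color :: "'c tile \<Rightarrow> 'c" where "bottom_color (a, b, c, d) = d"

definition e1 :: "int \<times> int" where "e1 = (1, 0)"
definition e2 :: "int \<times> int" where "e2 = (0, 1)"

definition wang_shift :: "'c tile set \<Rightarrow> (int \<times> int \<Rightarrow> 'c tile) set" where
  "wang_shift T = {x. (\<forall>n. x n \<in> T) \<and>
     (\<forall>n. right_color (x n) = left_color (x (n + e1))) \<and>
     (\<forall>n. top_color (x n) = bottom_color (x (n + e2)))}"

definition shift :: "int \<times> int \<Rightarrow> (int \<times> int \<Rightarrow> 'a) \<Rightarrow> (int \<times> int \<Rightarrow> 'a)" where
  "shift n x = (\<lambda>m. x (m + n))"

text \<open>Closedness is taken in the full shift over the alphabet \<open>T\<close>, with \<open>T\<close> discrete;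
  in particular all members of a subshift over \<open>T\<close> take their values in \<open>T\<close>.\<close>

definition subshift :: "'a set \<Rightarrow> (int \<times> int \<Rightarrow> 'a) set \<Rightarrow> bool" where
  "subshift T X \<longleftrightarrow>
     closedin (product_topology (\<lambda>_. discrete_topology T) UNIV) X \<and>
     (\<forall>n. shift n ` X = X)"

definition minimal_subshift :: "'a set \<Rightarrow> (int \<times> int \<Rightarrow> 'a) set \<Rightarrow> bool" where
  "minimal_subshift T X \<longleftrightarrow>
     subshift T X \<and> \<not> (\<exists>Y. Y \<noteq> {} \<and> Y \<subset> X \<and> subshift T Y)"

definition aperiodic :: "(int \<times> int \<Rightarrow> 'a) set \<Rightarrow> bool" where
  "aperiodic X \<longleftrightarrow> X \<noteq> {} \<and> \<not> (\<exists>x\<in>X. \<exists>n. n \<noteq> 0 \<and> shift n x = x)"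

definition jeandel_rao_tiles :: "nat tile set" where
  "jeandel_rao_tiles =
     {(2,4,2,1), (2,2,2,0), (1,1,3,1), (1,2,3,2), (3,1,3,3), (0,1,3,1),
      (0,0,0,1), (3,1,0,2), (0,2,1,2), (1,2,1,4), (3,3,1,2)}"

datatype letter =
  cA | cB | cC | cD | cE | cF | cG | cH | cI | cJ | cK | cL | cM | cN | cO | cP

definition tiles_U :: "letter tile set" where
  "tiles_U =
     {(cF,cO,cJ,cO), (cF,cO,cH,cL), (cJ,cM,cF,cP), (cD,cM,cF,cK), (cH,cP,cJ,cP),
      (cH,cP,cH,cN), (cH,cK,cF,cP), (cH,cK,cD,cP), (cB,cO,cI,cO), (cG,cL,cE,cO),
      (cG,cL,cC,cL), (cA,cL,cI,cO), (cE,cP,cG,cP), (cE,cP,cI,cP), (cI,cP,cG,cK),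
      (cI,cP,cI,cK), (cI,cK,cB,cM), (cI,cK,cA,cK), (cC,cN,cI,cP)}"

text \<open>The position map \<open>p\<close> tells where the origin of the patch replacing the tile \<open>w n\<close> is put;
  for given \<open>a\<close>, \<open>b\<close>, \<open>w\<close> there is at most one.\<close>

definition position_map ::
  "('u \<Rightarrow> int \<times> int) \<Rightarrow> ('u \<Rightarrow> int \<times> int) \<Rightarrow> (int \<times> int \<Rightarrow> 'u) \<Rightarrow>
   (int \<times> int \<Rightarrow> int \<times> int) \<Rightarrow> bool" where
  "position_map a b w p \<longleftrightarrow> p 0 = 0 \<and>
     (\<forall>n. p (n + e1) = p n + a (w n)) \<and> (\<forall>n. p (n + e2) = p n + b (w n))"

text \<open>The partition is understood as an indexed family: patches at different \<open>n\<close> are disjoint.\<close>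

definition placed_supports_partition ::
  "('u \<Rightarrow> (int \<times> int) set) \<Rightarrow> (int \<times> int \<Rightarrow> 'u) \<Rightarrow> (int \<times> int \<Rightarrow> int \<times> int) \<Rightarrow> bool" where
  "placed_supports_partition S w p \<longleftrightarrow>
     disjoint_family (\<lambda>n. (+) (p n) ` S (w n)) \<and> (\<Union>n. (+) (p n) ` S (w n)) = UNIV"

end

theory Submission
  imports Defs "HOL-Library.Code_Binary_Nat"
begin

text \<open>The patches arise by composing simpler substitutions. Cutting the configurations of \<open>X\<^sub>0\<close>
  along rows of height 4 or 5 gives words of Jeandel--Rao tiles; shearing the array of words by one
  column per row, then merging certain tiles with their right neighbour (four times) and with their
  upper neighbour (twice), produces the tiles of \<open>\<U>\<close>. Each step replaces letters by words along one
  axis. Since the first letter of a word occurs only in first position, the cutting points are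
  visible in the image, so the step is uniquely reversible; the shear is reversible because
  letters with the same image are separated by their horizontal neighbours.

  Two further steps of the same kind lead from \<open>\<Omega>\<^sub>U\<close> onto itself. As this self-similarity expands
  distances, no tiling has a period and it suffices for minimality that every \<open>2 \<times> 2\<close> pattern
  occurs in every tiling. Applied to finite patterns it also yields arbitrarily large squares, hence
  a tiling. Finally \<open>X\<^sub>0\<close> consists of all translates of images of \<open>\<Omega>\<^sub>U\<close>. It is closed by
  compactness, and it inherits aperiodicity and minimality from \<open>\<Omega>\<^sub>U\<close>.\<close>

section \<open>Decompositions into patches\<close>

text \<open>Statements about infinite tilings have to follow from finitely many checks. Every level
  therefore has a finite alphabet of numbers and two lists of dominoes, and each step between levels
  is justified by conditions on these lists. Since \<open>X0\<close> is by definition the set of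
  translates of images, the way down to Jeandel-Rao tiles calls for injectivity
  (\<open>embeds\<close>), whereas the self-similarity must also be onto (\<open>covers\<close>).
  For the latter the colours of U are too permissive: they admit dominoes that occur in no tiling,
  and these are discarded beforehand. The self-similarity sends tile 0 to a single tile, so only its
  square expands in both directions. A 2 x 2 square nevertheless lies in the image of a 2 x 2 square
  already under the substitution itself, and side 2 is where the halving of squares comes to a stop.
  The Jeandel-Rao tiles numbered 0 and 1 are the only ones with colour 2 on the left or right edge.
  They fill whole rows, and cutting below these rows gives the heights 4 and 5. In the resulting
  array of words the lines to be merged next run diagonally, which is the reason for the
  shear.\<close>

declare split_paired_All [simp del] split_paired_Ex [simp del]

type_synonym point = "int \<times> int"
type_synonym dominoes = "(nat \<times> nat) list"

definition support :: "('u \<Rightarrow> (point \<times> 't) list) \<Rightarrow> 'u \<Rightarrow> point set" where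
  "support C u = fst ` set (C u)"

text \<open>The list \<open>C u\<close> contains the cells of the patch of \<open>u\<close> together with their values.\<close>

definition image_by ::
  "('u \<Rightarrow> (point \<times> 't) list) \<Rightarrow> ('u \<Rightarrow> point) \<Rightarrow> ('u \<Rightarrow> point) \<Rightarrow>
   (point \<Rightarrow> 'u) \<Rightarrow> (point \<Rightarrow> point) \<Rightarrow> (point \<Rightarrow> 't) \<Rightarrow> bool" where
  "image_by C a b w p x \<longleftrightarrow>
     position_map a b w p \<and> placed_supports_partition (support C) w p \<and>
     (\<forall>n. \<forall>(s, c)\<in>set (C (w n)). x (p n + s) = c)"

text \<open>Every point is joined to the origin by unit steps, some of them leftwards or downwards;
  hence equivalences instead of implications in the step cases.\<close>

lemma plane_induct [case_names zero e1 e2]: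
  assumes "P 0" and "\<And>n. P n \<longleftrightarrow> P (n + e1)" and "\<And>n. P n \<longleftrightarrow> P (n + e2)"
  shows "P n"
proof -
  have r: "P (i, j) \<longleftrightarrow> P (i + 1, j)" for i j
    using assms(2)[of "(i, j)"] by (simp add: e1_def)
  have u: "P (i, j) \<longleftrightarrow> P (i, j + 1)" for i j
    using assms(3)[of "(i, j)"] by (simp add: e2_def)
  have "P (i, 0)" for i
  proof (induction i rule: int_induct[where k = 0])
    case base then show ?case using assms(1) by (simp add: zero_prod_def)
  next
    case (step1 i) then show ?case using r by blast
  next
    case (step2 i) then show ?case using r[of "i - 1" 0] by simp
  qed
  then have "P (i, j)" for i j
  proof (induction j rule: int_induct[where k = 0])
    case base then show ?case .
  next
    case (step1 j) then show ?case using u by blast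
  next
    case (step2 j) then show ?case using u[of i "j - 1"] by simp
  qed
  then show ?thesis by (cases n) auto
qed

lemma position_map_unique:
  assumes "position_map a b w p" "position_map a b w p'"
  shows "p = p'"
proof
  fix n
  show "p n = p' n"
    by (induction n rule: plane_induct) (use assms in \<open>simp_all add: position_map_def\<close>)
qed

lemma in_translate: "(z::point) \<in> (+) v ` S \<longleftrightarrow> z - v \<in> S"
proof
  assume "z - v \<in> S"
  then have "v + (z - v) \<in> (+) v ` S" by (rule imageI)
  then show "z \<in> (+) v ` S" by simp
qed auto

text \<open>Every point has exactly one owner \<open>n\<close>. Partitions are built, shifted and
  composed in this form, where only the owner has to be traced.\<close>

lemma partition_iff:
  "placed_supports_partition S w p \<longleftrightarrow> (\<forall>z. \<exists>!n. z - p n \<in> S (w n))"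
proof
  assume P: "placed_supports_partition S w p"
  show "\<forall>z. \<exists>!n. z - p n \<in> S (w n)"
  proof
    fix z
    have "z \<in> (\<Union>n. (+) (p n) ` S (w n))" using P by (simp add: placed_supports_partition_def)
    then obtain n where n: "z \<in> (+) (p n) ` S (w n)" by blast
    have "m = n" if "z - p m \<in> S (w m)" for m
    proof (rule ccontr)
      assume "m \<noteq> n"
      then have "(+) (p m) ` S (w m) \<inter> (+) (p n) ` S (w n) = {}"
        using P unfolding placed_supports_partition_def disjoint_family_on_def by blast
      moreover have "z \<in> (+) (p m) ` S (w m)" using that unfolding in_translate .
      ultimately show False using n by blast
    qed
    then show "\<exists>!n. z - p n \<in> S (w n)" using n unfolding in_translate by blast
  qed
next
  assume E: "\<forall>z. \<exists>!n. z - p n \<in> S (w n)"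
  have "z \<in> (\<Union>n. (+) (p n) ` S (w n))" for z
    using E[rule_format, of z] unfolding in_translate UN_iff by blast
  moreover have "(+) (p m) ` S (w m) \<inter> (+) (p n) ` S (w n) = {}" if "m \<noteq> n" for m n
  proof (rule ccontr)
    assume "\<not> ?thesis"
    then obtain z where "z \<in> (+) (p m) ` S (w m)" "z \<in> (+) (p n) ` S (w n)" by blast
    then have "z - p m \<in> S (w m)" "z - p n \<in> S (w n)" unfolding in_translate by blast+
    then show False using E[rule_format, of z] that by blast
  qed
  ultimately show "placed_supports_partition S w p"
    unfolding placed_supports_partition_def disjoint_family_on_def by blast
qed

lemma image_by_partition:
  assumes "image_by C a b w p x" shows "\<exists>!n. z - p n \<in> support C (w n)"
  using assms by (simp add: image_by_def partition_iff)

lemma image_by_obtain: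
  assumes "image_by C a b w p x"
  obtains n s where "z = p n + s" "s \<in> support C (w n)"
proof -
  obtain n where "z - p n \<in> support C (w n)" using image_by_partition[OF assms] by blast
  moreover have "z = p n + (z - p n)" by simp
  ultimately show ?thesis using that by blast
qed

lemma image_by_inj:
  assumes "image_by C a b w p x" "p n + s = p m + t" "s \<in> support C (w n)" "t \<in> support C (w m)"
  shows "n = m \<and> s = t"
proof -
  have "p n + s - p n = s" by simp
  moreover have "p n + s - p m = t" unfolding assms(2) by simp
  ultimately have "n = m"
    using image_by_partition[OF assms(1), of "p n + s"] assms(3,4) by metis
  then show ?thesis using assms(2) by simp
qed

lemma image_by_position:
  assumes "image_by C a b w p x"
  shows "p 0 = 0" "p (n + e1) = p n + a (w n)" "p (n + e2) = p n + b (w n)"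
  using assms unfolding image_by_def position_map_def by blast+

lemma image_by_value:
  assumes "image_by C a b w p x" "(s, c) \<in> set (C (w n))"
  shows "x (p n + s) = c"
  using assms unfolding image_by_def by fast

text \<open>The recurrences determine the position map, and the partition leaves no cell without a
  value. Hence any given image of \<open>w\<close> can be exchanged for one constructed with
  additional properties.\<close>

lemma image_by_unique:
  assumes "image_by C a b w p x" "image_by C a b w p' x'"
  shows "p = p' \<and> x = x'"
proof -
  have p: "p = p'"
    by (rule position_map_unique[of a b w]) (use assms in \<open>simp_all add: image_by_def\<close>)
  have "x z = x' z" for z
  proof -
    obtain n s where z: "z = p n + s" and "s \<in> support C (w n)" by (rule image_by_obtain[OF assms(1)])
    then obtain c where c: "(s, c) \<in> set (C (w n))" by (auto simp: support_def)
    show ?thesis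
      using image_by_value[OF assms(1) c] image_by_value[OF assms(2) c] p z by simp
  qed
  then show ?thesis using p by auto
qed

text \<open>A position map vanishes at the origin, so moving the origin of \<open>w\<close> to
  \<open>n\<close> subtracts \<open>p n\<close> and moves the origin of the image to
  \<open>p n\<close>.\<close>

lemma image_by_shift:
  assumes "image_by C a b w p x"
  shows "image_by C a b (shift n w) (\<lambda>m. p (m + n) - p n) (shift (p n) x)"
proof -
  have "\<exists>!m. z - (p (m + n) - p n) \<in> support C (w (m + n))" for z
  proof -
    obtain k where k: "z + p n - p k \<in> support C (w k)"
      and uk: "\<And>k'. z + p n - p k' \<in> support C (w k') \<Longrightarrow> k' = k"
      using image_by_partition[OF assms, of "z + p n"] by blast
    show ?thesis
    proof (intro ex1I[of _ "k - n"])
      show "z - (p (k - n + n) - p n) \<in> support C (w (k - n + n))"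
        using k by (simp add: algebra_simps)
      show "m = k - n" if "z - (p (m + n) - p n) \<in> support C (w (m + n))" for m
        using uk[of "m + n"] that by (simp add: algebra_simps)
    qed
  qed
  moreover have "position_map a b (shift n w) (\<lambda>m. p (m + n) - p n)"
    unfolding position_map_def shift_def
  proof (intro conjI allI)
    fix m
    have c: "m + e1 + n = (m + n) + e1" "m + e2 + n = (m + n) + e2" by (simp_all add: ac_simps)
    show "p (m + e1 + n) - p n = p (m + n) - p n + a (w (m + n))"
      "p (m + e2 + n) - p n = p (m + n) - p n + b (w (m + n))"
      unfolding c image_by_position[OF assms] by (simp_all only: diff_add_eq)
  qed simp
  moreover have "\<forall>m. \<forall>(s, c)\<in>set (C (shift n w m)). shift (p n) x (p (m + n) - p n + s) = c"
  proof (intro allI ballI, unfold case_prod_beta)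
    fix m z assume "z \<in> set (C (shift n w m))"
    then have "x (p (m + n) + fst z) = snd z"
      using image_by_value[OF assms, of "fst z" "snd z" "m + n"] by (simp add: shift_def)
    moreover have "p (m + n) - p n + fst z + p n = p (m + n) + fst z" by (simp add: algebra_simps)
    ultimately show "shift (p n) x (p (m + n) - p n + fst z) = snd z" by (simp only: shift_def)
  qed
  ultimately show ?thesis
    by (simp add: image_by_def partition_iff shift_def)
qed

lemma shift_shift: "shift m (shift n x) = shift (m + n) x"
  by (simp add: shift_def fun_eq_iff add.assoc)

lemma shift_zero [simp]: "shift 0 x = x"
  by (simp add: shift_def)

lemma shift_cancel: "shift n x = shift n y \<longleftrightarrow> x = y"
proof
  assume "shift n x = shift n y"
  then have "shift (- n) (shift n x) = shift (- n) (shift n y)" by simp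
  then show "x = y" by (simp add: shift_shift)
qed simp

text \<open>Such a family of patches realises every configuration of \<open>Y\<close> as a configuration of \<open>X\<close>,
  and the decomposition into patches can be read off uniquely from the result.\<close>

definition embeds ::
  "(point \<Rightarrow> 'u) set \<Rightarrow> (point \<Rightarrow> 't) set \<Rightarrow> ('u \<Rightarrow> (point \<times> 't) list) \<Rightarrow>
   ('u \<Rightarrow> point) \<Rightarrow> ('u \<Rightarrow> point) \<Rightarrow> bool" where
  "embeds Y X C a b \<longleftrightarrow>
     (\<forall>w\<in>Y. \<forall>n. distinct (map fst (C (w n)))) \<and>
     (\<forall>w\<in>Y. \<exists>p x. image_by C a b w p x \<and> x \<in> X) \<and>
     (\<forall>w\<in>Y. \<forall>w'\<in>Y. \<forall>p x p' x' k k'. image_by C a b w p x \<longrightarrow> image_by C a b w' p' x' \<longrightarrow>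
        k \<in> support C (w 0) \<longrightarrow> k' \<in> support C (w' 0) \<longrightarrow> shift k x = shift k' x' \<longrightarrow>
        w = w' \<and> k = k')"

text \<open>Surjectivity up to translation: \<open>k\<close> tells where the origin of
  \<open>x\<close> lies inside the patch that owns it.\<close>

definition covers ::
  "(point \<Rightarrow> 'u) set \<Rightarrow> (point \<Rightarrow> 't) set \<Rightarrow> ('u \<Rightarrow> (point \<times> 't) list) \<Rightarrow>
   ('u \<Rightarrow> point) \<Rightarrow> ('u \<Rightarrow> point) \<Rightarrow> bool" where
  "covers Y X C a b \<longleftrightarrow>
     (\<forall>x\<in>X. \<exists>w\<in>Y. \<exists>p y k. image_by C a b w p y \<and> k \<in> support C (w 0) \<and> x = shift k y)"

lemma embeds_distinct: "embeds Y X C a b \<Longrightarrow> w \<in> Y \<Longrightarrow> distinct (map fst (C (w n)))"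
  by (auto simp: embeds_def)

lemma embeds_image:
  assumes "embeds Y X C a b" "w \<in> Y"
  obtains p x where "image_by C a b w p x" "x \<in> X"
  using assms unfolding embeds_def by blast

lemma embeds_recognizable:
  assumes "embeds Y X C a b" "w \<in> Y" "w' \<in> Y" "image_by C a b w p x" "image_by C a b w' p' x'"
    "k \<in> support C (w 0)" "k' \<in> support C (w' 0)" "shift k x = shift k' x'"
  shows "w = w' \<and> k = k'"
  using assms unfolding embeds_def by blast

text \<open>\<open>off u s\<close> is the displacement, in the fine grid, of the inner patch at cell
  \<open>s\<close>. Inner patches differ in size, so it depends on the letter \<open>u\<close> as
  well.\<close>

definition compose_patches ::
  "('u \<Rightarrow> (point \<times> 'v) list) \<Rightarrow> ('u \<Rightarrow> point \<Rightarrow> point) \<Rightarrow>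
   ('v \<Rightarrow> (point \<times> 't) list) \<Rightarrow> 'u \<Rightarrow> (point \<times> 't) list" where
  "compose_patches D off C u =
     concat (map (\<lambda>(s, t). map (\<lambda>(r, c). (off u s + r, c)) (C t)) (D u))"

lemma distinct_map_fst_concat:
  assumes "distinct (map fst xs)"
    and "\<And>s t. (s, t) \<in> set xs \<Longrightarrow> distinct (map fst (f s t))"
    and "\<And>s t s' t'. (s, t) \<in> set xs \<Longrightarrow> (s', t') \<in> set xs \<Longrightarrow> s \<noteq> s' \<Longrightarrow>
          fst ` set (f s t) \<inter> fst ` set (f s' t') = {}"
  shows "distinct (map fst (concat (map (\<lambda>(s, t). f s t) xs)))"
  using assms
proof (induction xs)
  case Nil then show ?case by simp
next
  case (Cons x xs)
  obtain s t where x: "x = (s, t)" by (cases x)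
  have IH: "distinct (map fst (concat (map (\<lambda>(s, t). f s t) xs)))"
    by (rule Cons.IH) (use Cons.prems in auto)
  have "fst ` set (f s t) \<inter> fst ` set (f s' t') = {}" if "(s', t') \<in> set xs" for s' t'
  proof (rule Cons.prems(3))
    show "s \<noteq> s'" using Cons.prems(1) that x by force
  qed (use that x in auto)
  then show ?case using IH Cons.prems(2)[of s t] x by fastforce
qed

lemma support_compose_patches:
  "z \<in> support (compose_patches D off C) u \<longleftrightarrow>
     (\<exists>s t r. (s, t) \<in> set (D u) \<and> r \<in> support C t \<and> z = off u s + r)"
  by (auto simp: support_def compose_patches_def image_iff) force+

text \<open>A fine cell has one owner \<open>m\<close> in the middle grid, and \<open>m\<close> has
  one owner \<open>n\<close> in the coarse grid; this gives existence and uniqueness of the composed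
  owner. The hypotheses on \<open>off\<close>, \<open>a'\<close> and \<open>b'\<close> say that
  displacements across a coarse patch can be read off from its letter.\<close>

lemma image_by_compose:
  assumes q: "image_by D a0 b0 w q y" and p: "image_by C a b y p x"
    and off: "\<And>n s t. (s, t) \<in> set (D (w n)) \<Longrightarrow> p (q n + s) = p (q n) + off (w n) s"
    and a': "\<And>n. p (q n + a0 (w n)) = p (q n) + a' (w n)"
    and b': "\<And>n. p (q n + b0 (w n)) = p (q n) + b' (w n)"
  shows "image_by (compose_patches D off C) a' b' w (\<lambda>n. p (q n)) x"
proof -
  have pos: "position_map a' b' w (\<lambda>n. p (q n))"
    using image_by_position[OF q] image_by_position[OF p] a' b' by (simp add: position_map_def)
  have val: "y (q n + s) = t" if "(s, t) \<in> set (D (w n))" for n s t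
    using image_by_value[OF q that] .
  have "\<exists>!n. z - p (q n) \<in> support (compose_patches D off C) (w n)" for z
  proof -
    obtain m r where m: "z = p m + r" "r \<in> support C (y m)" by (rule image_by_obtain[OF p])
    obtain n s where n: "m = q n + s" "s \<in> support D (w n)" by (rule image_by_obtain[OF q])
    then obtain t where t: "(s, t) \<in> set (D (w n))" by (auto simp: support_def)
    show ?thesis
    proof (rule ex1I[of _ n])
      have "z - p (q n) = off (w n) s + r" using m n off[OF t] by (simp add: algebra_simps)
      then show "z - p (q n) \<in> support (compose_patches D off C) (w n)"
        unfolding support_compose_patches using t m(2) val[OF t] n(1) by auto
    next
      fix n' assume "z - p (q n') \<in> support (compose_patches D off C) (w n')"
      then obtain s' t' r' where s': "(s', t') \<in> set (D (w n'))" "r' \<in> support C t'"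
        and z: "z - p (q n') = off (w n') s' + r'"
        unfolding support_compose_patches by blast
      have "p (q n' + s') + r' = p m + r" using z m off[OF s'(1)] by (simp add: algebra_simps)
      then have "q n' + s' = m"
        using image_by_inj[OF p _ _ m(2), of "q n' + s'" r'] s' val[OF s'(1)] by metis
      then show "n' = n"
        using image_by_inj[OF q _ _ n(2), of n' s'] s'(1) n(1) by (force simp: support_def)
    qed
  qed
  moreover have "x (p (q n) + z) = c" if zc: "(z, c) \<in> set (compose_patches D off C (w n))" for n z c
  proof -
    obtain s t r where s: "(s, t) \<in> set (D (w n))" "(r, c) \<in> set (C t)" "z = off (w n) s + r"
      using zc by (auto simp: compose_patches_def)
    have "(r, c) \<in> set (C (y (q n + s)))" using s val[OF s(1)] by simp
    from image_by_value[OF p this] show ?thesis using s off[OF s(1)] by (simp add: algebra_simps)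
  qed
  ultimately show ?thesis using pos unfolding image_by_def partition_iff by blast
qed

locale composable =
  fixes Z :: "(point \<Rightarrow> 'u) set" and Y :: "(point \<Rightarrow> 'v) set" and X :: "(point \<Rightarrow> 't) set"
    and D :: "'u \<Rightarrow> (point \<times> 'v) list" and a0 b0 :: "'u \<Rightarrow> point"
    and C :: "'v \<Rightarrow> (point \<times> 't) list" and a b :: "'v \<Rightarrow> point"
    and off :: "'u \<Rightarrow> point \<Rightarrow> point" and a' b' :: "'u \<Rightarrow> point"
  assumes step: "embeds Z Y D a0 b0" and emb: "embeds Y X C a b"
    and Y_shift: "\<And>y n. y \<in> Y \<Longrightarrow> shift n y \<in> Y"
    and off: "\<And>w q y p x n s t. w \<in> Z \<Longrightarrow> y \<in> Y \<Longrightarrow> image_by D a0 b0 w q y \<Longrightarrow> image_by C a b y p x \<Longrightarrow>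
        (s, t) \<in> set (D (w n)) \<Longrightarrow> p (q n + s) = p (q n) + off (w n) s"
    and a': "\<And>w q y p x n. w \<in> Z \<Longrightarrow> y \<in> Y \<Longrightarrow> image_by D a0 b0 w q y \<Longrightarrow> image_by C a b y p x \<Longrightarrow>
        p (q n + a0 (w n)) = p (q n) + a' (w n)"
    and b': "\<And>w q y p x n. w \<in> Z \<Longrightarrow> y \<in> Y \<Longrightarrow> image_by D a0 b0 w q y \<Longrightarrow> image_by C a b y p x \<Longrightarrow>
        p (q n + b0 (w n)) = p (q n) + b' (w n)"
begin

lemma decompose:
  assumes w: "w \<in> Z"
  obtains q y p x where "image_by D a0 b0 w q y" "y \<in> Y" "image_by C a b y p x" "x \<in> X"
    "image_by (compose_patches D off C) a' b' w (\<lambda>n. p (q n)) x"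
proof -
  obtain q y where q: "image_by D a0 b0 w q y" "y \<in> Y" by (rule embeds_image[OF step w])
  obtain p x where p: "image_by C a b y p x" "x \<in> X" by (rule embeds_image[OF emb q(2)])
  have "image_by (compose_patches D off C) a' b' w (\<lambda>n. p (q n)) x"
    by (rule image_by_compose[OF q(1) p(1)]) (use off a' b' w q p in blast)+
  then show ?thesis using that q p by blast
qed

lemma decompose_support:
  assumes "w \<in> Z" "image_by D a0 b0 w q y" "y \<in> Y" "image_by C a b y p x"
    "k \<in> support (compose_patches D off C) (w 0)"
  obtains s r where "s \<in> support D (w 0)" "r \<in> support C (y s)" "k = r + p s"
proof -
  obtain s t r where s: "(s, t) \<in> set (D (w 0))" "r \<in> support C t" "k = off (w 0) s + r"
    using assms(5) unfolding support_compose_patches by blast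
  have "p (q 0 + s) = p (q 0) + off (w 0) s" by (rule off) (use assms s in auto)
  moreover have "y (q 0 + s) = t" by (rule image_by_value[OF assms(2) s(1)])
  moreover have "q 0 = 0" "p 0 = 0" using assms image_by_position by auto
  moreover have "s \<in> support D (w 0)" using s(1) by (force simp: support_def)
  ultimately show ?thesis using s that[of s r] by (simp add: add.commute)
qed

text \<open>Recognizability is applied from the inside outwards. An offset splits as
  \<open>k = t + r s\<close> with \<open>s\<close> a cell of the coarse patch. Recentring
  \<open>y\<close> at \<open>s\<close> brings the inner patch to the origin, so the inner
  decomposition identifies the recentred arrays and the inner offsets; the coarse one then
  identifies \<open>w\<close> and \<open>s\<close>.\<close>

lemma composed: "embeds Z X (compose_patches D off C) a' b'"
  unfolding embeds_def
proof (intro conjI ballI allI impI)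
  fix w n assume w: "w \<in> Z"
  obtain q y p x where d: "image_by D a0 b0 w q y" "y \<in> Y" "image_by C a b y p x" "x \<in> X"
    using decompose[OF w] by metis
  have val: "y (q n + s) = t" if "(s, t) \<in> set (D (w n))" for s t
    using image_by_value[OF d(1) that] .
  have off': "p (q n + s) = p (q n) + off (w n) s" if "(s, t) \<in> set (D (w n))" for s t
    using off[OF w d(2,1,3) that] .
  show "distinct (map fst (compose_patches D off C (w n)))"
    unfolding compose_patches_def
  proof (rule distinct_map_fst_concat)
    show "distinct (map fst (D (w n)))" using embeds_distinct[OF step w] .
    show "distinct (map fst (map (\<lambda>(r, c). (off (w n) s + r, c)) (C t)))"
      if "(s, t) \<in> set (D (w n))" for s t
    proof -
      have "distinct (map fst (C t))" using embeds_distinct[OF emb d(2), of "q n + s"] val[OF that] by simp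
      then have "distinct (map (\<lambda>r. off (w n) s + r) (map fst (C t)))"
        by (simp add: distinct_map inj_on_def)
      then show ?thesis by (simp add: comp_def case_prod_unfold)
    qed
    fix s t s' t' assume st: "(s, t) \<in> set (D (w n))" "(s', t') \<in> set (D (w n))" "s \<noteq> s'"
    show "fst ` set (map (\<lambda>(r, c). (off (w n) s + r, c)) (C t)) \<inter>
          fst ` set (map (\<lambda>(r, c). (off (w n) s' + r, c)) (C t')) = {}"
    proof (rule ccontr)
      assume "\<not> ?thesis"
      then obtain r c r' c' where r: "(r, c) \<in> set (C t)" "(r', c') \<in> set (C t')"
        "off (w n) s + r = off (w n) s' + r'" by fastforce
      then have "p (q n + s) + r = p (q n + s') + r'" using off'[OF st(1)] off'[OF st(2)] by simp
      moreover have "r \<in> support C (y (q n + s))" "r' \<in> support C (y (q n + s'))"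
        unfolding val[OF st(1)] val[OF st(2)] support_def using r by force+
      \<comment> \<open>A cell common to two inner patches would have two owners in the middle
        grid.\<close>
      ultimately have "q n + s = q n + s'" using image_by_inj[OF d(3)] by blast
      then show False using st by simp
    qed
  qed
next
  fix w assume "w \<in> Z"
  then show "\<exists>p x. image_by (compose_patches D off C) a' b' w p x \<and> x \<in> X" by (metis decompose)
next
  fix w w' p x p' x' k k'
  assume W: "w \<in> Z" "w' \<in> Z" and I: "image_by (compose_patches D off C) a' b' w p x"
      "image_by (compose_patches D off C) a' b' w' p' x'"
    and k: "k \<in> support (compose_patches D off C) (w 0)" "k' \<in> support (compose_patches D off C) (w' 0)"
    and eq: "shift k x = shift k' x'"
  obtain q y r where d: "image_by D a0 b0 w q y" "y \<in> Y" "image_by C a b y r x"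
    using decompose[OF W(1)] image_by_unique[OF I(1)] by metis
  obtain q' y' r' where d': "image_by D a0 b0 w' q' y'" "y' \<in> Y" "image_by C a b y' r' x'"
    using decompose[OF W(2)] image_by_unique[OF I(2)] by metis
  obtain s t where s: "s \<in> support D (w 0)" "t \<in> support C (y s)" "k = t + r s"
    by (rule decompose_support[OF W(1) d k(1)])
  obtain s' t' where s': "s' \<in> support D (w' 0)" "t' \<in> support C (y' s')" "k' = t' + r' s'"
    by (rule decompose_support[OF W(2) d' k(2)])
  have "shift s y = shift s' y' \<and> t = t'"
    by (rule embeds_recognizable[OF emb Y_shift[OF d(2)] Y_shift[OF d'(2)] image_by_shift[OF d(3)] image_by_shift[OF d'(3)]])
      (use s s' eq in \<open>auto simp: shift_shift shift_def[of _ y] shift_def[of _ y']\<close>)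
  moreover from this have "w = w' \<and> s = s'"
    by (intro embeds_recognizable[OF step W d(1) d'(1)]) (use s s' in auto)
  moreover from this have "r = r'"
    using d d' \<open>shift s y = shift s' y' \<and> t = t'\<close> shift_cancel image_by_unique by metis
  ultimately show "w = w'" "k = k'" using s s' by auto
qed

text \<open>Preimages are taken one after the other; the inner position map carries the intermediate
  offset \<open>s\<close> into the fine grid, as \<open>r s\<close>.\<close>

lemma composed_covers:
  assumes "covers Z Y D a0 b0" "covers Y X C a b" and X_shift: "\<And>x n. x \<in> X \<Longrightarrow> shift n x \<in> X"
  shows "covers Z X (compose_patches D off C) a' b'"
  unfolding covers_def
proof
  fix x assume "x \<in> X"
  then obtain y p x' k where y: "y \<in> Y" "image_by C a b y p x'" "k \<in> support C (y 0)" "x = shift k x'"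
    using assms(2) unfolding covers_def by blast
  then obtain w q y' s where w: "w \<in> Z" "image_by D a0 b0 w q y'" "s \<in> support D (w 0)" "y = shift s y'"
    using assms(1) unfolding covers_def by blast
  have "y' \<in> Y" using embeds_image[OF step w(1)] image_by_unique[OF w(2)] by metis
  then obtain r z where z: "image_by C a b y' r z" "z \<in> X" by (rule embeds_image[OF emb])
  have "x' = shift (r s) z"
    using image_by_unique[OF y(2)] image_by_shift[OF z(1), of s] w(4) by metis
  then have x: "x = shift (k + r s) z" using y(4) by (simp add: shift_shift)
  have im: "image_by (compose_patches D off C) a' b' w (\<lambda>n. r (q n)) z"
    by (rule image_by_compose[OF w(2) z(1)]) (use off a' b' w z \<open>y' \<in> Y\<close> in blast)+
  obtain t where t: "(s, t) \<in> set (D (w 0))" using w(3) by (auto simp: support_def)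
  have "r (q 0 + s) = r (q 0) + off (w 0) s" by (rule off[OF w(1) \<open>y' \<in> Y\<close> w(2) z(1) t])
  then have "r s = off (w 0) s" using image_by_position(1)[OF w(2)] image_by_position(1)[OF z(1)] by simp
  moreover have "y 0 = t"
    using image_by_value[OF w(2) t] image_by_position(1)[OF w(2)] w(4) by (simp add: shift_def)
  ultimately have "k + r s \<in> support (compose_patches D off C) (w 0)"
    unfolding support_compose_patches using t y(3) by (auto simp: add.commute)
  then show "\<exists>w\<in>Z. \<exists>p y k. image_by (compose_patches D off C) a' b' w p y \<and>
      k \<in> support (compose_patches D off C) (w 0) \<and> x = shift k y"
    using w(1) im x by blast
qed

end

section \<open>Substitution by words along one axis\<close>

definition nn_shift :: "dominoes \<Rightarrow> dominoes \<Rightarrow> (point \<Rightarrow> nat) set" where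
  "nn_shift H V = {w. \<forall>n. (w n, w (n + e1)) \<in> set H \<and> (w n, w (n + e2)) \<in> set V}"

text \<open>The flag \<open>d\<close> exchanges the roles of the two axes, so that horizontal and vertical steps
  are treated at once: \<open>A\<close> is the relation along the axis and \<open>B\<close> the relation across it.\<close>

definition nn :: "bool \<Rightarrow> dominoes \<Rightarrow> dominoes \<Rightarrow> (point \<Rightarrow> nat) set" where
  "nn d A B = (if d then nn_shift B A else nn_shift A B)"

definition pt :: "bool \<Rightarrow> int \<Rightarrow> int \<Rightarrow> point" where
  "pt d i j = (if d then (j, i) else (i, j))"

lemma pt_inject [simp]: "pt d i j = pt d i' j' \<longleftrightarrow> i = i' \<and> j = j'"
  by (auto simp: pt_def)

lemma pt_add [simp]: "pt d i j + pt d i' j' = pt d (i + i') (j + j')"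
  by (simp add: pt_def)

lemma pt_diff [simp]: "pt d i j - pt d i' j' = pt d (i - i') (j - j')"
  by (simp add: pt_def)

lemma pt_zero [simp]: "pt d 0 0 = 0"
  by (simp add: pt_def zero_prod_def)

lemma pt_cases: obtains i j where "n = pt d i j"
  by (cases n, cases d) (auto simp: pt_def)

lemma nn_iff:
  "w \<in> nn d A B \<longleftrightarrow> (\<forall>i j. (w (pt d i j), w (pt d (i + 1) j)) \<in> set A \<and>
                          (w (pt d i j), w (pt d i (j + 1))) \<in> set B)"
proof -
  have s: "w \<in> nn_shift A B \<longleftrightarrow> (\<forall>i j. (w (i, j), w (i + 1, j)) \<in> set A \<and> (w (i, j), w (i, j + 1)) \<in> set B)"
    for A B unfolding nn_shift_def e1_def e2_def by (simp add: split_paired_All)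
  show ?thesis by (cases d) (auto simp: nn_def s pt_def)
qed

lemma nn_shift_closed: "w \<in> nn d A B \<Longrightarrow> shift n w \<in> nn d A B"
proof (rule pt_cases[of n d])
  fix i j assume w: "w \<in> nn d A B" and n: "n = pt d i j"
  have "i' + 1 + i = (i' + i) + 1" "j' + 1 + j = (j' + j) + 1" for i' j' by simp_all
  then show "shift n w \<in> nn d A B" using w by (simp only: nn_iff shift_def n pt_add simp_thms)
qed

text \<open>Entry \<open>u\<close> of the table \<open>tab\<close> is the word replacing the letter \<open>u\<close>.\<close>

definition word_patch :: "bool \<Rightarrow> nat list list \<Rightarrow> nat \<Rightarrow> (point \<times> nat) list" where
  "word_patch d tab u = map (\<lambda>i. (pt d (int i) 0, tab ! u ! i)) [0..<length (tab ! u)]"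

definition word_a :: "bool \<Rightarrow> nat list list \<Rightarrow> nat \<Rightarrow> point" where
  "word_a d tab u = (if d then (1, 0) else (int (length (tab ! u)), 0))"

definition word_b :: "bool \<Rightarrow> nat list list \<Rightarrow> nat \<Rightarrow> point" where
  "word_b d tab u = (if d then (0, int (length (tab ! u))) else (0, 1))"

lemma position_map_word:
  "position_map (word_a d tab) (word_b d tab) w q \<longleftrightarrow>
     q 0 = 0 \<and> (\<forall>n. q (n + pt d 1 0) = q n + pt d (int (length (tab ! w n))) 0) \<and>
     (\<forall>n. q (n + pt d 0 1) = q n + pt d 0 1)"
  by (cases d) (auto simp: position_map_def word_a_def word_b_def pt_def e1_def e2_def)

lemma support_word_patch:
  "z \<in> support (word_patch d tab) u \<longleftrightarrow> (\<exists>r<length (tab ! u). z = pt d (int r) 0)"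
  by (force simp: support_def word_patch_def)

section \<open>Two-sided increasing sequences of integers\<close>

lemma int_partial_sums:
  fixes c :: "int \<Rightarrow> int"
  obtains q where "q 0 = 0" "\<And>i. q (i + 1) = q i + c i"
proof (rule that[of "\<lambda>i. if i \<ge> 0 then sum c {0..<i} else - sum c {i..<0}"])
  let ?q = "\<lambda>i. if i \<ge> 0 then sum c {0..<i} else - sum c {i..<0}"
  fix i :: int
  show "?q (i + 1) = ?q i + c i"
  proof (cases "i \<ge> 0")
    case True
    then have "{0..<i + 1} = insert i {0..<i}" by auto
    then show ?thesis using True by simp
  next
    case False
    then have "{i..<0} = insert i {i + 1..<0}" by auto
    then show ?thesis using False by (cases "i + 1 = 0") auto
  qed
qed simp

lemma increasing_mono:
  fixes q :: "int \<Rightarrow> int"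
  assumes "\<And>i. q i < q (i + 1)"
  shows "i \<le> j \<Longrightarrow> q i \<le> q j" and "q i < q j \<longleftrightarrow> i < j"
proof -
  have le: "q i \<le> q j" if "i \<le> j" for i j
    using that
  proof (induction j rule: int_ge_induct)
    case (step k)
    then show ?case using assms[of k] by linarith
  qed simp
  then show "i \<le> j \<Longrightarrow> q i \<le> q j" .
  have "q i < q j" if "i < j" using le[of "i + 1" j] assms[of i] that by linarith
  moreover have "q j \<le> q i" if "\<not> i < j" using le[of j i] that by linarith
  ultimately show "q i < q j \<longleftrightarrow> i < j" by linarith
qed

lemma increasing_partition:
  fixes q :: "int \<Rightarrow> int"
  assumes inc: "\<And>i. q i < q (i + 1)" and "q 0 = 0"
  shows "\<exists>!i. q i \<le> x \<and> x < q (i + 1)"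
proof -
  have "\<exists>i. q i \<le> x \<and> x < q (i + 1)"
  proof (induction x rule: int_induct[where k = 0])
    case base
    show ?case using assms(2) inc[of 0] by (intro exI[of _ 0]) auto
  next
    case (step1 x)
    then obtain i where i: "q i \<le> x" "x < q (i + 1)" by blast
    then have "q i \<le> x + 1 \<and> x + 1 < q (i + 1) \<or> q (i + 1) \<le> x + 1 \<and> x + 1 < q (i + 1 + 1)"
      using inc[of "i + 1"] by linarith
    then show ?case by blast
  next
    case (step2 x)
    then obtain i where i: "q i \<le> x" "x < q (i + 1)" by blast
    then have "q i \<le> x - 1 \<and> x - 1 < q (i + 1) \<or> q (i - 1) \<le> x - 1 \<and> x - 1 < q (i - 1 + 1)"
      using inc[of "i - 1"] by simp linarith
    then show ?case by blast
  qed
  moreover have "i = j" if "q i \<le> x" "x < q (i + 1)" "q j \<le> x" "x < q (j + 1)" for i j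
  proof -
    have "q i < q (j + 1)" "q j < q (i + 1)" using that by linarith+
    then show ?thesis using increasing_mono(2)[of q, OF inc] by fastforce
  qed
  ultimately show ?thesis by blast
qed

text \<open>Two increasing enumerations of the same set differ by a shift of the index, which the
  condition \<open>s 0 \<le> 0 < s 1\<close> removes. In the application it says that the word
  starting at \<open>s 0\<close> contains the origin.\<close>

lemma increasing_unique:
  fixes s t :: "int \<Rightarrow> int"
  assumes s: "\<And>i. s i < s (i + 1)" and t: "\<And>i. t i < t (i + 1)" and r: "range s = range t"
    and s0: "s 0 \<le> 0" "0 < s 1" and t0: "t 0 \<le> 0" "0 < t 1"
  shows "s = t"
proof
  \<comment> \<open>A value of \<open>t'\<close> above \<open>s' (i - 1)\<close> is itself a value
    of \<open>s'\<close>, hence at least \<open>s' i\<close>; \<open>ge\<close> is the mirror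
    image.\<close>
  have le: "s' i \<le> t' j"
    if S: "\<And>i. s' i < s' (i + 1)" and R: "range s' = range t'" and b: "t' j > s' (i - 1)"
    for s' t' :: "int \<Rightarrow> int" and i j
  proof -
    obtain m where m: "t' j = s' m" using R by (metis UNIV_I image_iff)
    then have "i - 1 < m" using b increasing_mono(2)[of s', OF S] by simp
    then show ?thesis using m increasing_mono(1)[of s' i m, OF S] by simp
  qed
  have ge: "t' j \<le> s' i"
    if S: "\<And>i. s' i < s' (i + 1)" and R: "range s' = range t'" and b: "t' j < s' (i + 1)"
    for s' t' :: "int \<Rightarrow> int" and i j
  proof -
    obtain m where m: "t' j = s' m" using R by (metis UNIV_I image_iff)
    then have "m < i + 1" using b increasing_mono(2)[of s', OF S] by simp
    then show ?thesis using m increasing_mono(1)[of s' m i, OF S] by simp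
  qed
  fix i show "s i = t i"
  proof (induction i rule: int_induct[where k = 0])
    case base
    have "t 0 \<le> s 0" by (rule ge[OF s r]) (use s0 t0 in simp)
    moreover have "s 0 \<le> t 0" by (rule ge[OF t r[symmetric]]) (use s0 t0 in simp)
    ultimately show ?case by simp
  next
    case (step1 i)
    have "s (i + 1) \<le> t (i + 1)" by (rule le[OF s r]) (use step1 t[of i] in simp)
    moreover have "t (i + 1) \<le> s (i + 1)" by (rule le[OF t r[symmetric]]) (use step1 s[of i] in simp)
    ultimately show ?case by simp
  next
    case (step2 i)
    have "t (i - 1) \<le> s (i - 1)" by (rule ge[OF s r]) (use step2 t[of "i - 1"] in simp)
    moreover have "s (i - 1) \<le> t (i - 1)"
      by (rule ge[OF t r[symmetric]]) (use step2 s[of "i - 1"] in simp)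
    ultimately show ?case by simp
  qed
qed

text \<open>Words in the same line across the axis have equal length, so the cuts are straight lines
  at the coordinates \<open>q i\<close>. Finding the owner of a cell becomes the one-dimensional
  problem solved by \<open>increasing_partition\<close>.\<close>

lemma image_by_word:
  assumes len: "\<And>i j. length (tab ! w (pt d i j)) = L i" and pos: "\<And>i. 0 < L i"
    and q: "q 0 = 0" "\<And>i. q (i + 1) = q i + int (L i)"
    and y: "\<And>i j r. r < L i \<Longrightarrow> y (pt d (q i + int r) j) = tab ! w (pt d i j) ! r"
    and p: "\<And>i j. p (pt d i j) = pt d (q i) j"
  shows "image_by (word_patch d tab) (word_a d tab) (word_b d tab) w p y"
proof -
  have inc: "q i < q (i + 1)" for i using q(2)[of i] pos[of i] by simp
  have "p (pt d 0 0) = pt d 0 0" unfolding p using q(1) by simp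
  then have p0: "p 0 = 0" by simp
  have "p (n + pt d 1 0) = p n + pt d (int (length (tab ! w n))) 0" for n
    by (rule pt_cases[of n d]) (simp add: p q len)
  moreover have "p (n + pt d 0 1) = p n + pt d 0 1" for n
    by (rule pt_cases[of n d]) (simp add: p)
  ultimately have "position_map (word_a d tab) (word_b d tab) w p"
    unfolding position_map_word using p0 by blast
  moreover have "\<exists>!n. z - p n \<in> support (word_patch d tab) (w n)" for z
  proof -
    obtain x j where z: "z = pt d x j" by (rule pt_cases)
    obtain i where i: "q i \<le> x" "x < q (i + 1)"
      and ui: "\<And>i'. q i' \<le> x \<and> x < q (i' + 1) \<Longrightarrow> i' = i"
      using increasing_partition[of q x, OF inc q(1)] by blast
    show ?thesis
    proof (rule ex1I[of _ "pt d i j"])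
      show "z - p (pt d i j) \<in> support (word_patch d tab) (w (pt d i j))"
        unfolding support_word_patch using i q(2)[of i]
        by (intro exI[of _ "nat (x - q i)"]) (auto simp: z p len)
    next
      fix n assume n: "z - p n \<in> support (word_patch d tab) (w n)"
      obtain i' j' where n': "n = pt d i' j'" by (rule pt_cases)
      show "n = pt d i j"
        using n ui[of i'] q(2)[of i'] unfolding support_word_patch n' z p len
        by auto
    qed
  qed
  moreover have "y (p n + s) = c" if sc: "(s, c) \<in> set (word_patch d tab (w n))" for n s c
  proof -
    obtain i j where n: "n = pt d i j" by (rule pt_cases)
    show ?thesis using sc y[of _ i j] by (auto simp: word_patch_def n p len)
  qed
  ultimately show ?thesis unfolding image_by_def partition_iff by blast
qed

text \<open>\<open>A\<close> and \<open>B\<close> constrain the letters, \<open>A'\<close> and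
  \<open>B'\<close> the words put in their place: along the axis inside a word and over the seam to
  the next one, across it position by position. Equal length across the axis keeps the cuts
  straight.\<close>

definition word_ok ::
  "nat list list \<Rightarrow> dominoes \<Rightarrow> dominoes \<Rightarrow> dominoes \<Rightarrow> dominoes \<Rightarrow> bool" where
  "word_ok tab A B A' B' \<longleftrightarrow>
     distinct tab \<and>
     list_all (\<lambda>(u, v). u < length tab \<and> tab ! u \<noteq> [] \<and> (last (tab ! u), hd (tab ! v)) \<in> set A' \<and>
       list_all (\<lambda>p. p \<in> set A') (zip (tab ! u) (tl (tab ! u))) \<and>
       list_all (\<lambda>t. t \<notin> set (map hd tab)) (tl (tab ! u))) A \<and>
     list_all (\<lambda>(u, v). length (tab ! u) = length (tab ! v) \<and>
       list_all (\<lambda>p. p \<in> set B') (zip (tab ! u) (tab ! v))) B"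

context
  fixes d :: bool and tab A B A' B'
  assumes ok: "word_ok tab A B A' B'"
begin

lemma word_ok_along:
  assumes "(u, v) \<in> set A"
  shows "u < length tab" "0 < length (tab ! u)" "(last (tab ! u), hd (tab ! v)) \<in> set A'"
    "r + 1 < length (tab ! u) \<Longrightarrow> (tab ! u ! r, tab ! u ! (r + 1)) \<in> set A'"
    "r < length (tab ! u) \<Longrightarrow> tab ! u ! r \<in> hd ` set tab \<longleftrightarrow> r = 0"
proof -
  have P: "u < length tab" "tab ! u \<noteq> []" "(last (tab ! u), hd (tab ! v)) \<in> set A'"
    "list_all (\<lambda>p. p \<in> set A') (zip (tab ! u) (tl (tab ! u)))"
    "list_all (\<lambda>t. t \<notin> hd ` set tab) (tl (tab ! u))"
    using ok assms unfolding word_ok_def list_all_iff by fastforce+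
  then show "u < length tab" "0 < length (tab ! u)" "(last (tab ! u), hd (tab ! v)) \<in> set A'" by auto
  show "(tab ! u ! r, tab ! u ! (r + 1)) \<in> set A'" if "r + 1 < length (tab ! u)"
    using P(4) that unfolding list_all_length by (auto simp: nth_tl dest: spec[of _ r])
  show "tab ! u ! r \<in> hd ` set tab \<longleftrightarrow> r = 0" if "r < length (tab ! u)"
    using P(1,2,5) that unfolding list_all_length
    by (cases r) (auto simp: nth_tl simp flip: hd_conv_nth)
qed

lemma word_ok_across:
  assumes "(u, v) \<in> set B"
  shows "length (tab ! u) = length (tab ! v)"
    "r < length (tab ! u) \<Longrightarrow> (tab ! u ! r, tab ! v ! r) \<in> set B'"
proof -
  have P: "length (tab ! u) = length (tab ! v)" "list_all (\<lambda>p. p \<in> set B') (zip (tab ! u) (tab ! v))"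
    using ok assms unfolding word_ok_def list_all_iff by fastforce+
  then show "length (tab ! u) = length (tab ! v)" by simp
  show "(tab ! u ! r, tab ! v ! r) \<in> set B'" if "r < length (tab ! u)"
    using P that unfolding list_all_length by (auto dest: spec[of _ r])
qed

lemma word_length_const:
  assumes "w \<in> nn d A B"
  shows "length (tab ! w (pt d i j)) = length (tab ! w (pt d i 0))"
proof (induction j rule: int_induct[where k = 0])
  case (step1 j)
  then show ?case using word_ok_across(1) assms unfolding nn_iff by metis
next
  case (step2 j)
  have "(w (pt d i (j - 1)), w (pt d i (j - 1 + 1))) \<in> set B" using assms nn_iff by blast
  then show ?case using step2 word_ok_across(1) by simp
qed simp

lemma word_image:
  assumes w: "w \<in> nn d A B"
  obtains q p y where "image_by (word_patch d tab) (word_a d tab) (word_b d tab) w p y"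
    "y \<in> nn d A' B'" "\<And>i j. p (pt d i j) = pt d (q i) j" "q 0 = 0"
    "\<And>i. q i < q (i + 1)" "\<And>i j. q (i + 1) = q i + int (length (tab ! w (pt d i j)))"
    "\<And>i j r. r < length (tab ! w (pt d i j)) \<Longrightarrow> y (pt d (q i + int r) j) = tab ! w (pt d i j) ! r"
    "\<And>x. y (pt d x 0) \<in> hd ` set tab \<longleftrightarrow> x \<in> range q"
proof -
  define L where "L i = length (tab ! w (pt d i 0))" for i
  have len: "length (tab ! w (pt d i j)) = L i" for i j
    unfolding L_def by (rule word_length_const[OF w])
  have al: "(w (pt d i j), w (pt d (i + 1) j)) \<in> set A" for i j using w nn_iff by blast
  have ac: "(w (pt d i j), w (pt d i (j + 1))) \<in> set B" for i j using w nn_iff by blast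
  have pos: "0 < L i" for i using word_ok_along(2)[OF al[of i 0]] by (simp add: L_def)
  obtain q :: "int \<Rightarrow> int" where q: "q 0 = 0" "\<And>i. q (i + 1) = q i + int (L i)"
    using int_partial_sums[of "\<lambda>i. int (L i)"] by metis
  have inc: "q i < q (i + 1)" for i using q(2)[of i] pos[of i] by simp
  define I where "I x = (THE i. q i \<le> x \<and> x < q (i + 1))" for x
  have I: "I (q i + int r) = i" if "r < L i" for i r
    unfolding I_def
    by (rule the1_equality[OF increasing_partition[of q, OF inc q(1)]]) (use that q(2)[of i] in auto)
  define y where "y z = (let x = (if d then snd z else fst z); j = (if d then fst z else snd z)
      in tab ! w (pt d (I x) j) ! nat (x - q (I x)))" for z
  have y: "y (pt d (q i + int r) j) = tab ! w (pt d i j) ! r" if "r < L i" for i j r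
  proof -
    have "y (pt d x j) = tab ! w (pt d (I x) j) ! nat (x - q (I x))" for x j
      by (simp add: y_def pt_def)
    then show ?thesis using I[OF that] by simp
  qed
  define p where "p n = (if d then (fst n, q (snd n)) else (q (fst n), snd n))" for n
  have p: "p (pt d i j) = pt d (q i) j" for i j by (simp add: p_def pt_def)
  have split: "\<exists>i r. r < L i \<and> x = q i + int r" for x
  proof -
    obtain i where "q i \<le> x" "x < q (i + 1)" using increasing_partition[of q x, OF inc q(1)] by blast
    then show ?thesis using q(2)[of i] by (intro exI[of _ i] exI[of _ "nat (x - q i)"]) auto
  qed
  have "y \<in> nn d A' B'"
    unfolding nn_iff
  proof (intro allI conjI)
    fix x j
    obtain i r where x: "r < L i" "x = q i + int r" using split by blast
    show "(y (pt d x j), y (pt d x (j + 1))) \<in> set B'"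
      using word_ok_across(2)[OF ac[of i j]] y[of r i] x len by simp
    show "(y (pt d x j), y (pt d (x + 1) j)) \<in> set A'"
    proof (cases "r + 1 < L i")
      case True
      then have "y (pt d (x + 1) j) = tab ! w (pt d i j) ! (r + 1)"
        using y[of "r + 1" i j] x by (simp add: algebra_simps)
      then show ?thesis using word_ok_along(4)[OF al[of i j]] True x y[of r i j] len by simp
    next
      case False
      \<comment> \<open>The last letter of a word: the next cell carries the first letter of the
        following word, so the seam condition applies.\<close>
      then have r: "r = L i - 1" using x by simp
      then have "x + 1 = q (i + 1) + int 0" using x q(2)[of i] pos[of i] by simp
      then have "y (pt d (x + 1) j) = tab ! w (pt d (i + 1) j) ! 0" using y[OF pos] by metis
      moreover have "tab ! w (pt d i j) \<noteq> []" "tab ! w (pt d (i + 1) j) \<noteq> []"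
        using len pos by (metis length_greater_0_conv)+
      ultimately show ?thesis
        using word_ok_along(3)[OF al[of i j]] y[of r i j] x r len
        by (simp add: last_conv_nth hd_conv_nth)
    qed
  qed
  moreover have "image_by (word_patch d tab) (word_a d tab) (word_b d tab) w p y"
    by (rule image_by_word[of tab w d L q y p, OF len pos q]) (use y p in auto)
  moreover have "y (pt d x 0) \<in> hd ` set tab \<longleftrightarrow> x \<in> range q" for x
  proof -
    obtain i r where x: "r < L i" "x = q i + int r" using split by blast
    have "y (pt d x 0) \<in> hd ` set tab \<longleftrightarrow> r = 0"
      using word_ok_along(5)[OF al[of i 0]] x y[of r i 0] len by simp
    moreover have "r = 0" if "x = q k" for k
    proof -
      have "q i \<le> q k" "q k < q (i + 1)" using that x q(2)[of i] by auto
      then have "\<not> k < i" "k < i + 1" using increasing_mono(2)[of q, OF inc] by (metis not_less)+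
      then show ?thesis using that x by simp
    qed
    ultimately show ?thesis using x by auto
  qed
  ultimately show ?thesis using that[of p y q] p q inc y len by auto
qed

text \<open>After translation both sequences of cuts enumerate the same set, and the offsets
  \<open>r\<close>, \<open>r'\<close> inside the word at the origin give the normalisation for
  \<open>increasing_unique\<close>. Equal cuts give equal words, and the words of a table are
  distinct.\<close>

lemma embeds_word:
  "embeds (nn d A B) (nn d A' B') (word_patch d tab) (word_a d tab) (word_b d tab)"
  unfolding embeds_def
proof (intro conjI ballI allI impI)
  show "distinct (map fst (word_patch d tab (w n)))" for w n
    by (auto simp: word_patch_def distinct_map inj_on_def comp_def)
  show "\<exists>p x. image_by (word_patch d tab) (word_a d tab) (word_b d tab) w p x \<and> x \<in> nn d A' B'"
    if "w \<in> nn d A B" for w by (rule word_image[OF that]) blast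
  fix w w' p y p' y' k k'
  assume W: "w \<in> nn d A B" "w' \<in> nn d A B"
    and I: "image_by (word_patch d tab) (word_a d tab) (word_b d tab) w p y"
      "image_by (word_patch d tab) (word_a d tab) (word_b d tab) w' p' y'"
    and k: "k \<in> support (word_patch d tab) (w 0)" "k' \<in> support (word_patch d tab) (w' 0)"
    and eq: "shift k y = shift k' y'"
  obtain q where q: "q 0 = 0" "\<And>i. q i < q (i + 1)"
    "\<And>i j. q (i + 1) = q i + int (length (tab ! w (pt d i j)))"
    "\<And>i j r. r < length (tab ! w (pt d i j)) \<Longrightarrow> y (pt d (q i + int r) j) = tab ! w (pt d i j) ! r"
    "\<And>x. y (pt d x 0) \<in> hd ` set tab \<longleftrightarrow> x \<in> range q"
    by (rule word_image[OF W(1)]) (metis I(1) image_by_unique)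
  obtain q' where q': "q' 0 = 0" "\<And>i. q' i < q' (i + 1)"
    "\<And>i j. q' (i + 1) = q' i + int (length (tab ! w' (pt d i j)))"
    "\<And>i j r. r < length (tab ! w' (pt d i j)) \<Longrightarrow> y' (pt d (q' i + int r) j) = tab ! w' (pt d i j) ! r"
    "\<And>x. y' (pt d x 0) \<in> hd ` set tab \<longleftrightarrow> x \<in> range q'"
    by (rule word_image[OF W(2)]) (metis I(2) image_by_unique)
  obtain r r' where r: "r < length (tab ! w 0)" "k = pt d (int r) 0"
    and r': "r' < length (tab ! w' 0)" "k' = pt d (int r') 0"
    using k by (auto simp: support_word_patch)
  have sh: "y (pt d (x + int r) 0) = y' (pt d (x + int r') 0)" for x
    using fun_cong[OF eq, of "pt d x 0"] r r' by (simp add: shift_def)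
  have "(\<lambda>i. q i - int r) = (\<lambda>i. q' i - int r')"
  proof (rule increasing_unique)
    show "range (\<lambda>i. q i - int r) = range (\<lambda>i. q' i - int r')"
    proof -
      have "x \<in> range (\<lambda>i. q i - int r) \<longleftrightarrow> x + int r \<in> range q" for x
        by (auto simp: image_iff eq_diff_eq)
      moreover have "x \<in> range (\<lambda>i. q' i - int r') \<longleftrightarrow> x + int r' \<in> range q'" for x
        by (auto simp: image_iff eq_diff_eq)
      ultimately show ?thesis using sh q(5) q'(5) by (metis subsetI subset_antisym)
    qed
    show "0 < q 1 - int r" "0 < q' 1 - int r'"
      using q(1) q(3)[of 0 0] r(1) q'(1) q'(3)[of 0 0] r'(1) by simp_all
  qed (use q q' in simp_all)
  then have qq: "q i - int r = q' i - int r'" for i by meson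
  then have "r = r'" using qq[of 0] q(1) q'(1) by simp
  then have "q = q'" "k = k'" using qq r r' by auto
  then have "y = y'" using eq shift_cancel by blast
  show "k = k'" by fact
  show "w = w'"
  proof
    fix n
    obtain i j where n: "n = pt d i j" by (rule pt_cases)
    have l: "length (tab ! w n) = length (tab ! w' n)"
      using q(3)[of i j] q'(3)[of i j] \<open>q = q'\<close> n by simp
    then have "tab ! w n = tab ! w' n"
      by (intro nth_equalityI) (use q(4)[of _ i j] q'(4)[of _ i j] \<open>q = q'\<close> \<open>y = y'\<close> n in auto)
    moreover have "w n < length tab" "w' n < length tab"
      using W word_ok_along(1) unfolding nn_iff n by blast+
    ultimately show "w n = w' n" using ok nth_eq_iff_index_eq unfolding word_ok_def by blast
  qed
qed

end

text \<open>The position map advances letter by letter, so the displacement inside a word is the sum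
  of the advances of the letters passed.\<close>

definition word_off ::
  "bool \<Rightarrow> nat list list \<Rightarrow> (nat \<Rightarrow> point) \<Rightarrow> (nat \<Rightarrow> point) \<Rightarrow> nat \<Rightarrow> point \<Rightarrow> point" where
  "word_off d tab a b u s =
     sum_list (map (if d then b else a) (take (nat (if d then snd s else fst s)) (tab ! u)))"

definition word_cells where
  "word_cells d tab C a b = compose_patches (word_patch d tab) (word_off d tab a b) C"

text \<open>Along the axis the advances of all letters add up; across it the path leaves from the
  first letter of the word, hence \<open>hd\<close>.\<close>

definition adv_a :: "bool \<Rightarrow> nat list list \<Rightarrow> (nat \<Rightarrow> point) \<Rightarrow> nat \<Rightarrow> point" where
  "adv_a d tab a u = (if d then a (hd (tab ! u)) else sum_list (map a (tab ! u)))"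

definition adv_b :: "bool \<Rightarrow> nat list list \<Rightarrow> (nat \<Rightarrow> point) \<Rightarrow> nat \<Rightarrow> point" where
  "adv_b d tab b u = (if d then sum_list (map b (tab ! u)) else b (hd (tab ! u)))"

lemma composable_word:
  assumes ok: "word_ok tab A B A' B'" and emb: "embeds (nn d A' B') X C a b"
  shows "composable (nn d A B) (nn d A' B') X (word_patch d tab) (word_a d tab) (word_b d tab) C a b
    (word_off d tab a b) (adv_a d tab a) (adv_b d tab b)"
proof
  show "embeds (nn d A B) (nn d A' B') (word_patch d tab) (word_a d tab) (word_b d tab)"
    by (rule embeds_word[OF ok])
  show "embeds (nn d A' B') X C a b" by (rule emb)
  show "shift n y \<in> nn d A' B'" if "y \<in> nn d A' B'" for n y using nn_shift_closed[OF that] .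
next
  fix w q y p x n s t
  assume w: "w \<in> nn d A B" and q: "image_by (word_patch d tab) (word_a d tab) (word_b d tab) w q y"
    and p: "image_by C a b y p x"
  let ?L = "length (tab ! w n)" and ?c = "if d then b else a"
  have val: "y (q n + pt d (int r) 0) = tab ! w n ! r" if "r < ?L" for r
    by (rule image_by_value[OF q]) (use that in \<open>simp add: word_patch_def\<close>)
  have step: "p (m + pt d 1 0) = p m + ?c (y m)" for m
    using image_by_position(2,3)[OF p, of m] by (cases d) (simp_all add: pt_def e1_def e2_def)
  have sums: "p (q n + pt d (int r) 0) = p (q n) + sum_list (map ?c (take r (tab ! w n)))"
    if "r \<le> ?L" for r
    using that
  proof (induction r)
    case (Suc r)
    have "q n + pt d (int (Suc r)) 0 = q n + pt d (int r) 0 + pt d 1 0" by (simp add: add.assoc add.commute)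
    then have "p (q n + pt d (int (Suc r)) 0) = p (q n + pt d (int r) 0) + ?c (tab ! w n ! r)"
      using step[of "q n + pt d (int r) 0"] val[of r] Suc.prems by (simp only: Suc_le_eq)
    then show ?case using Suc by (simp add: take_Suc_conv_app_nth add.assoc)
  qed simp
  show "p (q n + s) = p (q n) + word_off d tab a b (w n) s" if st: "(s, t) \<in> set (word_patch d tab (w n))"
  proof -
    obtain r where r: "r < ?L" "s = pt d (int r) 0" using st by (auto simp: word_patch_def)
    then have "nat (if d then snd s else fst s) = r" by (simp add: pt_def)
    then have "word_off d tab a b (w n) s = sum_list (map ?c (take r (tab ! w n)))"
      by (simp only: word_off_def)
    then show ?thesis using sums[of r] r by simp
  qed
  have "(w n, w (n + pt d 1 0)) \<in> set A"
    by (rule pt_cases[of n d]) (use w in \<open>simp add: nn_iff\<close>)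
  then have "0 < ?L" using word_ok_along(2)[OF ok] by blast
  then have h: "y (q n) = hd (tab ! w n)" using val[of 0] by (simp add: hd_conv_nth)
  show "p (q n + word_a d tab (w n)) = p (q n) + adv_a d tab a (w n)"
    using sums[of ?L] image_by_position(2)[OF p, of "q n"] h
    by (cases d) (simp_all add: word_a_def adv_a_def pt_def e1_def)
  show "p (q n + word_b d tab (w n)) = p (q n) + adv_b d tab b (w n)"
    using sums[of ?L] image_by_position(3)[OF p, of "q n"] h
    by (cases d) (simp_all add: word_b_def adv_b_def pt_def e2_def)
qed

lemma embeds_word_cells:
  assumes "word_ok tab A B A' B'" "embeds (nn d A' B') X C a b"
  shows "embeds (nn d A B) X (word_cells d tab C a b) (adv_a d tab a) (adv_b d tab b)"
  unfolding word_cells_def by (rule composable.composed[OF composable_word[OF assms]])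

text \<open>A two-sided orbit through 0. With \<open>f\<close> leading from each cut to the next it
  enumerates the cuts of a configuration; towards the left, preimages are chosen.\<close>

lemma iterate_two_sided:
  fixes N :: "int \<Rightarrow> bool"
  assumes "N 0" and fw: "\<And>x. N x \<Longrightarrow> N (f x)" and bw: "\<And>x. N x \<Longrightarrow> \<exists>y. N y \<and> f y = x"
  obtains q where "q 0 = (0::int)" "\<And>i::int. N (q i)" "\<And>i. q (i + 1) = f (q i)"
proof -
  define g where "g x = (SOME y. N y \<and> f y = x)" for x
  have g: "N (g x) \<and> f (g x) = x" if "N x" for x
    unfolding g_def using someI_ex[OF bw[OF that]] .
  define q where "q i = (if i \<ge> 0 then (f ^^ nat i) 0 else (g ^^ nat (- i)) 0)" for i :: int
  have "N ((f ^^ k) 0)" for k by (induction k) (use assms in auto)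
  moreover have G: "N ((g ^^ k) 0)" for k by (induction k) (use assms(1) g in auto)
  ultimately have "N (q i)" for i by (simp add: q_def)
  moreover have "q (i + 1) = f (q i)" for i
  proof (cases "i \<ge> 0")
    case True
    then have "nat (i + 1) = Suc (nat i)" by simp
    then show ?thesis using True by (simp add: q_def)
  next
    case False
    then have k: "nat (- i) = Suc (nat (- (i + 1)))" by simp
    have "f ((g ^^ nat (- i)) 0) = (g ^^ nat (- (i + 1))) 0" unfolding k using g[OF G] by simp
    then show ?thesis using False by (cases "i + 1 = 0") (auto simp: q_def)
  qed
  ultimately show ?thesis using that[of q] by (simp add: q_def)
qed

text \<open>The adjacencies that a preimage inherits: along the axis from the seam between two
  words, across it (\<open>pull_across\<close>) from letters in equal positions.\<close>

definition pull_along :: "nat list list \<Rightarrow> dominoes \<Rightarrow> dominoes" where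
  "pull_along tab A = concat (map (\<lambda>(x, y). concat (map (\<lambda>u.
     if last (tab ! u) = x then map (Pair u) (filter (\<lambda>v. hd (tab ! v) = y) [0..<length tab]) else [])
     [0..<length tab])) A)"

definition pull_across :: "nat list list \<Rightarrow> dominoes \<Rightarrow> dominoes" where
  "pull_across tab B = concat (map (\<lambda>(x, y). concat (map (\<lambda>u.
     if hd (tab ! u) = x then map (Pair u) (filter (\<lambda>v. hd (tab ! v) = y \<and>
       length (tab ! u) = length (tab ! v) \<and>
       list_all (\<lambda>p. p \<in> set B) (zip (tl (tab ! u)) (tl (tab ! v)))) [0..<length tab]) else [])
     [0..<length tab])) B)"

lemma concat_mapI: "x \<in> set xs \<Longrightarrow> y \<in> set (f x) \<Longrightarrow> y \<in> set (concat (map f xs))"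
  by auto

lemma pull_alongI:
  assumes "u < length tab" "v < length tab" "(last (tab ! u), hd (tab ! v)) \<in> set A"
  shows "(u, v) \<in> set (pull_along tab A)"
  unfolding pull_along_def
  by (rule concat_mapI[OF assms(3)], unfold prod.case, rule concat_mapI[of u]) (use assms(1,2) in auto)

lemma pull_acrossI:
  assumes uv: "u < length tab" "v < length tab" "length (tab ! u) = length (tab ! v)" "tab ! u \<noteq> []"
    and B: "\<And>r. r < length (tab ! u) \<Longrightarrow> (tab ! u ! r, tab ! v ! r) \<in> set B"
  shows "(u, v) \<in> set (pull_across tab B)"
proof -
  have "tab ! v \<noteq> []" using uv(3,4) by auto
  then have h: "(hd (tab ! u), hd (tab ! v)) \<in> set B" using uv(4) B[of 0] by (simp add: hd_conv_nth)
  have "(tl (tab ! u) ! r, tl (tab ! v) ! r) \<in> set B" if "r < length (tl (tab ! u))" for r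
    using B[of "Suc r"] that uv(3) by (simp add: nth_tl)
  then have "list_all (\<lambda>p. p \<in> set B) (zip (tl (tab ! u)) (tl (tab ! v)))"
    using uv(3) unfolding list_all_length by simp
  then show ?thesis
    unfolding pull_across_def
    by (intro concat_mapI[OF h], unfold prod.case, intro concat_mapI[of u]) (use uv in auto)
qed

text \<open>Letters in \<open>M\<close> are markers: they fill whole lines across the axis, are isolated along it,
  and each is absorbed by its predecessor.\<close>

definition pair_ok :: "nat list list \<Rightarrow> nat list \<Rightarrow> dominoes \<Rightarrow> dominoes \<Rightarrow> bool" where
  "pair_ok tab M A B \<longleftrightarrow>
     list_all (\<lambda>(s, t). (s \<in> set M \<longrightarrow> t \<notin> set M) \<and>
       (s \<notin> set M \<longrightarrow> (if t \<in> set M then [s, t] else [s]) \<in> set tab)) A \<and>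
     list_all (\<lambda>(s, t). s \<in> set M \<longleftrightarrow> t \<in> set M) B"

text \<open>As markers are isolated and fill lines, words have one or two letters and the cuts are
  the coordinates without a marker. Looking up the words in \<open>tab\<close> gives the
  preimage.\<close>

lemma covers_word:
  assumes ok: "pair_ok tab M A' B'"
  shows "covers (nn d (pull_along tab A') (pull_across tab B')) (nn d A' B')
    (word_patch d tab) (word_a d tab) (word_b d tab)"
  unfolding covers_def
proof
  let ?A = "pull_along tab A'" and ?B = "pull_across tab B'"
  have MA: "t \<notin> set M" if "(s, t) \<in> set A'" "s \<in> set M" for s t
    using ok that unfolding pair_ok_def list_all_iff by fastforce
  have tab: "(if t \<in> set M then [s, t] else [s]) \<in> set tab" if "(s, t) \<in> set A'" "s \<notin> set M" for s t
    using ok that unfolding pair_ok_def list_all_iff by fastforce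
  have MB: "s \<in> set M \<longleftrightarrow> t \<in> set M" if "(s, t) \<in> set B'" for s t
    using ok that unfolding pair_ok_def list_all_iff by fastforce
  have AI: "(u, v) \<in> set ?A" if "u < length tab" "v < length tab" "(last (tab ! u), hd (tab ! v)) \<in> set A'" for u v
    by (rule pull_alongI[OF that])
  have BI: "(u, v) \<in> set ?B"
    if "u < length tab" "v < length tab" "length (tab ! u) = length (tab ! v)" "tab ! u \<noteq> []"
      "\<And>r. r < length (tab ! u) \<Longrightarrow> (tab ! u ! r, tab ! v ! r) \<in> set B'" for u v
    by (rule pull_acrossI[OF that])
  fix y0 assume y0: "y0 \<in> nn d A' B'"
  have no_two: "y0 (pt d (x + 1) 0) \<notin> set M" if "y0 (pt d x 0) \<in> set M" for x
    using y0 MA that unfolding nn_iff by blast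
  \<comment> \<open>A marker at the origin belongs to the word that starts one cell earlier; the
    shift moves that start to the origin.\<close>
  define r0 :: nat where "r0 = (if y0 0 \<in> set M then 1 else 0)"
  define y where "y = shift (pt d (- int r0) 0) y0"
  have y: "y \<in> nn d A' B'" unfolding y_def by (rule nn_shift_closed[OF y0])
  have y0_eq: "y0 = shift (pt d (int r0) 0) y" by (simp add: y_def shift_shift)
  have al: "(y (pt d i j), y (pt d (i + 1) j)) \<in> set A'" for i j using y nn_iff by blast
  have ac: "(y (pt d i j), y (pt d i (j + 1))) \<in> set B'" for i j using y nn_iff by blast
  define N where "N x \<longleftrightarrow> y (pt d x 0) \<notin> set M" for x
  have N: "y (pt d x j) \<in> set M \<longleftrightarrow> \<not> N x" for x j
  proof (induction j rule: int_induct[where k = 0])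
    case base then show ?case by (simp add: N_def)
  next
    case (step1 j) then show ?case using MB[OF ac] by blast
  next
    case (step2 j) then show ?case using MB[OF ac[of x "j - 1"]] by simp
  qed
  have N2: "N (x + 1)" if "\<not> N x" for x using that MA[OF al] N by blast
  have N0: "N 0"
    using no_two[of "- 1"] by (auto simp: N_def y_def r0_def shift_def)
  have N1: "\<not> N 1" if "r0 = 1"
    using that by (auto simp: N_def y_def shift_def r0_def split: if_splits)
  \<comment> \<open>The next cut, skipping a marker if there is one; a second marker cannot
    follow.\<close>
  define f where "f x = (if N (x + 1) then x + 1 else x + 2)" for x :: int
  have "N (f x)" if "N x" for x using N2[of "x + 1"] by (auto simp: f_def add.assoc)
  moreover have "\<exists>z. N z \<and> f z = x" if "N x" for x
  proof (cases "N (x - 1)")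
    case True then show ?thesis using that by (intro exI[of _ "x - 1"]) (simp add: f_def)
  next
    case False
    then have "N (x - 2)" using N2[of "x - 2"] by auto
    then show ?thesis using that False by (intro exI[of _ "x - 2"]) (simp add: f_def)
  qed
  ultimately obtain q where q: "q 0 = (0::int)" "\<And>i::int. N (q i)" "\<And>i. q (i + 1) = f (q i)"
    using iterate_two_sided[of N f] N0 by metis
  define L :: "int \<Rightarrow> nat" where "L i = (if N (q i + 1) then 1 else 2)" for i
  have L: "q (i + 1) = q i + int (L i)" for i by (simp add: L_def q(3) f_def)
  define W where "W i j = map (\<lambda>r. y (pt d (q i + int r) j)) [0..<L i]" for i j
  have W_tab: "W i j \<in> set tab" for i j
  proof -
    have "W i j = (if y (pt d (q i + 1) j) \<in> set M then [y (pt d (q i) j), y (pt d (q i + 1) j)]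
        else [y (pt d (q i) j)])"
      using N by (simp add: W_def L_def numeral_2_eq_2)
    then show ?thesis using tab[OF al[of "q i" j]] q(2)[of i] N by simp
  qed
  define w where "w n = (SOME u. u < length tab \<and>
      tab ! u = W (if d then snd n else fst n) (if d then fst n else snd n))" for n
  have w: "w (pt d i j) < length tab \<and> tab ! w (pt d i j) = W i j" for i j
  proof -
    have "w (pt d i j) = (SOME u. u < length tab \<and> tab ! u = W i j)" by (simp add: w_def pt_def)
    then show ?thesis using someI_ex[of "\<lambda>u. u < length tab \<and> tab ! u = W i j"] W_tab[of i j]
      by (simp add: in_set_conv_nth)
  qed
  have lenW: "length (W i j) = L i" for i j by (simp add: W_def)
  have Wn: "W i j ! r = y (pt d (q i + int r) j)" if "r < L i" for i j r using that by (simp add: W_def)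
  have posL: "0 < L i" for i by (simp add: L_def)
  have "w \<in> nn d ?A ?B"
    unfolding nn_iff
  proof (intro allI conjI)
    fix i j
    have "W i j \<noteq> []" "W (i + 1) j \<noteq> []" using lenW posL by (metis length_greater_0_conv)+
    then have "last (W i j) = y (pt d (q i + int (L i - 1)) j)" "hd (W (i + 1) j) = y (pt d (q (i + 1)) j)"
      using Wn[of _ i j] Wn[of 0 "i + 1" j] posL lenW by (simp_all add: last_conv_nth hd_conv_nth)
    moreover have "q (i + 1) = q i + int (L i - 1) + 1" using L[of i] posL[of i] by simp
    ultimately show "(w (pt d i j), w (pt d (i + 1) j)) \<in> set ?A"
      using AI w al[of "q i + int (L i - 1)" j] by simp
    show "(w (pt d i j), w (pt d i (j + 1))) \<in> set ?B"
      by (rule BI) (use w Wn ac lenW \<open>W i j \<noteq> []\<close> in simp_all)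
  qed
  moreover have "image_by (word_patch d tab) (word_a d tab) (word_b d tab) w
      (\<lambda>n. pt d (q (if d then snd n else fst n)) (if d then fst n else snd n)) y"
    by (rule image_by_word[of tab w d L q]) (use w lenW posL q(1) L Wn in \<open>auto simp: pt_def\<close>)
  moreover have "pt d (int r0) 0 \<in> support (word_patch d tab) (w 0)"
    unfolding support_word_patch
    using w[of 0 0] lenW[of 0 0] N1 q(1) by (intro exI[of _ r0]) (auto simp: L_def r0_def split: if_splits)
  ultimately show "\<exists>w\<in>nn d ?A ?B. \<exists>p y k.
      image_by (word_patch d tab) (word_a d tab) (word_b d tab) w p y \<and>
      k \<in> support (word_patch d tab) (w 0) \<and> y0 = shift k y"
    using y0_eq by blast
qed

lemma covers_word_cells:
  assumes "word_ok tab A B A' B'" "embeds (nn d A' B') X C a b"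
    "covers (nn d A B) (nn d A' B') (word_patch d tab) (word_a d tab) (word_b d tab)"
    "covers (nn d A' B') X C a b" "\<And>x n. x \<in> X \<Longrightarrow> shift n x \<in> X"
  shows "covers (nn d A B) X (word_cells d tab C a b) (adv_a d tab a) (adv_b d tab b)"
  unfolding word_cells_def
  by (rule composable.composed_covers[OF composable_word[OF assms(1,2)] assms(3,4)]) (rule assms(5))

section \<open>Self-similarity: periods and recurrence\<close>

text \<open>With \<open>m\<close> the owner of \<open>n + k\<close>, the same configuration is a
  translate of the image of \<open>w\<close> and of that of \<open>shift m w\<close>.
  Recognizability identifies the two preimages, and equality of the offsets gives
  \<open>n = p m\<close>.\<close>

lemma period_lifts:
  assumes emb: "embeds Y X C a b" and Ys: "\<And>y n. y \<in> Y \<Longrightarrow> shift n y \<in> Y" and w: "w \<in> Y"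
    and I: "image_by C a b w p x" and k: "k \<in> support C (w 0)" and per: "shift n (shift k x) = shift k x"
  shows "\<exists>m. shift m w = w \<and> n = p m"
proof -
  obtain m s where m: "n + k = p m + s" "s \<in> support C (w m)" by (rule image_by_obtain[OF I])
  have "shift s (shift (p m) x) = shift k x"
    using per m(1) by (simp add: shift_shift add.commute)
  moreover have "s \<in> support C (shift m w 0)" using m(2) by (simp add: shift_def)
  ultimately have "shift m w = w \<and> s = k"
    using embeds_recognizable[OF emb Ys[OF w] w image_by_shift[OF I] I] k by blast
  then show ?thesis using m(1) by auto
qed

text \<open>Only the letters along a path of unit steps from the origin to \<open>n\<close> enter
  into \<open>p n\<close>.\<close>

lemma position_locally_determined:
  "\<exists>G. finite G \<and> (\<forall>w' p' x'. image_by C a b w' p' x' \<longrightarrow> (\<forall>g\<in>G. w' g = w g) \<longrightarrow>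
     image_by C a b w p x \<longrightarrow> p' n = p n)"
proof (induction n rule: plane_induct)
  case zero
  show ?case by (intro exI[of _ "{}"]) (auto simp: image_by_position)
next
  case (e1 n)
  have "p' n = p n \<longleftrightarrow> p' (n + e1) = p (n + e1)"
    if "image_by C a b w' p' x'" "w' n = w n" "image_by C a b w p x" for w' p' x'
    using image_by_position(2)[OF that(1)] image_by_position(2)[OF that(3)] that(2) by simp
  then show ?case by (metis finite_insert insertCI)
next
  case (e2 n)
  have "p' n = p n \<longleftrightarrow> p' (n + e2) = p (n + e2)"
    if "image_by C a b w' p' x'" "w' n = w n" "image_by C a b w p x" for w' p' x'
    using image_by_position(3)[OF that(1)] image_by_position(3)[OF that(3)] that(2) by simp
  then show ?case by (metis finite_insert insertCI)
qed

text \<open>Continuity of the passage from \<open>w\<close> to \<open>x\<close>: the value of a cell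
  depends on the letter of its owner and on the letters that fix the owner's position.\<close>

lemma image_locally_determined:
  assumes I: "image_by C a b w p x" and "finite F"
  shows "\<exists>G. finite G \<and> (\<forall>w' p' x'. image_by C a b w' p' x' \<longrightarrow> (\<forall>g\<in>G. w' g = w g) \<longrightarrow>
     (\<forall>z\<in>F. x' z = x z))"
  using \<open>finite F\<close>
proof induction
  case (insert z F)
  obtain n s where z: "z = p n + s" "s \<in> support C (w n)" by (rule image_by_obtain[OF I])
  then obtain c where c: "(s, c) \<in> set (C (w n))" by (auto simp: support_def)
  obtain G where G: "finite G" "\<And>w' p' x'. image_by C a b w' p' x' \<Longrightarrow> (\<forall>g\<in>G. w' g = w g) \<Longrightarrow> p' n = p n"
    using position_locally_determined[of C a b w p x n] I by blast
  obtain G' where G': "finite G'" "\<And>w' p' x'. image_by C a b w' p' x' \<Longrightarrow> (\<forall>g\<in>G'. w' g = w g) \<Longrightarrow> \<forall>z\<in>F. x' z = x z"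
    using insert by blast
  have "x' z = x z" if I': "image_by C a b w' p' x'" and "\<forall>g\<in>insert n G. w' g = w g" for w' p' x'
  proof -
    have c': "(s, c) \<in> set (C (w' n))" and "p' n = p n" using that c G(2)[OF I'] by auto
    then show ?thesis using image_by_value[OF I' c'] image_by_value[OF I c] z by simp
  qed
  moreover have "\<forall>z\<in>F. x' z = x z"
    if "image_by C a b w' p' x'" "\<forall>g\<in>G'. w' g = w g" for w' p' x' using G'(2)[OF that] .
  ultimately have "\<forall>z\<in>insert z F. x' z = x z"
    if "image_by C a b w' p' x'" "\<forall>g\<in>insert n G \<union> G'. w' g = w g" for w' p' x'
    using that by (metis UnCI insertE)
  moreover have "finite (insert n G \<union> G')" using G(1) G'(1) by simp
  ultimately show ?case by blast
qed (intro exI[of _ "{}"], simp)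

text \<open>Order: lower left, lower right, upper left, upper right.\<close>

definition quad :: "(point \<Rightarrow> nat) \<Rightarrow> point \<Rightarrow> nat \<times> nat \<times> nat \<times> nat" where
  "quad w n = (w n, w (n + (1, 0)), w (n + (0, 1)), w (n + (1, 1)))"

text \<open>The image of a 2 x 2 pattern. The upper right patch is reached by a step right and then
  a step up, hence \<open>a t + b u\<close>.\<close>

definition quad_patch ::
  "(nat \<Rightarrow> (point \<times> nat) list) \<Rightarrow> (nat \<Rightarrow> point) \<Rightarrow> (nat \<Rightarrow> point) \<Rightarrow>
   nat \<times> nat \<times> nat \<times> nat \<Rightarrow> (point \<times> nat) list" where
  "quad_patch C a b = (\<lambda>(t, u, v, x). C t @ map (\<lambda>(r, c). (a t + r, c)) (C u) @
     map (\<lambda>(r, c). (b t + r, c)) (C v) @ map (\<lambda>(r, c). (a t + b u + r, c)) (C x))"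

definition quad_at :: "(point \<times> nat) list \<Rightarrow> point \<Rightarrow> (nat \<times> nat \<times> nat \<times> nat) option" where
  "quad_at L z = (case map_of L z of None \<Rightarrow> None | Some c \<Rightarrow>
     case map_of L (z + (1, 0)) of None \<Rightarrow> None | Some r \<Rightarrow>
     case map_of L (z + (0, 1)) of None \<Rightarrow> None | Some t \<Rightarrow>
     case map_of L (z + (1, 1)) of None \<Rightarrow> None | Some d \<Rightarrow> Some (c, r, t, d))"

lemma quad_at_iff:
  "quad_at L z = Some (c, r, t, d) \<longleftrightarrow> map_of L z = Some c \<and> map_of L (z + (1, 0)) = Some r \<and>
     map_of L (z + (0, 1)) = Some t \<and> map_of L (z + (1, 1)) = Some d"
  unfolding quad_at_def by (auto split: option.splits)

lemma quad_at_occurs: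
  assumes "quad_at L z = Some q" "\<And>s c. (s, c) \<in> set L \<Longrightarrow> x (m + s) = c"
  shows "quad x (m + z) = q"
proof -
  obtain c r t d where q: "q = (c, r, t, d)" by (cases q)
  show ?thesis
    using assms(1) unfolding q quad_at_iff quad_def
    by (auto simp: add.assoc dest!: map_of_SomeD assms(2))
qed

text \<open>A recognizable substitution from \<open>X\<close> onto \<open>X\<close> whose patches are rectangles with sides
  at least \<open>g\<close>.\<close>

locale rect_substitution =
  fixes X :: "(point \<Rightarrow> nat) set" and C a b and g :: int
  assumes emb: "embeds X X C a b" and cov: "covers X X C a b"
    and X_shift: "\<And>x n. x \<in> X \<Longrightarrow> shift n x \<in> X"
    and gap: "g \<ge> 1"
    and sides: "\<And>w n. w \<in> X \<Longrightarrow> snd (a (w n)) = 0 \<and> g \<le> fst (a (w n)) \<and> fst (b (w n)) = 0 \<and> g \<le> snd (b (w n))"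
    and rect: "\<And>w n s. w \<in> X \<Longrightarrow> s \<in> support C (w n) \<longleftrightarrow>
       0 \<le> fst s \<and> fst s < fst (a (w n)) \<and> 0 \<le> snd s \<and> snd s < snd (b (w n))"
begin

text \<open>\<open>a\<close> is horizontal and \<open>b\<close> is vertical, so abscissas are
  constant along columns and ordinates along rows: the position map is a product of two
  sequences.\<close>

lemma grid:
  assumes "w \<in> X" and I: "image_by C a b w p x"
  obtains P Q where "\<And>i j. p (i, j) = (P i, Q j)" "P 0 = 0" "Q 0 = 0"
    "\<And>i j. P (i + 1) = P i + fst (a (w (i, j)))" "\<And>i j. Q (j + 1) = Q j + snd (b (w (i, j)))"
proof -
  have h: "p (i + 1, j) = p (i, j) + a (w (i, j))" and v: "p (i, j + 1) = p (i, j) + b (w (i, j))" for i j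
    using image_by_position(2,3)[OF I, of "(i, j)"] by (simp_all add: e1_def e2_def)
  have f: "fst (p (i, j)) = fst (p (i, 0))" for i j
  proof (induction j rule: int_induct[where k = 0])
    case (step1 j) then show ?case using v[of i j] sides[OF assms(1)] by simp
  next
    case (step2 j) then show ?case using v[of i "j - 1"] sides[OF assms(1)] by simp
  qed simp
  have s: "snd (p (i, j)) = snd (p (0, j))" for i j
  proof (induction i rule: int_induct[where k = 0])
    case (step1 i) then show ?case using h[of i j] sides[OF assms(1)] by simp
  next
    case (step2 i) then show ?case using h[of "i - 1" j] sides[OF assms(1)] by simp
  qed simp
  show ?thesis
  proof (rule that[of "\<lambda>i. fst (p (i, 0))" "\<lambda>j. snd (p (0, j))"])
    show "p (i, j) = (fst (p (i, 0)), snd (p (0, j)))" for i j using f[of i j] s[of i j] by (simp add: prod_eq_iff)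
    show "fst (p (0, 0)) = 0" "snd (p (0, 0)) = 0" using image_by_position(1)[OF I] by (simp_all add: zero_prod_def)
    show "fst (p (i + 1, 0)) = fst (p (i, 0)) + fst (a (w (i, j)))" for i j
      using h[of i j] f[of i j] f[of "i + 1" j] by simp
    show "snd (p (0, j + 1)) = snd (p (0, j)) + snd (b (w (i, j)))" for i j
      using v[of i j] s[of i j] s[of i "j + 1"] by simp
  qed
qed

lemma gap_growth:
  assumes "\<And>i::int. P i + g \<le> P (i + 1)" "i \<le> j"
  shows "P i + g * (j - i) \<le> P j"
  using assms(2)
proof (induction j rule: int_ge_induct)
  case (step k)
  then show ?case using assms(1)[of k] by (simp add: algebra_simps)
qed simp

text \<open>With \<open>g \<ge> 2\<close> a period of \<open>x\<close> comes from a period at most half as long.\<close>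

lemma aperiodic_shift:
  assumes "g \<ge> 2" "w \<in> X" "shift n w = w"
  shows "n = 0"
  using assms(2,3)
proof (induction "nat (\<bar>fst n\<bar> + \<bar>snd n\<bar>)" arbitrary: n w rule: less_induct)
  case less
  obtain w' p y k where w': "w' \<in> X" "image_by C a b w' p y" "k \<in> support C (w' 0)" "w = shift k y"
    using cov less.prems(1) unfolding covers_def by blast
  obtain m where m: "shift m w' = w'" "n = p m"
    using period_lifts[OF emb X_shift w'(1-3)] less.prems(2) w'(4) by blast
  obtain P Q where PQ: "\<And>i j. p (i, j) = (P i, Q j)" "P 0 = 0" "Q 0 = 0"
    "\<And>i j. P (i + 1) = P i + fst (a (w' (i, j)))" "\<And>i j. Q (j + 1) = Q j + snd (b (w' (i, j)))"
    by (rule grid[OF w'(1,2)], rule that) assumption+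
  have gr: "P i + g \<le> P (i + 1)" "Q i + g \<le> Q (i + 1)" for i
    using PQ(4)[of i 0] PQ(5)[of i 0] sides[OF w'(1)] by simp_all
  have big: "2 * \<bar>i\<bar> \<le> \<bar>P i\<bar>" if "\<And>i::int. P i + g \<le> P (i + 1)" "P 0 = 0" for P i
  proof (cases "i \<ge> 0")
    case True
    have "2 * i \<le> g * i" using True assms(1) by (intro mult_right_mono) auto
    then show ?thesis using gap_growth[of P 0 i, OF that(1)] True that(2) by simp
  next
    case False
    have "2 * (- i) \<le> g * (- i)" using False assms(1) by (intro mult_right_mono) auto
    moreover have "P i + g * (- i) \<le> 0" using gap_growth[of P i 0, OF that(1)] False that(2) by simp
    ultimately show ?thesis using False by linarith
  qed
  obtain i j where ij: "m = (i, j)" by (cases m)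
  then have n: "fst n = P i" "snd n = Q j" using m(2) PQ(1) by simp_all
  have b: "2 * \<bar>i\<bar> \<le> \<bar>P i\<bar>" "2 * \<bar>j\<bar> \<le> \<bar>Q j\<bar>"
    using big[of P i] big[of Q j] gr PQ(2,3) by blast+
  show ?case
  proof (rule ccontr)
    assume "n \<noteq> 0"
    then have "m \<noteq> 0" using m(2) image_by_position(1)[OF w'(2)] by auto
    then have "i \<noteq> 0 \<or> j \<noteq> 0" using ij by (simp add: zero_prod_def)
    then have "\<bar>i\<bar> + \<bar>j\<bar> < \<bar>P i\<bar> + \<bar>Q j\<bar>" using b by linarith
    then have "nat (\<bar>fst m\<bar> + \<bar>snd m\<bar>) < nat (\<bar>fst n\<bar> + \<bar>snd n\<bar>)" using n ij by simp
    from less.hyps[OF this w'(1) m(1)] \<open>m \<noteq> 0\<close> show False by blast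
  qed
qed

text \<open>The box starts inside the patch of the origin, so its abscissas stay below
  \<open>P 1 + (L - 1) \<le> P 1 + g * (c - 1) \<le> P c\<close>, and likewise its
  ordinates.\<close>

lemma box_covered:
  assumes w: "w \<in> X" and I: "image_by C a b w p x" and k: "k \<in> support C (w 0)"
    and L: "L - 1 \<le> g * (c - 1)" and ij: "0 \<le> i" "i < L" "0 \<le> j" "j < L"
  obtains n1 n2 s where "(i, j) + k = p (n1, n2) + s" "s \<in> support C (w (n1, n2))"
    "0 \<le> n1" "n1 < c" "0 \<le> n2" "n2 < c"
proof -
  obtain P Q where PQ: "\<And>i j. p (i, j) = (P i, Q j)" "P 0 = 0" "Q 0 = 0"
    "\<And>i j. P (i + 1) = P i + fst (a (w (i, j)))" "\<And>i j. Q (j + 1) = Q j + snd (b (w (i, j)))"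
    by (rule grid[OF w I], rule that) assumption+
  have gr: "P i + g \<le> P (i + 1)" "Q i + g \<le> Q (i + 1)" for i
    using PQ(4)[of i 0] PQ(5)[of i 0] sides[OF w] by simp_all
  have range: "0 \<le> n \<and> n < c"
    if gr: "\<And>i::int. P i + g \<le> P (i + 1)" and "P 0 = 0" and e: "i + k = P n + s" "0 \<le> s" "P n + s < P (n + 1)"
      "0 \<le> k" "k < P 1" "0 \<le> i" "i < L" for P n s i k
  proof -
    have mono: "P i \<le> P j" if "i \<le> j" for i j
      using increasing_mono(1)[of P i j] gr gap that by (smt (verit))
    have "0 \<le> n"
    proof (rule ccontr)
      assume "\<not> 0 \<le> n"
      then have "P (n + 1) \<le> P 0" by (intro mono) simp
      then show False using e \<open>P 0 = 0\<close> by simp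
    qed
    moreover have "n < c"
    proof (rule ccontr)
      assume "\<not> n < c"
      moreover have "0 < c"
      proof (rule ccontr)
        assume "\<not> 0 < c"
        then have "g * (c - 1) < 0" using gap by (intro mult_pos_neg) auto
        then show False using L e by simp
      qed
      ultimately have "P c \<le> P n" "P 1 + g * (c - 1) \<le> P c"
        using mono[of c n] gap_growth[of P 1 c, OF gr] by auto
      then show False using e L by simp
    qed
    ultimately show ?thesis by blast
  qed
  obtain n s where n: "(i, j) + k = p n + s" "s \<in> support C (w n)" by (rule image_by_obtain[OF I])
  obtain n1 n2 where nn: "n = (n1, n2)" by (cases n)
  obtain s1 s2 k1 k2 where sk: "s = (s1, s2)" "k = (k1, k2)" by (cases s, cases k)
  have e: "i + k1 = P n1 + s1" "j + k2 = Q n2 + s2" using n(1) nn sk PQ(1) by simp_all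
  have "0 \<le> s1" "s1 < fst (a (w n))" "0 \<le> s2" "s2 < snd (b (w n))"
    "0 \<le> k1" "k1 < fst (a (w 0))" "0 \<le> k2" "k2 < snd (b (w 0))"
    using n(2) k rect[OF w] sk by auto
  then have "0 \<le> n1 \<and> n1 < c" "0 \<le> n2 \<and> n2 < c"
    using range[OF gr(1) PQ(2) e(1), of] range[OF gr(2) PQ(3) e(2)] ij
      PQ(4)[of n1 n2] PQ(5)[of n2 n1] PQ(4)[of 0 0] PQ(5)[of 0 0] PQ(2,3) nn
    by (auto simp: zero_prod_def)
  then show ?thesis using that n nn by blast
qed

definition recurs :: "int \<Rightarrow> bool" where
  "recurs L \<longleftrightarrow> (\<forall>w\<in>X. \<forall>v\<in>X. \<exists>m. \<forall>i j. 0 \<le> i \<longrightarrow> i < L \<longrightarrow> 0 \<le> j \<longrightarrow> j < L \<longrightarrow> v (m + (i, j)) = w (i, j))"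

text \<open>A box of side \<open>L\<close> in \<open>w\<close> lies in the image of a box of side
  \<open>c\<close> of a preimage. The latter recurs in a preimage of \<open>v\<close>, and its image
  there contains the same box of side \<open>L\<close>.\<close>

lemma recurs_step:
  assumes rc: "recurs c" and L: "L - 1 \<le> g * (c - 1)"
  shows "recurs L"
  unfolding recurs_def
proof (intro ballI)
  fix w v assume "w \<in> X" "v \<in> X"
  obtain w' p y k where w': "w' \<in> X" "image_by C a b w' p y" "k \<in> support C (w' 0)" "w = shift k y"
    using cov \<open>w \<in> X\<close> unfolding covers_def by blast
  obtain v' r z l where v': "v' \<in> X" "image_by C a b v' r z" "v = shift l z"
    using cov \<open>v \<in> X\<close> unfolding covers_def by blast
  obtain m where m: "\<And>i j. 0 \<le> i \<Longrightarrow> i < c \<Longrightarrow> 0 \<le> j \<Longrightarrow> j < c \<Longrightarrow> v' (m + (i, j)) = w' (i, j)"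
    using rc w'(1) v'(1) unfolding recurs_def by blast
  define u where "u = shift m v'"
  have u: "u \<in> X" and uI: "image_by C a b u (\<lambda>n. r (n + m) - r m) (shift (r m) z)"
    unfolding u_def using X_shift v' image_by_shift by blast+
  have agree: "u (i, j) = w' (i, j)" if "0 \<le> i" "i < c" "0 \<le> j" "j < c" for i j
    using m[OF that] by (simp add: u_def shift_def add.commute)
  obtain P Q where P: "\<And>i j. p (i, j) = (P i, Q j)" "P 0 = 0" "Q 0 = 0"
    "\<And>i j. P (i + 1) = P i + fst (a (w' (i, j)))" "\<And>i j. Q (j + 1) = Q j + snd (b (w' (i, j)))"
    by (rule grid[OF w'(1,2)], rule that) assumption+
  obtain R S where R: "\<And>i j. r ((i, j) + m) - r m = (R i, S j)" "R 0 = 0" "S 0 = 0"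
    "\<And>i j. R (i + 1) = R i + fst (a (u (i, j)))" "\<And>i j. S (j + 1) = S j + snd (b (u (i, j)))"
    by (rule grid[OF u uI], rule that) assumption+
  \<comment> \<open>Increments are functions of the letters, so where the letters agree the patches
    also lie in the same places.\<close>
  have same: "R i = P i \<and> S i = Q i" if "0 \<le> i" "i < c" for i
    using that
  proof (induction i rule: int_ge_induct)
    case base then show ?case using P R by simp
  next
    case (step i)
    then have "u (i, 0) = w' (i, 0)" "u (0, i) = w' (0, i)" using agree by auto
    then show ?case using step P(4)[of i 0] P(5)[of i 0] R(4)[of i 0] R(5)[of i 0] by simp
  qed
  have "v (k + r m - l + (i, j)) = w (i, j)" if ij: "0 \<le> i" "i < L" "0 \<le> j" "j < L" for i j
  proof -
    obtain n1 n2 s where n: "(i, j) + k = p (n1, n2) + s" "s \<in> support C (w' (n1, n2))"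
      "0 \<le> n1" "n1 < c" "0 \<le> n2" "n2 < c"
      by (rule box_covered[OF w'(1-3) L ij])
    obtain d where d: "(s, d) \<in> set (C (w' (n1, n2)))" using n(2) by (auto simp: support_def)
    have "y ((i, j) + k) = d" using image_by_value[OF w'(2) d] n(1) by simp
    moreover have "shift (r m) z (r ((n1, n2) + m) - r m + s) = d"
      by (rule image_by_value[OF uI]) (use d agree n in simp)
    moreover have "r ((n1, n2) + m) - r m = p (n1, n2)" using R(1) P(1) same n by simp
    ultimately have "z ((i, j) + k + r m) = w (i, j)" using n(1) w'(4) by (simp add: shift_def)
    moreover have "k + r m - l + (i, j) + l = (i, j) + k + r m" by (simp add: algebra_simps)
    ultimately show ?thesis unfolding v'(3) shift_def by (simp only:)
  qed
  then show "\<exists>m. \<forall>i j. 0 \<le> i \<longrightarrow> i < L \<longrightarrow> 0 \<le> j \<longrightarrow> j < L \<longrightarrow> v (m + (i, j)) = w (i, j)" by blast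
qed

lemma recurs_all:
  assumes "g \<ge> 2" "recurs 2"
  shows "recurs L"
proof (induction "nat L" arbitrary: L rule: less_induct)
  case less
  show ?case
  proof (cases "L \<le> 2")
    case True
    then show ?thesis using assms(2) unfolding recurs_def by (meson order_less_le_trans)
  next
    case False
    \<comment> \<open>The least \<open>c\<close> with \<open>L - 1 \<le> 2 * (c - 1)\<close>. It is
      smaller than \<open>L\<close> once \<open>L > 2\<close>, while \<open>L = 2\<close> gives
      \<open>c = 2\<close> again; this is why 2 x 2 patterns form the base case.\<close>
    define c where "c = (L + 2) div 2"
    have "2 * c = L + 2 \<or> 2 * c = L + 1" unfolding c_def by presburger
    then have c: "nat c < nat L" "L - 1 \<le> 2 * (c - 1)" "1 \<le> c" using False by auto
    have "2 * (c - 1) \<le> g * (c - 1)" using assms(1) c(3) by (intro mult_right_mono) auto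
    then have "L - 1 \<le> g * (c - 1)" using c(2) by linarith
    then show ?thesis by (rule recurs_step[OF less(1)[OF c(1)]])
  qed
qed

definition universal :: "nat \<times> nat \<times> nat \<times> nat \<Rightarrow> bool" where
  "universal q \<longleftrightarrow> (\<forall>v\<in>X. \<exists>m. quad v m = q)"

lemma quad_patch_values:
  assumes I: "image_by C a b w p x" and sc: "(s, c) \<in> set (quad_patch C a b (quad w n))"
  shows "x (p n + s) = c"
proof -
  have n: "n + (1, 0) = n + e1" "n + (0, 1) = n + e2" "n + (1, 1) = (n + e1) + e2"
    by (simp_all add: e1_def e2_def prod_eq_iff)
  note pos = image_by_position(2,3)[OF I]
  consider "(s, c) \<in> set (C (w n))"
    | r where "(r, c) \<in> set (C (w (n + e1)))" "s = a (w n) + r"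
    | r where "(r, c) \<in> set (C (w (n + e2)))" "s = b (w n) + r"
    | r where "(r, c) \<in> set (C (w (n + e1 + e2)))" "s = a (w n) + b (w (n + e1)) + r"
    using sc unfolding quad_patch_def quad_def n by auto
  then show ?thesis
  proof cases
    case 1 then show ?thesis using image_by_value[OF I] by blast
  next
    case 2 from image_by_value[OF I 2(1)] show ?thesis by (simp add: pos 2(2) add.assoc)
  next
    case 3 from image_by_value[OF I 3(1)] show ?thesis by (simp add: pos 3(2) add.assoc)
  next
    case 4
    have "p (n + e1 + e2) = p n + a (w n) + b (w (n + e1))" using pos(2)[of "n + e1"] pos(1)[of n] by simp
    then have "p (n + e1 + e2) + r = p n + s" unfolding 4(2) by (simp add: add.assoc)
    then show ?thesis using image_by_value[OF I 4(1)] by simp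
  qed
qed

lemma occurs_in_quad_image:
  assumes "w \<in> X" "image_by C a b w p x" "quad w n = q" "quad_at (quad_patch C a b q) z = Some q'"
  shows "quad x (p n + z) = q'"
  by (rule quad_at_occurs[OF assms(4)]) (use quad_patch_values[OF assms(2)] assms(3) in blast)

lemma quad_shift: "quad (shift k y) n = quad y (n + k)"
proof -
  have "n + d + k = n + k + d" for d by (simp add: ac_simps)
  then show ?thesis unfolding quad_def shift_def by metis
qed

lemma universal_step:
  assumes "universal q" "quad_at (quad_patch C a b q) z = Some q'"
  shows "universal q'"
  unfolding universal_def
proof
  fix v assume "v \<in> X"
  then obtain w p y k where w: "w \<in> X" "image_by C a b w p y" "v = shift k y"
    using cov unfolding covers_def by blast
  obtain n where "quad w n = q" using assms(1) w(1) unfolding universal_def by blast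
  then have "quad y (p n + z) = q'" by (rule occurs_in_quad_image[OF w(1,2) _ assms(2)])
  then have "quad v (p n + z - k) = q'" unfolding w(3) quad_shift by simp
  then show "\<exists>m. quad v m = q'" by blast
qed

text \<open>This is \<open>box_covered\<close> with \<open>L = c = 2\<close>, where
  \<open>g = 1\<close> is enough. Hence 2 x 2 patterns can be studied under the substitution itself,
  whose images are smaller than those of its square.\<close>

lemma quad_parent:
  assumes "w \<in> X"
  obtains v k where "v \<in> X" "quad_at (quad_patch C a b (quad v 0)) k = Some (quad w 0)"
proof -
  obtain v p y k where v: "v \<in> X" "image_by C a b v p y" "k \<in> support C (v 0)" "w = shift k y"
    using cov assms unfolding covers_def by blast
  let ?L = "quad_patch C a b (quad v 0)"
  have val: "y s = c" if "(s, c) \<in> set ?L" for s c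
    using quad_patch_values[OF v(2) that] image_by_position(1)[OF v(2)] by simp
  have inL: "(z, y z) \<in> set ?L" if ij: "0 \<le> i" "i < 2" "0 \<le> j" "j < 2" and z: "z = (i, j) + k" for i j z
  proof -
    obtain n1 n2 s where n: "(i, j) + k = p (n1, n2) + s" "s \<in> support C (v (n1, n2))"
      "0 \<le> n1" "n1 < 2" "0 \<le> n2" "n2 < 2"
      by (rule box_covered[OF v(1-3) _ ij, where c = 2]) (use gap in auto)
    obtain d where d: "(s, d) \<in> set (C (v (n1, n2)))" using n(2) by (auto simp: support_def)
    note pos = image_by_position(2,3)[OF v(2), unfolded e1_def e2_def]
    have p: "p (0, 0) = 0" "p (1, 0) = a (v (0, 0))" "p (0, 1) = b (v (0, 0))"
      "p (1, 1) = a (v (0, 0)) + b (v (1, 0))"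
      using image_by_position(1)[OF v(2)] pos[of "(0, 0)"] pos(2)[of "(1, 0)"]
      by (simp_all add: zero_prod_def[symmetric])
    have q: "quad v 0 = (v (0, 0), v (1, 0), v (0, 1), v (1, 1))"
      by (simp add: quad_def zero_prod_def)
    have tr: "(z + s, d) \<in> (\<lambda>(r, c). (z + r, c)) ` set (C u)" if "(s, d) \<in> set (C u)" for z u
      by (rule image_eqI[OF _ that]) simp
    have "n1 = 0 \<or> n1 = 1" "n2 = 0 \<or> n2 = 1" using n by auto
    then consider "n1 = 0" "n2 = 0" | "n1 = 1" "n2 = 0" | "n1 = 0" "n2 = 1" | "n1 = 1" "n2 = 1" by blast
    then have "(p (n1, n2) + s, d) \<in> set ?L"
    proof cases
      case 1
      then have "(p (n1, n2) + s, d) \<in> set (C (v (0, 0)))" using d p by simp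
      then show ?thesis unfolding q quad_patch_def by simp
    next
      case 2
      then have "(p (n1, n2) + s, d) \<in> (\<lambda>(r, c). (a (v (0, 0)) + r, c)) ` set (C (v (1, 0)))"
        using tr d p by simp
      then show ?thesis unfolding q quad_patch_def by simp
    next
      case 3
      then have "(p (n1, n2) + s, d) \<in> (\<lambda>(r, c). (b (v (0, 0)) + r, c)) ` set (C (v (0, 1)))"
        using tr d p by simp
      then show ?thesis unfolding q quad_patch_def by simp
    next
      case 4
      then have "(p (n1, n2) + s, d) \<in>
          (\<lambda>(r, c). (a (v (0, 0)) + b (v (1, 0)) + r, c)) ` set (C (v (1, 1)))"
        using tr d p by simp
      then show ?thesis unfolding q quad_patch_def by simp
    qed
    then show ?thesis using val n(1) z by metis
  qed
  have mo: "map_of ?L z = Some (y z)" if z: "0 \<le> i" "i < 2" "0 \<le> j" "j < 2" "z = (i, j) + k" for i j z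
  proof -
    obtain c where "map_of ?L z = Some c" using weak_map_of_SomeI[OF inL[OF z]] by blast
    then show ?thesis using val[OF map_of_SomeD] by simp
  qed
  have "quad w 0 = (y k, y (k + (1, 0)), y (k + (0, 1)), y (k + (1, 1)))"
    unfolding v(4) by (simp add: quad_def shift_def add.commute)
  then have "quad_at ?L k = Some (quad w 0)"
    using mo[of 0 0 k] mo[of 1 0 "k + (1, 0)"] mo[of 0 1 "k + (0, 1)"] mo[of 1 1 "k + (1, 1)"]
    by (simp add: quad_at_iff add.commute zero_prod_def[symmetric])
  then show ?thesis using that v(1) by blast
qed

lemma recurs_2I:
  assumes "\<And>w. w \<in> X \<Longrightarrow> universal (quad w 0)"
  shows "recurs 2"
  unfolding recurs_def
proof (intro ballI)
  fix w v assume "w \<in> X" "v \<in> X"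
  then obtain m where m: "quad v m = quad w 0" using assms unfolding universal_def by blast
  have "v (m + (i, j)) = w (i, j)" if "0 \<le> i" "i < 2" "0 \<le> j" "j < 2" for i j
  proof -
    have "i = 0 \<or> i = 1" "j = 0 \<or> j = 1" using that by auto
    then show ?thesis using m by (auto simp: quad_def zero_prod_def[symmetric])
  qed
  then show "\<exists>m. \<forall>i j. 0 \<le> i \<longrightarrow> i < 2 \<longrightarrow> 0 \<le> j \<longrightarrow> j < 2 \<longrightarrow> v (m + (i, j)) = w (i, j)" by blast
qed

end

section \<open>The self-similarity of the tilings by U\<close>

lemma covers_mono: "covers Z X C a b \<Longrightarrow> Z \<subseteq> Z' \<Longrightarrow> covers Z' X C a b"
  unfolding covers_def by blast

text \<open>A change of alphabet is a substitution with one-cell patches. It is used for the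
  identity, from which the self-similarity is built up, and for passing from numbers to Jeandel-Rao
  tiles.\<close>

lemma embeds_relabel:
  assumes inj: "inj_on f A" and Y: "\<And>w n. w \<in> Y \<Longrightarrow> w n \<in> A" and X: "\<And>w. w \<in> Y \<Longrightarrow> f \<circ> w \<in> X"
  shows "embeds Y X (\<lambda>u. [(0, f u)]) (\<lambda>_. e1) (\<lambda>_. e2)"
proof -
  have I: "image_by (\<lambda>u. [(0, f u)]) (\<lambda>_. e1) (\<lambda>_. e2) w (\<lambda>n. n) (f \<circ> w)" for w
    by (simp add: image_by_def position_map_def partition_iff support_def)
  have "w = w' \<and> k = k'"
    if "w \<in> Y" "w' \<in> Y" "image_by (\<lambda>u. [(0, f u)]) (\<lambda>_. e1) (\<lambda>_. e2) w p x"
      "image_by (\<lambda>u. [(0, f u)]) (\<lambda>_. e1) (\<lambda>_. e2) w' p' x'"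
      "k \<in> support (\<lambda>u. [(0, f u)]) (w 0)" "k' \<in> support (\<lambda>u. [(0, f u)]) (w' 0)"
      "shift k x = shift k' x'" for w w' p p' x x' k k'
  proof -
    have "x = f \<circ> w" "x' = f \<circ> w'" "k = 0" "k' = 0"
      using that image_by_unique[OF I] by (auto simp: support_def)
    then have "f (w n) = f (w' n)" for n using that(7) by (metis comp_apply shift_zero)
    then have "w n = w' n" for n using inj Y that(1,2) by (meson inj_onD)
    then show ?thesis using \<open>k = 0\<close> \<open>k' = 0\<close> by auto
  qed
  moreover have "\<exists>p x. image_by (\<lambda>u. [(0, f u)]) (\<lambda>_. e1) (\<lambda>_. e2) w p x \<and> x \<in> X" if "w \<in> Y" for w
    using I X[OF that] by blast
  ultimately show ?thesis unfolding embeds_def by (simp only: list.map distinct_singleton) blast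
qed

lemma covers_self: "covers X X (\<lambda>u. [(0, u)]) (\<lambda>_. e1) (\<lambda>_. e2)"
proof -
  have "image_by (\<lambda>u. [(0, u)]) (\<lambda>_. e1) (\<lambda>_. e2) w (\<lambda>n. n) w" for w
    by (simp add: image_by_def position_map_def partition_iff support_def)
  then show ?thesis unfolding covers_def by (force simp: support_def intro!: exI[of _ 0])
qed

text \<open>A domino \<open>(s, t)\<close> is blocked if it cannot be extended to a \<open>2 \<times> 2\<close> square on one of its two long sides.\<close>

definition blocked :: "nat \<Rightarrow> (nat \<Rightarrow> nat \<Rightarrow> bool) \<Rightarrow> (nat \<Rightarrow> nat \<Rightarrow> bool) \<Rightarrow> nat \<times> nat \<Rightarrow> bool" where
  "blocked N A B = (\<lambda>(s, t).
     if list_all (\<lambda>s'. if B s s' then list_all (\<lambda>t'. if B t t' then \<not> A s' t' else True) [0..<N] else True) [0..<N]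
     then True
     else list_all (\<lambda>s'. if B s' s then list_all (\<lambda>t'. if B t' t then \<not> A s' t' else True) [0..<N] else True) [0..<N])"

text \<open>The directions \<open>e\<close> and \<open>f\<close> are arbitrary so that exchanging
  them, together with \<open>A\<close> and \<open>B\<close>, treats vertical dominoes.\<close>

lemma blocked_avoided:
  fixes w :: "point \<Rightarrow> nat"
  assumes A: "\<And>n. A (w n) (w (n + e))" and B: "\<And>n. B (w n) (w (n + f))" and N: "\<And>n. w n < N"
    and ok: "list_all (blocked N A B) D"
  shows "(w n, w (n + e)) \<notin> set D"
proof
  assume "(w n, w (n + e)) \<in> set D"
  then have bl: "blocked N A B (w n, w (n + e))" using ok by (simp add: list_all_iff)
  have c: "n + e + f = (n + f) + e" "n - f + e = n + e - f" by (simp_all add: algebra_simps)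
  have "A (w (n + f)) (w (n + e + f))" "A (w (n - f)) (w (n + e - f))"
    using A[of "n + f"] A[of "n - f"] unfolding c by simp_all
  moreover have "B (w n) (w (n + f))" "B (w (n + e)) (w (n + e + f))"
    "B (w (n - f)) (w n)" "B (w (n + e - f)) (w (n + e))"
    using B[of n] B[of "n + e"] B[of "n - f"] B[of "n + e - f"] by simp_all
  ultimately show False
    using bl N[of "n + f"] N[of "n + e + f"] N[of "n - f"] N[of "n + e - f"]
    unfolding blocked_def list_all_iff by (auto split: if_splits)
qed

lemma nn_shiftD:
  assumes "w \<in> nn_shift H V"
  shows "(w n, w (n + e1)) \<in> set H" "(w n, w (n + e2)) \<in> set V"
  using assms unfolding nn_shift_def by blast+

lemma nn_shift_mono:
  assumes "list_all (\<lambda>p. p \<in> set H') H" "list_all (\<lambda>p. p \<in> set V') V"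
  shows "nn_shift H V \<subseteq> nn_shift H' V'"
  using assms unfolding nn_shift_def list_all_iff by blast

text \<open>The tiles of \<open>\<U>\<close> are numbered by their positions in \<open>tile_list\<close>. Of the dominoes allowed by the colours,
  \<open>H_U\<close> and \<open>V_U\<close> contain those that survive three rounds of discarding blocked ones.\<close>

definition H_U :: "dominoes" where
  "H_U =
    [(0,3), (1,2), (1,3), (1,6), (2,0), (2,4), (3,7), (4,1), (5,1), (6,1), (6,5), (7,1),
    (8,16), (9,14), (10,12), (10,14), (11,17), (12,9), (13,9), (14,8), (14,11), (14,13),
    (14,18), (15,8), (15,11), (16,8), (16,13), (16,15), (17,8), (17,13), (18,10)]"

definition V_U :: "dominoes" where
  "V_U =
    [(0,8), (1,8), (1,9), (1,11), (2,16), (3,16), (4,13), (5,13), (6,14), (6,17), (7,15),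
    (8,0), (8,9), (8,11), (9,1), (9,10), (10,1), (11,1), (11,10), (12,6), (13,4), (13,7),
    (13,18), (14,2), (14,6), (14,12), (15,7), (15,13), (15,18), (16,3), (16,14), (16,17),
    (17,3), (17,14), (18,5)]"

definition drop_H1 :: "dominoes" where
  "drop_H1 =
    [(0,2), (0,6), (5,5), (9,12), (14,15), (15,15), (16,11), (16,18), (17,11), (17,15),
    (17,18)]"

definition drop_V1 :: "dominoes" where
  "drop_V1 =
    [(0,0), (0,9), (4,2), (4,4), (4,6), (4,7), (4,12), (4,18), (5,2), (5,4), (5,6), (5,7),
    (5,12), (5,18), (6,15), (7,3), (7,14), (7,17), (8,8), (10,10), (12,2), (12,4), (12,7),
    (12,12), (12,13), (12,18), (13,2), (13,6), (13,12), (13,13), (14,4), (14,7), (14,13),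
    (14,18), (15,2), (15,6), (15,12), (16,15), (17,15), (17,17)]"

definition drop_H2 :: "dominoes" where
  "drop_H2 =
    [(4,5), (15,13), (15,18)]"

definition drop_V2 :: "dominoes" where
  "drop_V2 =
    [(0,11), (1,0), (6,3), (15,4)]"

definition drop_H3 :: "dominoes" where
  "drop_H3 =
    [(7,5)]"

text \<open>First half of the self-similarity, with an intermediate alphabet of 20 letters. The
  second letters 0, 1, 8, 9, 10, 11 are the tiles with both top and bottom colour in {O, L}; no
  other tile has O or L there, so they fill whole columns.\<close>

definition tab_V :: "nat list list" where
  "tab_V =
    [[2], [3], [6], [14], [16], [17], [2,0], [4,1], [5,1], [6,1], [7,1], [12,9], [13,9],
    [14,8], [14,11], [15,8], [15,11], [16,8], [17,8], [18,10]]"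

definition H_V :: "dominoes" where
  "H_V =
    [(0,7), (1,10), (2,8), (3,12), (3,19), (4,12), (4,15), (4,16), (5,12), (6,1), (7,0), (7,1),
    (7,2), (7,6), (7,9), (8,0), (8,1), (8,2), (8,6), (8,9), (9,0), (9,1), (9,2), (9,6), (9,9),
    (10,0), (10,1), (10,2), (10,6), (10,9), (11,3), (11,13), (11,14), (12,3), (12,13), (12,14),
    (13,4), (13,17), (14,5), (14,18), (15,4), (15,17), (16,5), (16,18), (17,4), (17,17),
    (18,4), (18,17), (19,3), (19,11), (19,13), (19,14)]"

definition V_V :: "dominoes" where
  "V_V =
    [(0,4), (1,4), (2,3), (2,5), (3,0), (3,2), (4,1), (4,3), (4,5), (5,1), (5,3), (6,17),
    (7,12), (8,12), (9,13), (9,14), (9,18), (10,15), (10,16), (11,9), (12,7), (12,10), (12,19),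
    (13,6), (13,11), (14,9), (15,12), (16,10), (16,19), (17,14), (18,14), (19,8)]"

text \<open>Second half, along vertical lines. The 19 entries are numbered like the tiles of U, so
  that the composed step leads from U to U without a renaming.\<close>

definition tab_W :: "nat list list" where
  "tab_W =
    [[5], [4], [16], [12], [18], [17], [15], [13], [3,2], [5,1], [4,1], [3,0], [16,10], [14,9],
    [12,10], [11,9], [19,8], [12,7], [13,6]]"

text \<open>The \<open>2 \<times> 2\<close> patterns of tilings by \<open>\<U>\<close>. Entry \<open>k + 1\<close> occurs in the image of the entry whose
  index, together with the position, is recorded as entry \<open>k\<close> of \<open>quad_parents\<close>; entry 0 occurs in the image
  of every tile under the fourfold iterate, as witnessed by \<open>seed_positions\<close>.\<close>

definition quad_list :: "(nat \<times> nat \<times> nat \<times> nat) list" where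
  "quad_list =
    [(9,14,1,6), (17,13,3,7), (13,9,7,1), (3,7,16,15), (7,1,15,8), (13,9,4,1), (14,11,6,1),
    (4,1,13,9), (1,6,9,14), (6,1,14,8), (11,17,1,3), (1,3,8,16), (13,9,18,10), (9,14,10,12),
    (14,8,12,9), (18,10,5,1), (10,12,1,6), (12,9,6,1), (8,16,9,14), (6,1,17,8), (9,14,1,2),
    (1,2,8,16), (17,8,14,11), (8,16,11,17), (16,15,17,13), (15,8,13,9), (14,13,2,4),
    (2,4,16,13), (16,13,14,18), (14,18,6,5), (14,8,2,0), (8,16,0,3), (7,1,15,11), (16,15,3,7),
    (15,11,7,1), (1,6,11,17), (2,0,16,8), (0,3,8,16), (6,5,17,13), (5,1,13,9), (16,15,14,18),
    (15,11,18,10), (6,5,14,13), (6,1,14,11), (11,17,10,14), (10,14,1,6), (16,15,14,13),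
    (17,13,14,18), (16,8,14,11), (16,13,3,7)]"

definition quad_parents :: "(nat \<times> point) list" where
  "quad_parents =
    [(0,(0,0)), (0,(1,0)), (0,(0,1)), (0,(1,1)), (1,(0,0)), (1,(2,0)), (1,(0,1)), (1,(1,1)),
    (1,(2,1)), (2,(1,0)), (2,(1,1)), (3,(0,0)), (3,(1,0)), (3,(2,0)), (3,(0,1)), (3,(1,1)),
    (3,(2,1)), (4,(1,0)), (5,(0,1)), (6,(1,0)), (6,(1,1)), (7,(0,0)), (7,(1,0)), (8,(0,0)),
    (8,(1,0)), (10,(0,0)), (10,(0,1)), (11,(0,0)), (11,(0,1)), (12,(0,2)), (12,(1,2)),
    (13,(1,1)), (13,(0,2)), (13,(1,2)), (14,(1,1)), (15,(0,1)), (15,(1,1)), (18,(0,1)),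
    (18,(1,1)), (21,(0,0)), (21,(1,0)), (23,(0,1)), (24,(2,1)), (27,(1,0)), (27,(1,1)),
    (35,(0,0)), (37,(0,0)), (38,(2,0)), (44,(0,2))]"

definition seed_positions :: "(point \<times> point \<times> point) list" where
  "seed_positions =
    [((0,0), (0,1), (1,1)), ((0,0), (0,0), (1,0)), ((0,0), (0,1), (1,1)), ((0,0), (0,1),
    (1,1)), ((0,0), (0,1), (1,1)), ((0,0), (0,0), (1,0)), ((0,0), (0,1), (1,1)), ((0,0), (0,1),
    (1,1)), ((0,0), (0,1), (1,1)), ((0,0), (0,1), (1,1)), ((0,0), (0,0), (1,0)), ((0,0), (0,1),
    (1,1)), ((0,0), (0,1), (1,1)), ((0,0), (0,1), (1,1)), ((0,0), (0,1), (1,1)), ((0,0), (0,1),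
    (1,1)), ((1,0), (0,1), (1,1)), ((0,0), (0,1), (1,1)), ((0,0), (0,1), (1,1))]"

definition tile_list :: "letter tile list" where
  "tile_list =
    [(cF,cO,cJ,cO), (cF,cO,cH,cL), (cJ,cM,cF,cP), (cD,cM,cF,cK), (cH,cP,cJ,cP),
     (cH,cP,cH,cN), (cH,cK,cF,cP), (cH,cK,cD,cP), (cB,cO,cI,cO), (cG,cL,cE,cO),
     (cG,cL,cC,cL), (cA,cL,cI,cO), (cE,cP,cG,cP), (cE,cP,cI,cP), (cI,cP,cG,cK),
     (cI,cP,cI,cK), (cI,cK,cB,cM), (cI,cK,cA,cK), (cC,cN,cI,cP)]"

definition h_match :: "dominoes \<Rightarrow> nat \<Rightarrow> nat \<Rightarrow> bool" where
  "h_match D s t \<longleftrightarrow> (if right_color (tile_list ! s) = left_color (tile_list ! t) then (s, t) \<notin> set D else False)"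

definition v_match :: "dominoes \<Rightarrow> nat \<Rightarrow> nat \<Rightarrow> bool" where
  "v_match D s t \<longleftrightarrow> (if top_color (tile_list ! s) = bottom_color (tile_list ! t) then (s, t) \<notin> set D else False)"

lemma h_match_iff:
  "h_match D s t \<longleftrightarrow> right_color (tile_list ! s) = left_color (tile_list ! t) \<and> (s, t) \<notin> set D"
  by (simp add: h_match_def)

lemma v_match_iff:
  "v_match D s t \<longleftrightarrow> top_color (tile_list ! s) = bottom_color (tile_list ! t) \<and> (s, t) \<notin> set D"
  by (simp add: v_match_def)

lemma drop_1: "list_all (blocked 19 (h_match []) (v_match [])) drop_H1"
    "list_all (blocked 19 (v_match []) (h_match [])) drop_V1"
  by code_simp+

lemma drop_2: "list_all (blocked 19 (h_match drop_H1) (v_match drop_V1)) drop_H2"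
    "list_all (blocked 19 (v_match drop_V1) (h_match drop_H1)) drop_V2"
  by code_simp+

lemma drop_3: "list_all (blocked 19 (h_match (drop_H1 @ drop_H2)) (v_match (drop_V1 @ drop_V2))) drop_H3"
  by code_simp

lemma remaining: "list_all (\<lambda>s. list_all (\<lambda>t.
    (if h_match (drop_H1 @ drop_H2 @ drop_H3) s t then (s, t) \<in> set H_U else True) \<and>
    (if v_match (drop_V1 @ drop_V2) s t then (s, t) \<in> set V_U else True)) [0..<19]) [0..<19]"
  by code_simp

lemma word_ok_V: "word_ok tab_V H_V V_V H_U V_U" by code_simp
lemma word_ok_W: "word_ok tab_W V_U H_U V_V H_V" by code_simp
lemma pair_ok_V: "pair_ok tab_V [0, 1, 8, 9, 10, 11] H_U V_U" by code_simp
lemma pair_ok_W: "pair_ok tab_W [0, 1, 2, 6, 7, 8, 9, 10] V_V H_V" by code_simp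

definition shift_U :: "(point \<Rightarrow> nat) set" where
  "shift_U = nn_shift H_U V_U"

text \<open>Each round profits from the previous ones: a domino whose extensions have all been
  discarded becomes blocked in turn. The third round discards only a horizontal domino.\<close>

lemma color_shift_U:
  assumes N: "\<And>n. w n < 19" and h: "\<And>n. h_match [] (w n) (w (n + e1))" and v: "\<And>n. v_match [] (w n) (w (n + e2))"
  shows "w \<in> shift_U"
proof -
  have h1: "h_match drop_H1 (w n) (w (n + e1))" and v1: "v_match drop_V1 (w n) (w (n + e2))" for n
    using blocked_avoided[OF h v N drop_1(1), of n] blocked_avoided[OF v h N drop_1(2), of n] h[of n] v[of n]
    by (simp_all add: h_match_iff v_match_iff)
  have h2: "h_match (drop_H1 @ drop_H2) (w n) (w (n + e1))" and v2: "v_match (drop_V1 @ drop_V2) (w n) (w (n + e2))" for n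
    using blocked_avoided[OF h1 v1 N drop_2(1), of n] blocked_avoided[OF v1 h1 N drop_2(2), of n] h1[of n] v1[of n]
    by (simp_all add: h_match_iff v_match_iff)
  have h3: "h_match (drop_H1 @ drop_H2 @ drop_H3) (w n) (w (n + e1))" for n
    using blocked_avoided[OF h2 v2 N drop_3, of n] h2[of n] by (simp add: h_match_iff)
  show ?thesis
    unfolding shift_U_def nn_shift_def
  proof (intro CollectI allI conjI)
    fix n
    show "(w n, w (n + e1)) \<in> set H_U" "(w n, w (n + e2)) \<in> set V_U"
      using remaining h3[of n] v2[of n] N[of n] N[of "n + e1"] N[of "n + e2"]
      unfolding list_all_iff by auto
  qed
qed

lemma pull_V: "nn_shift (pull_along tab_V H_U) (pull_across tab_V V_U) \<subseteq> nn_shift H_V V_V"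
  by (rule nn_shift_mono) code_simp+

lemma pull_W_colors: "list_all (\<lambda>(u, v). u < 19 \<and> h_match [] u v) (pull_across tab_W H_V)"
    "list_all (\<lambda>(u, v). v_match [] u v) (pull_along tab_W V_V)"
  by code_simp+

text \<open>The inherited dominoes are only checked for matching colours;
  \<open>color_shift_U\<close> then yields the finer relations.\<close>

lemma pull_W: "nn_shift (pull_across tab_W H_V) (pull_along tab_W V_V) \<subseteq> shift_U"
proof
  fix w assume w: "w \<in> nn_shift (pull_across tab_W H_V) (pull_along tab_W V_V)"
  show "w \<in> shift_U"
  proof (rule color_shift_U)
    show "w n < 19" "h_match [] (w n) (w (n + e1))" "v_match [] (w n) (w (n + e2))" for n
      using nn_shiftD[OF w, of n] pull_W_colors unfolding list_all_iff by blast+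
  qed
qed

text \<open>Puts one round of the self-similarity in front of a decomposition over U. From the
  trivial one-cell patches it produces the substitution, and from the substitution its
  square.\<close>

definition inflate where
  "inflate C a b = word_cells True tab_W (word_cells False tab_V C a b) (adv_a False tab_V a) (adv_b False tab_V b)"

definition inflate_a where "inflate_a a = adv_a True tab_W (adv_a False tab_V a)"
definition inflate_b where "inflate_b b = adv_b True tab_W (adv_b False tab_V b)"

lemma shift_U_closed: "w \<in> shift_U \<Longrightarrow> shift n w \<in> shift_U"
  using nn_shift_closed[of w False] by (simp add: shift_U_def nn_def)

lemma shift_U_letter: "w \<in> shift_U \<Longrightarrow> w n < 19"
proof -
  assume "w \<in> shift_U"
  then have "(w n, w (n + e1)) \<in> set H_U" unfolding shift_U_def by (rule nn_shiftD)
  moreover have "list_all (\<lambda>(u, v). u < 19) H_U" by code_simp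
  ultimately show "w n < 19" by (auto simp: list_all_iff)
qed

lemma embeds_V:
  assumes "embeds shift_U X C a b"
  shows "embeds (nn_shift H_V V_V) X (word_cells False tab_V C a b) (adv_a False tab_V a) (adv_b False tab_V b)"
  using embeds_word_cells[OF word_ok_V, where d = False] assms by (simp add: nn_def shift_U_def)

lemma embeds_inflate:
  assumes "embeds shift_U X C a b"
  shows "embeds shift_U X (inflate C a b) (inflate_a a) (inflate_b b)"
  using embeds_word_cells[OF word_ok_W, where d = True] embeds_V[OF assms]
  by (simp add: nn_def shift_U_def inflate_def inflate_a_def inflate_b_def)

lemma covers_V_step: "covers (nn_shift H_V V_V) shift_U
    (word_patch False tab_V) (word_a False tab_V) (word_b False tab_V)"
  by (rule covers_mono[OF covers_word[OF pair_ok_V, where d = False, unfolded nn_def if_False, folded shift_U_def] pull_V])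

lemma covers_W_step: "covers shift_U (nn_shift H_V V_V)
    (word_patch True tab_W) (word_a True tab_W) (word_b True tab_W)"
  by (rule covers_mono[OF covers_word[OF pair_ok_W, where d = True, unfolded nn_def if_True] pull_W])

lemma covers_inflate:
  assumes "embeds shift_U X C a b" "covers shift_U X C a b" "\<And>x n. x \<in> X \<Longrightarrow> shift n x \<in> X"
  shows "covers shift_U X (inflate C a b) (inflate_a a) (inflate_b b)"
proof -
  have "covers (nn_shift H_V V_V) X (word_cells False tab_V C a b) (adv_a False tab_V a) (adv_b False tab_V b)"
    using covers_word_cells[OF word_ok_V, where d = False and X = X and C = C and a = a and b = b] assms covers_V_step
    by (simp add: nn_def shift_U_def)
  then show ?thesis
    using covers_word_cells[OF word_ok_W, where d = True and X = X and C = "word_cells False tab_V C a b"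
        and a = "adv_a False tab_V a" and b = "adv_b False tab_V b"]
      embeds_V[OF assms(1)] covers_W_step assms(3)
    by (simp add: nn_def shift_U_def inflate_def inflate_a_def inflate_b_def)
qed

definition sub_cells where "sub_cells = inflate (\<lambda>u. [(0, u)]) (\<lambda>_. e1) (\<lambda>_. e2)"
definition sub_a where "sub_a = inflate_a (\<lambda>_. e1)"
definition sub_b where "sub_b = inflate_b (\<lambda>_. e2)"
text \<open>The square is formed because tile 0 becomes the word \<open>[5]\<close> and then the
  single tile 17, so one round alone does not expand by a factor 2.\<close>

definition sub2_cells where "sub2_cells = inflate sub_cells sub_a sub_b"
definition sub2_a where "sub2_a = inflate_a sub_a"
definition sub2_b where "sub2_b = inflate_b sub_b"

definition box_ok :: "(nat \<Rightarrow> (point \<times> nat) list) \<Rightarrow> (nat \<Rightarrow> point) \<Rightarrow> (nat \<Rightarrow> point) \<Rightarrow> int \<Rightarrow> nat \<Rightarrow> bool" where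
  "box_ok C a b g u \<longleftrightarrow> snd (a u) = 0 \<and> g \<le> fst (a u) \<and> fst (b u) = 0 \<and> g \<le> snd (b u) \<and>
     list_all (\<lambda>(z, c). 0 \<le> fst z \<and> fst z < fst (a u) \<and> 0 \<le> snd z \<and> snd z < snd (b u)) (C u) \<and>
     list_all (\<lambda>i. list_all (\<lambda>j. (i, j) \<in> set (map fst (C u))) [0..snd (b u) - 1]) [0..fst (a u) - 1]"

lemma box_okD:
  assumes "box_ok C a b g u"
  shows "snd (a u) = 0 \<and> g \<le> fst (a u) \<and> fst (b u) = 0 \<and> g \<le> snd (b u)"
    and "s \<in> support C u \<longleftrightarrow> 0 \<le> fst s \<and> fst s < fst (a u) \<and> 0 \<le> snd s \<and> snd s < snd (b u)"
proof -
  show "snd (a u) = 0 \<and> g \<le> fst (a u) \<and> fst (b u) = 0 \<and> g \<le> snd (b u)"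
    using assms by (simp add: box_ok_def)
  show "s \<in> support C u \<longleftrightarrow> 0 \<le> fst s \<and> fst s < fst (a u) \<and> 0 \<le> snd s \<and> snd s < snd (b u)"
  proof
    show "s \<in> support C u \<Longrightarrow> 0 \<le> fst s \<and> fst s < fst (a u) \<and> 0 \<le> snd s \<and> snd s < snd (b u)"
      using assms unfolding box_ok_def list_all_iff support_def by fastforce
    assume s: "0 \<le> fst s \<and> fst s < fst (a u) \<and> 0 \<le> snd s \<and> snd s < snd (b u)"
    then have "fst s \<in> set [0..fst (a u) - 1]" "snd s \<in> set [0..snd (b u) - 1]" by auto
    then have "(fst s, snd s) \<in> set (map fst (C u))" using assms unfolding box_ok_def list_all_iff by blast
    then show "s \<in> support C u" by (simp add: support_def)
  qed
qed

lemma sub_boxes: "list_all (box_ok sub_cells sub_a sub_b 1) [0..<19]" by code_simp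
lemma sub2_boxes: "list_all (box_ok sub2_cells sub2_a sub2_b 2) [0..<19]" by code_simp

lemma embeds_sub: "embeds shift_U shift_U sub_cells sub_a sub_b"
  unfolding sub_cells_def sub_a_def sub_b_def
  by (rule embeds_inflate, rule embeds_relabel[of "\<lambda>u. u" UNIV]) (simp_all add: comp_def)

lemma covers_sub: "covers shift_U shift_U sub_cells sub_a sub_b"
  unfolding sub_cells_def sub_a_def sub_b_def
  by (rule covers_inflate[OF _ covers_self shift_U_closed], rule embeds_relabel[of "\<lambda>u. u" UNIV]) (simp_all add: comp_def)

interpretation sub: rect_substitution shift_U sub_cells sub_a sub_b 1
proof
  show "embeds shift_U shift_U sub_cells sub_a sub_b" "covers shift_U shift_U sub_cells sub_a sub_b"
    using embeds_sub covers_sub by blast+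
  have "box_ok sub_cells sub_a sub_b 1 (w n)" if "w \<in> shift_U" for w n
    using sub_boxes shift_U_letter[OF that, of n] by (simp add: list_all_iff)
  then show "snd (sub_a (w n)) = 0 \<and> 1 \<le> fst (sub_a (w n)) \<and> fst (sub_b (w n)) = 0 \<and> 1 \<le> snd (sub_b (w n))"
    "s \<in> support sub_cells (w n) \<longleftrightarrow>
       0 \<le> fst s \<and> fst s < fst (sub_a (w n)) \<and> 0 \<le> snd s \<and> snd s < snd (sub_b (w n))"
    if "w \<in> shift_U" for w n s using that box_okD by blast+
qed (simp_all add: shift_U_closed)

interpretation sub2: rect_substitution shift_U sub2_cells sub2_a sub2_b 2
proof
  show "embeds shift_U shift_U sub2_cells sub2_a sub2_b" "covers shift_U shift_U sub2_cells sub2_a sub2_b"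
    unfolding sub2_cells_def sub2_a_def sub2_b_def
    using embeds_inflate[OF embeds_sub] covers_inflate[OF embeds_sub covers_sub shift_U_closed] by blast+
  have "box_ok sub2_cells sub2_a sub2_b 2 (w n)" if "w \<in> shift_U" for w n
    using sub2_boxes shift_U_letter[OF that, of n] by (simp add: list_all_iff)
  then show "snd (sub2_a (w n)) = 0 \<and> 2 \<le> fst (sub2_a (w n)) \<and> fst (sub2_b (w n)) = 0 \<and> 2 \<le> snd (sub2_b (w n))"
    "s \<in> support sub2_cells (w n) \<longleftrightarrow>
       0 \<le> fst s \<and> fst s < fst (sub2_a (w n)) \<and> 0 \<le> snd s \<and> snd s < snd (sub2_b (w n))"
    if "w \<in> shift_U" for w n s using that box_okD by blast+
qed (simp_all add: shift_U_closed)

definition allowed_quads :: "(nat \<times> nat \<times> nat \<times> nat) list" where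
  "allowed_quads = concat (map (\<lambda>(s, t). concat (map (\<lambda>(x, u). if x = s then
     concat (map (\<lambda>(y, v). if y = u then (if (t, v) \<in> set V_U then [(s, t, u, v)] else []) else []) H_U) else []) V_U)) H_U)"

text \<open>The quadruple \<open>(10, 14, 1, 2)\<close> is compatible with the adjacency relations but occurs in no
  tiling, since it is not inside the image of any other quadruple.\<close>

lemma allowed_quads_listed:
  "list_all (\<lambda>q. q = (10, 14, 1, 2) \<or> q \<in> set quad_list) allowed_quads"
  by code_simp

lemma orphan_quad:
  "list_all (\<lambda>q. let L = quad_patch sub_cells sub_a sub_b q in
     list_all (\<lambda>(z, c). if c = 10 then quad_at L z \<noteq> Some (10, 14, 1, 2) else True) L) allowed_quads"
  by code_simp

lemma quad_chain:
  "length quad_list = Suc (length quad_parents) \<and> quad_list ! 0 = (9, 14, 1, 6) \<and>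
   list_all (\<lambda>k. case quad_parents ! k of (m, z) \<Rightarrow> m \<le> k \<and>
     quad_at (quad_patch sub_cells sub_a sub_b (quad_list ! m)) z = Some (quad_list ! Suc k))
   [0..<length quad_parents]"
  by code_simp

lemma seed_reached:
  "list_all (\<lambda>u. case seed_positions ! u of (x, y, z) \<Rightarrow>
     case quad_at (sub2_cells u) x of None \<Rightarrow> False | Some q \<Rightarrow>
     case quad_at (quad_patch sub_cells sub_a sub_b q) y of None \<Rightarrow> False | Some q' \<Rightarrow>
     quad_at (quad_patch sub_cells sub_a sub_b q') z = Some (9, 14, 1, 6)) [0..<19]"
  by code_simp

lemma quad_allowed:
  assumes "w \<in> shift_U" shows "quad w n \<in> set allowed_quads"
proof -
  have h: "(w n, w (n + e1)) \<in> set H_U" and v: "(w n, w (n + e2)) \<in> set V_U" for n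
    using assms nn_shiftD unfolding shift_U_def by blast+
  have d: "n + (1, 0) = n + e1" "n + (0, 1) = n + e2" "n + (1, 1) = n + e1 + e2" "n + e1 + e2 = n + e2 + e1"
    by (simp_all add: e1_def e2_def prod_eq_iff)
  have h': "(w (n + e2), w (n + e1 + e2)) \<in> set H_U" using h[of "n + e2"] unfolding d(4) .
  show ?thesis
    unfolding allowed_quads_def quad_def d(1-3)
    by (intro concat_mapI[OF h[of n]], unfold prod.case, intro concat_mapI[OF v[of n]], unfold prod.case if_True simp_thms,
        intro concat_mapI[OF h']) (use v[of "n + e1"] in auto)
qed

text \<open>The configuration is desubstituted twice by the substitution and once by its square. The
  fourth iterate of any tile contains the seed, so one tile of the deepest preimage decides.\<close>

lemma seed_universal: "sub.universal (9, 14, 1, 6)"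
  unfolding sub.universal_def
proof
  fix v assume "v \<in> shift_U"
  then obtain w p y k where w: "w \<in> shift_U" "image_by sub_cells sub_a sub_b w p y" "v = shift k y"
    using covers_sub unfolding covers_def by blast
  obtain w' p' y' k' where w': "w' \<in> shift_U" "image_by sub_cells sub_a sub_b w' p' y'" "w = shift k' y'"
    using covers_sub w(1) unfolding covers_def by blast
  obtain w'' p'' y'' k'' where w'': "w'' \<in> shift_U" "image_by sub2_cells sub2_a sub2_b w'' p'' y''" "w' = shift k'' y''"
    using sub2.cov w'(1) unfolding covers_def by blast
  obtain x z t where xyz: "seed_positions ! w'' 0 = (x, z, t)" by (cases "seed_positions ! w'' 0")
  have "w'' 0 \<in> set [0..<19]" using shift_U_letter[OF w''(1)] by simp
  then obtain q q' where q: "quad_at (sub2_cells (w'' 0)) x = Some q"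
    "quad_at (quad_patch sub_cells sub_a sub_b q) z = Some q'"
    "quad_at (quad_patch sub_cells sub_a sub_b q') t = Some (9, 14, 1, 6)"
    using seed_reached xyz unfolding list_all_iff by (fastforce split: option.splits)
  have "quad y'' (p'' 0 + x) = q"
    by (rule quad_at_occurs[OF q(1)]) (use image_by_value[OF w''(2)] in blast)
  then have "quad w' (p'' 0 + x - k'') = q" unfolding w''(3) sub.quad_shift by simp
  from sub.occurs_in_quad_image[OF w'(1,2) this q(2)]
  have "quad w (p' (p'' 0 + x - k'') + z - k') = q'" unfolding w'(3) sub.quad_shift by simp
  from sub.occurs_in_quad_image[OF w(1,2) this q(3)]
  show "\<exists>m. quad v m = (9, 14, 1, 6)" unfolding w(3) sub.quad_shift by (metis diff_add_cancel)
qed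

lemma listed_universal: "k < length quad_list \<Longrightarrow> sub.universal (quad_list ! k)"
proof (induction k rule: less_induct)
  case (less k)
  show ?case
  proof (cases k)
    case 0
    then show ?thesis using seed_universal quad_chain by simp
  next
    case (Suc j)
    obtain m z where mz: "quad_parents ! j = (m, z)" by (cases "quad_parents ! j")
    have "j \<in> set [0..<length quad_parents]" using less.prems Suc quad_chain by simp
    then have "m \<le> j" "quad_at (quad_patch sub_cells sub_a sub_b (quad_list ! m)) z = Some (quad_list ! Suc j)"
      using quad_chain mz unfolding list_all_iff by fastforce+
    then show ?thesis using sub.universal_step less.IH[of m] less.prems Suc by simp
  qed
qed

text \<open>Every pattern has a parent whose image contains it, which rules out the one spurious
  candidate. The remaining candidates are listed, and listed patterns occur in every tiling.\<close>

lemma quads_universal: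
  assumes w: "w \<in> shift_U" shows "quad w n \<in> set quad_list" and "sub.universal (quad w n)"
proof -
  have sh: "shift n w \<in> shift_U" by (rule shift_U_closed[OF w])
  obtain v k where v: "v \<in> shift_U" "quad_at (quad_patch sub_cells sub_a sub_b (quad v 0)) k = Some (quad (shift n w) 0)"
    by (rule sub.quad_parent[OF sh])
  have "quad w n \<noteq> (10, 14, 1, 2)"
  proof
    assume "quad w n = (10, 14, 1, 2)"
    then have at: "quad_at (quad_patch sub_cells sub_a sub_b (quad v 0)) k = Some (10, 14, 1, 2)"
      using v(2) by (simp add: sub.quad_shift)
    then have "(k, 10) \<in> set (quad_patch sub_cells sub_a sub_b (quad v 0))"
      unfolding quad_at_iff by (auto dest: map_of_SomeD)
    then show False
      using orphan_quad quad_allowed[OF v(1), of 0] at unfolding list_all_iff Let_def by fastforce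
  qed
  then show q: "quad w n \<in> set quad_list"
    using allowed_quads_listed quad_allowed[OF w, of n] unfolding list_all_iff by blast
  then show "sub.universal (quad w n)" using listed_universal by (metis in_set_conv_nth)
qed

lemma shift_U_recurs: "sub2.recurs L"
proof (rule sub2.recurs_all)
  have "sub.recurs 2" by (rule sub.recurs_2I) (use quads_universal in blast)
  \<comment> \<open>Recurrence speaks about the set of tilings only, so the base case obtained from
    the substitution serves for its square.\<close>
  then show "sub2.recurs 2" unfolding sub.recurs_def sub2.recurs_def .
qed simp

lemma shift_U_aperiodic: "w \<in> shift_U \<Longrightarrow> shift n w = w \<Longrightarrow> n = 0"
  by (rule sub2.aperiodic_shift) simp_all

lemma shift_U_recurrent:
  assumes "w \<in> shift_U" "v \<in> shift_U" "finite G"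
  obtains m where "\<And>z. z \<in> G \<Longrightarrow> v (z + m) = w z"
proof -
  obtain K where K: "\<And>z. z \<in> G \<Longrightarrow> \<bar>fst z\<bar> < K \<and> \<bar>snd z\<bar> < K"
  proof -
    define B where "B = Max (insert 0 ((\<lambda>z. \<bar>fst z\<bar> + \<bar>snd z\<bar>) ` G))"
    have B: "\<bar>fst z\<bar> + \<bar>snd z\<bar> \<le> B" if "z \<in> G" for z
      unfolding B_def using that assms(3) by (intro Max_ge) auto
    show ?thesis by (rule that[of "B + 1"]) (use B in fastforce)
  qed
  \<comment> \<open>Recurrence is stated for squares in the first quadrant; the translation moves
    the window around the origin there.\<close>
  have "shift (- K, - K) w \<in> shift_U" by (rule shift_U_closed[OF assms(1)])
  then obtain m where m: "\<And>i j. 0 \<le> i \<Longrightarrow> i < 2 * K \<Longrightarrow> 0 \<le> j \<Longrightarrow> j < 2 * K \<Longrightarrow>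
      v (m + (i, j)) = shift (- K, - K) w (i, j)"
    using shift_U_recurs[of "2 * K"] assms(2) unfolding sub2.recurs_def by blast
  have "v (z + (m + (K, K))) = w z" if "z \<in> G" for z
  proof -
    obtain i j where z: "z = (i, j)" by (cases z)
    have "0 \<le> i + K" "i + K < 2 * K" "0 \<le> j + K" "j + K < 2 * K" using K[OF that] z by auto
    then have "v (m + (i + K, j + K)) = w (i, j)" using m[of "i + K" "j + K"] by (simp add: shift_def)
    moreover have "(i, j) + (m + (K, K)) = m + (i + K, j + K)" by (simp add: prod_eq_iff)
    ultimately show ?thesis unfolding z by (simp only:)
  qed
  then show ?thesis using that by blast
qed

section \<open>Subshifts generated by a recognizable substitution\<close>

definition full_shift :: "'a set \<Rightarrow> (point \<Rightarrow> 'a) set" where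
  "full_shift T = {x. \<forall>n. x n \<in> T}"

lemma full_shiftD: "x \<in> full_shift T \<Longrightarrow> x n \<in> T"
  unfolding full_shift_def by blast

lemma full_shiftI: "(\<And>n. x n \<in> T) \<Longrightarrow> x \<in> full_shift T"
  unfolding full_shift_def by blast

abbreviation full_topology :: "'a set \<Rightarrow> (point \<Rightarrow> 'a) topology" where
  "full_topology T \<equiv> product_topology (\<lambda>_. discrete_topology T) UNIV"

lemma topspace_full: "topspace (full_topology T) = full_shift T"
  by (auto simp: full_shift_def)

lemma openin_fullI:
  assumes "U \<subseteq> full_shift T"
    and "\<And>x. x \<in> U \<Longrightarrow> \<exists>G. finite G \<and> (\<forall>y\<in>full_shift T. (\<forall>g\<in>G. y g = x g) \<longrightarrow> y \<in> U)"
  shows "openin (full_topology T) U"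
proof (subst openin_subopen, intro ballI)
  fix x assume x: "x \<in> U"
  obtain G where G: "finite G" and G': "\<forall>y\<in>full_shift T. (\<forall>g\<in>G. y g = x g) \<longrightarrow> y \<in> U"
    using assms(2)[OF x] by (elim exE conjE)
  let ?V = "\<lambda>g. if g \<in> G then {x g} else T"
  have xT: "x g \<in> T" for g by (rule full_shiftD) (use x assms(1) in blast)
  have "finite {g. ?V g \<noteq> topspace (discrete_topology T)}"
    by (rule finite_subset[OF _ G]) auto
  then have "openin (full_topology T) (\<Pi>\<^sub>E g\<in>UNIV. ?V g)"
    by (intro product_topology_basis) (use xT in auto)
  moreover have "x \<in> (\<Pi>\<^sub>E g\<in>UNIV. ?V g)" using xT by auto
  moreover have "(\<Pi>\<^sub>E g\<in>UNIV. ?V g) \<subseteq> U"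
  proof
    fix y assume y: "y \<in> (\<Pi>\<^sub>E g\<in>UNIV. ?V g)"
    then have v: "y g \<in> ?V g" for g using PiE_mem[OF y, of g] by simp
    have "y g \<in> T" for g using v[of g] xT[of g] by (cases "g \<in> G") auto
    moreover have "y g = x g" if "g \<in> G" for g using v[of g] that by simp
    ultimately show "y \<in> U" using G' full_shiftI[of y T] by blast
  qed
  ultimately show "\<exists>V. openin (full_topology T) V \<and> x \<in> V \<and> V \<subseteq> U" by blast
qed

lemma closedin_fullI:
  assumes "A \<subseteq> full_shift T"
    and "\<And>x. x \<in> full_shift T \<Longrightarrow> x \<notin> A \<Longrightarrow>
      \<exists>G. finite G \<and> (\<forall>y\<in>full_shift T. (\<forall>g\<in>G. y g = x g) \<longrightarrow> y \<notin> A)"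
  shows "closedin (full_topology T) A"
  unfolding closedin_def topspace_full
proof (intro conjI openin_fullI)
  fix x assume "x \<in> full_shift T - A"
  then show "\<exists>G. finite G \<and> (\<forall>y\<in>full_shift T. (\<forall>g\<in>G. y g = x g) \<longrightarrow> y \<in> full_shift T - A)"
    using assms(2)[of x] by (metis DiffE DiffI)
qed (use assms(1) in auto)

lemma closedin_fullD:
  assumes cl: "closedin (full_topology T) A" and x: "x \<in> full_shift T"
    and lim: "\<And>G. finite G \<Longrightarrow> \<exists>y\<in>A. \<forall>g\<in>G. y g = x g"
  shows "x \<in> A"
proof (rule ccontr)
  assume "x \<notin> A"
  then have "x \<in> full_shift T - A" using x by blast
  moreover have "openin (full_topology T) (full_shift T - A)"
    using cl unfolding closedin_def topspace_full by blast
  ultimately have "\<exists>U. finite {i \<in> UNIV. U i \<noteq> topspace (discrete_topology T)} \<and>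
      (\<forall>i\<in>UNIV. openin (discrete_topology T) (U i)) \<and> x \<in> Pi\<^sub>E UNIV U \<and> Pi\<^sub>E UNIV U \<subseteq> full_shift T - A"
    unfolding openin_product_topology_alt by (rule bspec[rotated])
  then obtain U where U: "finite {i. U i \<noteq> T}" "x \<in> Pi\<^sub>E UNIV U" "Pi\<^sub>E UNIV U \<subseteq> full_shift T - A"
    by (simp only: topspace_discrete_topology UNIV_I simp_thms) blast
  obtain y where y: "y \<in> A" "\<And>g. U g \<noteq> T \<Longrightarrow> y g = x g" using lim[OF U(1)] by blast
  have "y \<in> full_shift T" using y(1) cl closedin_subset topspace_full by blast
  have "y g \<in> U g" for g
  proof (cases "U g = T")
    case True then show ?thesis using full_shiftD[OF \<open>y \<in> full_shift T\<close>] by simp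
  next
    case False then show ?thesis using y(2)[OF False] U(2) by (auto simp: PiE_def)
  qed
  then have "y \<in> Pi\<^sub>E UNIV U" by auto
  then show False using U(3) y(1) by blast
qed

text \<open>The family decreases as the window grows, so the member for the union of finitely many
  windows lies in all of theirs, and the finite intersection property applies.\<close>

lemma compactness:
  assumes T: "finite T"
    and sub: "\<And>G. finite G \<Longrightarrow> A G \<subseteq> full_shift T" and ne: "\<And>G. finite G \<Longrightarrow> A G \<noteq> {}"
    and anti: "\<And>G G'. finite G' \<Longrightarrow> G \<subseteq> G' \<Longrightarrow> A G' \<subseteq> A G"
    and cyl: "\<And>G x. finite G \<Longrightarrow> x \<in> full_shift T \<Longrightarrow> x \<notin> A G \<Longrightarrow>
      \<exists>F. finite F \<and> (\<forall>y\<in>full_shift T. (\<forall>g\<in>F. y g = x g) \<longrightarrow> y \<notin> A G)"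
  obtains x :: "point \<Rightarrow> 'a" where "\<And>G. finite (G :: point set) \<Longrightarrow> x \<in> A G"
proof -
  have "compact_space (full_topology T)"
    using T by (simp add: compact_space_product_topology compact_space_discrete_topology)
  moreover have "closedin (full_topology T) C" if "C \<in> A ` {G. finite G}" for C
    using that closedin_fullI[OF sub cyl] by blast
  moreover have "\<Inter>\<F> \<noteq> {}" if "finite \<F>" "\<F> \<subseteq> A ` {G. finite G}" for \<F>
  proof -
    from finite_subset_image[OF that]
    obtain \<G> where G: "\<G> \<subseteq> {G. finite G}" "finite \<G>" "\<F> = A ` \<G>" by blast
    then have "finite (\<Union>\<G>)" by auto
    then have "A (\<Union>\<G>) \<subseteq> \<Inter>\<F>" using G(3) anti by blast
    then show ?thesis using ne[OF \<open>finite (\<Union>\<G>)\<close>] by blast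
  qed
  ultimately have "\<Inter>(A ` {G. finite G}) \<noteq> {}" unfolding compact_space_fip by blast
  then show ?thesis using that by blast
qed

locale realization =
  fixes U :: "(point \<Rightarrow> nat) set" and N :: nat and X :: "(point \<Rightarrow> 't) set" and T :: "'t set"
    and C :: "nat \<Rightarrow> (point \<times> 't) list" and a b :: "nat \<Rightarrow> point"
  assumes emb: "embeds U X C a b"
    and U_shift: "\<And>w n. w \<in> U \<Longrightarrow> shift n w \<in> U" and X_shift: "\<And>x n. x \<in> X \<Longrightarrow> shift n x \<in> X"
    and X_full: "X \<subseteq> full_shift T"
    and U_letters: "U \<subseteq> full_shift {..<N}" and U_nonempty: "U \<noteq> {}"
    and U_local: "\<And>w. w \<notin> U \<Longrightarrow> \<exists>F. finite F \<and> (\<forall>v. (\<forall>g\<in>F. v g = w g) \<longrightarrow> v \<notin> U)"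
    and U_recurrent: "\<And>w v G. w \<in> U \<Longrightarrow> v \<in> U \<Longrightarrow> finite G \<Longrightarrow> \<exists>m. \<forall>z\<in>G. v (z + m) = w z"
    and U_aperiodic: "\<And>w n. w \<in> U \<Longrightarrow> shift n w = w \<Longrightarrow> n = 0"
begin

definition image_shift :: "(point \<Rightarrow> 't) set" where
  "image_shift = {x. \<exists>w\<in>U. \<exists>p y. \<exists>k\<in>support C (w 0). image_by C a b w p y \<and> x = shift k y}"

lemma image_in_X: "w \<in> U \<Longrightarrow> image_by C a b w p y \<Longrightarrow> y \<in> X"
  using embeds_image[OF emb] image_by_unique by metis

lemma image_shift_subset: "image_shift \<subseteq> X"
  unfolding image_shift_def using image_in_X X_shift by blast

lemma image_shiftI:
  assumes "w \<in> U" "image_by C a b w p y"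
  shows "shift n y \<in> image_shift"
proof -
  obtain m s where m: "n = p m + s" "s \<in> support C (w m)" by (rule image_by_obtain[OF assms(2)])
  have "shift n y = shift s (shift (p m) y)" by (simp add: shift_shift m(1) add.commute)
  moreover have "s \<in> support C (shift m w 0)" using m(2) by (simp add: shift_def)
  ultimately show ?thesis
    unfolding image_shift_def using U_shift[OF assms(1)] image_by_shift[OF assms(2), of m] by blast
qed

lemma image_shift_shift:
  assumes "x \<in> image_shift" shows "shift n x \<in> image_shift"
proof -
  obtain w p y k where "w \<in> U" "image_by C a b w p y" "x = shift k y"
    using assms unfolding image_shift_def by blast
  then show ?thesis using image_shiftI[of w p y "n + k"] by (simp add: shift_shift)
qed

text \<open>For a limit \<open>x\<close> of images, \<open>A G\<close> collects the preimages of
  configurations that agree with \<open>x\<close> on \<open>G\<close>. Compactness gives one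
  preimage \<open>w\<close> for all windows at once, and finiteness of the patch at its origin then
  gives one offset.\<close>

lemma closedin_image_shift: "closedin (full_topology T) image_shift"
proof (rule closedin_fullI)
  show "image_shift \<subseteq> full_shift T" using image_shift_subset X_full by blast
  fix x assume "x \<in> full_shift T" "x \<notin> image_shift"
  show "\<exists>G. finite G \<and> (\<forall>y\<in>full_shift T. (\<forall>g\<in>G. y g = x g) \<longrightarrow> y \<notin> image_shift)"
  proof (rule ccontr)
    assume "\<not> ?thesis"
    then have lim: "\<exists>y\<in>image_shift. \<forall>g\<in>G. y g = x g" if "finite G" for G using that by blast
    define A where "A G = {w \<in> U. \<exists>k\<in>support C (w 0). \<exists>p y. image_by C a b w p y \<and> (\<forall>g\<in>G. y (g + k) = x g)}" for G
    obtain w where w: "\<And>G. finite G \<Longrightarrow> w \<in> A G"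
    proof (rule compactness[of "{..<N}" A])
      show "A G \<subseteq> full_shift {..<N}" for G using U_letters by (auto simp: A_def)
      show "A G \<noteq> {}" if G: "finite G" for G
      proof -
        obtain y where y: "y \<in> image_shift" "\<And>g. g \<in> G \<Longrightarrow> y g = x g" using lim[OF G] by blast
        then obtain w p z k where w: "w \<in> U" "k \<in> support C (w 0)" "image_by C a b w p z" "y = shift k z"
          unfolding image_shift_def by blast
        have "\<forall>g\<in>G. z (g + k) = x g" using y(2) w(4) by (simp add: shift_def)
        then have "w \<in> A G" using w unfolding A_def by blast
        then show ?thesis by blast
      qed
      show "A G' \<subseteq> A G" if "G \<subseteq> G'" for G G' using that unfolding A_def by blast
      show "\<exists>F. finite F \<and> (\<forall>v\<in>full_shift {..<N}. (\<forall>g\<in>F. v g = w g) \<longrightarrow> v \<notin> A G)"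
        if "finite G" "w \<notin> A G" for G w
      proof (cases "w \<in> U")
        case False
        then obtain F where "finite F" "\<And>v. \<forall>g\<in>F. v g = w g \<Longrightarrow> v \<notin> U" using U_local by metis
        moreover have "v \<in> U" if "v \<in> A G" for v using that by (simp add: A_def)
        ultimately show ?thesis by meson
      next
        case True
        obtain p y where I: "image_by C a b w p y" by (rule embeds_image[OF emb True])
        \<comment> \<open>All cells that can be read when the window \<open>G\<close> is placed with
          any of the finitely many possible offsets.\<close>
        define F where "F = (\<lambda>(g, k). g + k) ` (G \<times> support C (w 0))"
        have "finite F" using that(1) by (simp add: F_def support_def)
        from image_locally_determined[OF I this]
        obtain G' where G': "finite G'"
          and det: "\<forall>w' p' y'. image_by C a b w' p' y' \<longrightarrow> (\<forall>g\<in>G'. w' g = w g) \<longrightarrow> (\<forall>z\<in>F. y' z = y z)"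
          by (elim exE conjE)
        \<comment> \<open>Including 0 gives \<open>v\<close> the same patch at the origin, hence the
          same candidate offsets.\<close>
        have "v \<notin> A G" if v: "\<forall>g\<in>insert 0 G'. v g = w g" for v
        proof
          assume "v \<in> A G"
          then obtain k p' y' where k: "k \<in> support C (w 0)" "image_by C a b v p' y'" "\<forall>g\<in>G. y' (g + k) = x g"
            unfolding A_def using v by auto
          have "y (g + k) = x g" if "g \<in> G" for g
          proof -
            have "g + k \<in> F" using that k(1) by (force simp: F_def)
            moreover have "\<forall>z\<in>F. y' z = y z"
              using det[THEN spec, THEN spec, THEN spec, THEN mp, THEN mp, OF k(2)] v by simp
            ultimately show ?thesis using k(3) that by metis
          qed
          then have "w \<in> A G" unfolding A_def using True k(1) I by blast
          then show False using \<open>w \<notin> A G\<close> by blast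
        qed
        then show ?thesis using G' by (intro exI[of _ "insert 0 G'"]) blast
      qed
    qed auto
    have "w \<in> U" using w[of "{}"] by (simp add: A_def)
    obtain p y where I: "image_by C a b w p y" by (rule embeds_image[OF emb \<open>w \<in> U\<close>])
    \<comment> \<open>If every offset \<open>k\<close> failed at some cell \<open>f k\<close>, the
      finite window of these cells would refute all offsets at once.\<close>
    have "\<exists>k\<in>support C (w 0). \<forall>g. y (g + k) = x g"
    proof (rule ccontr)
      assume "\<not> ?thesis"
      then obtain f where f: "\<And>k. k \<in> support C (w 0) \<Longrightarrow> y (f k + k) \<noteq> x (f k)" by metis
      have "finite (f ` support C (w 0))" by (simp add: support_def)
      from w[OF this] obtain k p' y' where "k \<in> support C (w 0)" "image_by C a b w p' y'"
        "\<forall>g\<in>f ` support C (w 0). y' (g + k) = x g" unfolding A_def by blast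
      then show False using f image_by_unique[OF I] by blast
    qed
    then obtain k where k: "k \<in> support C (w 0)" "\<forall>g. y (g + k) = x g" by blast
    have "x = shift k y" by (rule ext) (simp add: shift_def k(2))
    then have "x \<in> image_shift" unfolding image_shift_def using \<open>w \<in> U\<close> I k(1) by blast
    then show False using \<open>x \<notin> image_shift\<close> by blast
  qed
qed

lemma subshift_image_shift: "subshift T image_shift"
  unfolding subshift_def
proof (intro conjI allI closedin_image_shift)
  fix n
  show "shift n ` image_shift = image_shift"
  proof
    show "shift n ` image_shift \<subseteq> image_shift" using image_shift_shift by blast
    show "image_shift \<subseteq> shift n ` image_shift"
    proof
      fix x assume "x \<in> image_shift"
      then have "shift (- n) x \<in> image_shift" by (rule image_shift_shift)
      moreover have "x = shift n (shift (- n) x)" by (simp add: shift_shift)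
      ultimately show "x \<in> shift n ` image_shift" by blast
    qed
  qed
qed

text \<open>Let \<open>x\<close> come from \<open>w\<close>, and a point of \<open>Y\<close> from
  \<open>v\<close>. The finitely many letters of \<open>w\<close> that determine \<open>x\<close> on
  a window recur in \<open>v\<close>, so translates of the point of \<open>Y\<close> approximate
  \<open>x\<close>, and \<open>Y\<close> is closed.\<close>

lemma minimal_image_shift: "minimal_subshift T image_shift"
  unfolding minimal_subshift_def
proof (intro conjI subshift_image_shift notI)
  assume "\<exists>Y. Y \<noteq> {} \<and> Y \<subset> image_shift \<and> subshift T Y"
  then obtain Y y where Y: "y \<in> Y" "Y \<subset> image_shift" "subshift T Y" by blast
  have "image_shift \<subseteq> Y"
  proof
    fix x assume x: "x \<in> image_shift"
    then obtain w p x' k where w: "w \<in> U" "image_by C a b w p x'" "x = shift k x'"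
      unfolding image_shift_def by blast
    obtain v r z l where v: "v \<in> U" "image_by C a b v r z" "y = shift l z"
      using Y unfolding image_shift_def by blast
    show "x \<in> Y"
    proof (rule closedin_fullD)
      show "closedin (full_topology T) Y" using Y(3) by (simp add: subshift_def)
      show "x \<in> full_shift T" using x image_shift_subset X_full by blast
      fix G :: "point set" assume "finite G"
      then have fin: "finite ((\<lambda>g. g + k) ` G)" by simp
      from image_locally_determined[OF w(2) fin]
      obtain G' where G': "finite G'"
        and det: "\<forall>w' p' y'. image_by C a b w' p' y' \<longrightarrow> (\<forall>g\<in>G'. w' g = w g) \<longrightarrow> (\<forall>z\<in>(\<lambda>g. g + k) ` G. y' z = x' z)"
        by (elim exE conjE)
      obtain m where m: "\<forall>z\<in>G'. v (z + m) = w z" using U_recurrent[OF w(1) v(1) G'] by blast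
      have "\<forall>u\<in>(\<lambda>g. g + k) ` G. shift (r m) z u = x' u"
        by (rule det[THEN spec, THEN spec, THEN spec, THEN mp, THEN mp, OF image_by_shift[OF v(2), of m]])
          (use m in \<open>simp add: shift_def\<close>)
      \<comment> \<open>\<open>- l\<close> undoes the translation in \<open>y\<close>,
        \<open>r m\<close> leads to the recurrence and \<open>k\<close> to the cell corresponding to
        the origin of \<open>x\<close>.\<close>
      then have "\<forall>g\<in>G. shift (k + r m - l) y g = x g"
        unfolding v(3) w(3) shift_shift by (simp add: shift_def add.assoc)
      moreover have "shift (k + r m - l) y \<in> Y" using Y(1,3) unfolding subshift_def by blast
      ultimately show "\<exists>y\<in>Y. \<forall>g\<in>G. y g = x g" by blast
    qed
  qed
  then show False using Y(2) by blast
qed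

lemma aperiodic_image_shift: "aperiodic image_shift"
  unfolding aperiodic_def
proof
  obtain w where w: "w \<in> U" using U_nonempty by blast
  obtain p y where "image_by C a b w p y" by (rule embeds_image[OF emb w])
  then show "image_shift \<noteq> {}" using image_shiftI[OF w] by blast
  show "\<not> (\<exists>x\<in>image_shift. \<exists>n. n \<noteq> 0 \<and> shift n x = x)"
  proof
  assume "\<exists>x\<in>image_shift. \<exists>n. n \<noteq> 0 \<and> shift n x = x"
  then obtain w p y k n where w: "w \<in> U" "image_by C a b w p y" "k \<in> support C (w 0)"
    "n \<noteq> 0" "shift n (shift k y) = shift k y"
    unfolding image_shift_def by blast
  obtain m where m: "shift m w = w" "n = p m" using period_lifts[OF emb U_shift w(1-3,5)] by blast
  show False using U_aperiodic[OF w(1) m(1)] image_by_position(1)[OF w(2)] w(4) m(2) by simp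
  qed
qed

end

section \<open>Existence of tilings by U\<close>

definition cell_in :: "(point \<times> nat) list \<Rightarrow> int \<Rightarrow> int \<Rightarrow> nat" where
  "cell_in L i j = (case map_of L (i, j) of Some c \<Rightarrow> c | None \<Rightarrow> 0)"

definition cell :: "nat \<Rightarrow> int \<Rightarrow> int \<Rightarrow> nat" where
  "cell u = cell_in (sub2_cells u)"

definition cell_ok :: "nat \<Rightarrow> nat option \<Rightarrow> nat option \<Rightarrow> bool" where
  "cell_ok c r t \<longleftrightarrow> c < 19 \<and>
     (case r of None \<Rightarrow> True | Some d \<Rightarrow> (c, d) \<in> set H_U) \<and>
     (case t of None \<Rightarrow> True | Some d \<Rightarrow> (c, d) \<in> set V_U)"

definition inside_ok :: "(point \<times> nat) list \<Rightarrow> int \<Rightarrow> int \<Rightarrow> bool" where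
  "inside_ok L m n \<longleftrightarrow> list_all (\<lambda>i. list_all (\<lambda>j. cell_ok (cell_in L i j)
     (if i + 1 < m then Some (cell_in L (i + 1) j) else None)
     (if j + 1 < n then Some (cell_in L i (j + 1)) else None)) [0..n - 1]) [0..m - 1]"

definition beside_ok :: "(point \<times> nat) list \<Rightarrow> (point \<times> nat) list \<Rightarrow> int \<Rightarrow> int \<Rightarrow> bool" where
  "beside_ok L M m n \<longleftrightarrow> list_all (\<lambda>j. (cell_in L (m - 1) j, cell_in M 0 j) \<in> set H_U) [0..n - 1]"

definition above_ok :: "(point \<times> nat) list \<Rightarrow> (point \<times> nat) list \<Rightarrow> int \<Rightarrow> int \<Rightarrow> bool" where
  "above_ok L M m n \<longleftrightarrow> list_all (\<lambda>i. (cell_in L i (n - 1), cell_in M i 0) \<in> set V_U) [0..m - 1]"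

lemma sub2_inside:
  "list_all (\<lambda>u. inside_ok (sub2_cells u) (fst (sub2_a u)) (snd (sub2_b u))) [0..<19]"
  by code_simp

lemma sub2_beside:
  "list_all (\<lambda>(u, v). sub2_b u = sub2_b v \<and>
     beside_ok (sub2_cells u) (sub2_cells v) (fst (sub2_a u)) (snd (sub2_b u))) H_U"
  by code_simp

lemma sub2_above:
  "list_all (\<lambda>(u, v). sub2_a u = sub2_a v \<and>
     above_ok (sub2_cells u) (sub2_cells v) (fst (sub2_a u)) (snd (sub2_b u))) V_U"
  by code_simp

definition valid_box :: "int \<Rightarrow> (point \<Rightarrow> nat) \<Rightarrow> bool" where
  "valid_box L w \<longleftrightarrow> (\<forall>i j. 0 \<le> i \<and> i < L \<and> 0 \<le> j \<and> j < L \<longrightarrow> w (i, j) < 19 \<and>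
     (i + 1 < L \<longrightarrow> (w (i, j), w (i + 1, j)) \<in> set H_U) \<and>
     (j + 1 < L \<longrightarrow> (w (i, j), w (i, j + 1)) \<in> set V_U))"

text \<open>The substitution is applied to a finite box, as no tiling of the plane is available yet.
  Images have sides at least 2, so the result covers a square of side \<open>2 * L\<close>; dominoes
  inside patches and over both kinds of seams were checked in the tables.\<close>

lemma valid_box_double:
  assumes w: "valid_box L w" and "0 < L"
  shows "\<exists>v. valid_box (2 * L) v"
proof -
  have W: "w (i, j) < 19" if "0 \<le> i" "i < L" "0 \<le> j" "j < L" for i j
    using w that by (simp add: valid_box_def)
  have WH: "(w (i, j), w (i + 1, j)) \<in> set H_U" if "0 \<le> i" "i + 1 < L" "0 \<le> j" "j < L" for i j
    using w that by (simp add: valid_box_def)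
  have WV: "(w (i, j), w (i, j + 1)) \<in> set V_U" if "0 \<le> i" "i < L" "0 \<le> j" "j + 1 < L" for i j
    using w that by (simp add: valid_box_def)
  have bH: "sub2_b u = sub2_b v" if "(u, v) \<in> set H_U" for u v
    using sub2_beside that unfolding list_all_iff by blast
  have aV: "sub2_a u = sub2_a v" if "(u, v) \<in> set V_U" for u v
    using sub2_above that unfolding list_all_iff by blast
  have big: "2 \<le> fst (sub2_a u)" "2 \<le> snd (sub2_b u)" if "u < 19" for u
    using sub2_boxes that by (auto simp: list_all_iff box_ok_def)
  \<comment> \<open>Column widths of the image. The value 2 outside the box makes the sequence of
    cuts increasing on all integers, as \<open>increasing_partition\<close> requires.\<close>
  define c where "c i = (if 0 \<le> i \<and> i < L then fst (sub2_a (w (i, 0))) else 2)" for i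
  define d where "d j = (if 0 \<le> j \<and> j < L then snd (sub2_b (w (0, j))) else 2)" for j
  have c: "fst (sub2_a (w (i, j))) = c i" if i: "0 \<le> i" "i < L" and "0 \<le> j" "j < L" for i j
    using that(3,4)
  proof (induction j rule: int_ge_induct)
    case base then show ?case using i by (simp add: c_def)
  next
    case (step j) then show ?case using aV[OF WV[of i j]] i by simp
  qed
  have d: "snd (sub2_b (w (i, j))) = d j" if j: "0 \<le> j" "j < L" and "0 \<le> i" "i < L" for i j
    using that(3,4)
  proof (induction i rule: int_ge_induct)
    case base then show ?case using j by (simp add: d_def)
  next
    case (step i) then show ?case using bH[OF WH[of i j]] j by simp
  qed
  have c2: "2 \<le> c i" for i using big(1)[OF W[of i 0]] \<open>0 < L\<close> by (simp add: c_def)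
  have d2: "2 \<le> d j" for j using big(2)[OF W[of 0 j]] \<open>0 < L\<close> by (simp add: d_def)
  obtain P where P: "P 0 = 0" "\<And>i. P (i + 1) = P i + c i" using int_partial_sums[of c] by metis
  obtain Q where Q: "Q 0 = 0" "\<And>i. Q (i + 1) = Q i + d i" using int_partial_sums[of d] by metis
  have incP: "P i < P (i + 1)" for i using P(2)[of i] c2[of i] by simp
  have incQ: "Q i < Q (i + 1)" for i using Q(2)[of i] d2[of i] by simp
  have grow: "2 * i \<le> R i" if "0 \<le> i" "R 0 = 0" "\<And>i. R i + 2 \<le> R (i + 1)" for R :: "int \<Rightarrow> int" and i
    using sub2.gap_growth[of R 0 i] that by simp
  have PL: "2 * L \<le> P L" and QL: "2 * L \<le> Q L"
    using grow[of L P] grow[of L Q] P Q c2 d2 \<open>0 < L\<close> by simp_all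
  define I where "I x = (THE i. P i \<le> x \<and> x < P (i + 1))" for x
  define J where "J y = (THE j. Q j \<le> y \<and> y < Q (j + 1))" for y
  have I: "P (I x) \<le> x \<and> x < P (I x + 1)" for x
    unfolding I_def by (rule theI'[OF increasing_partition[of P, OF incP P(1)]])
  have J: "Q (J y) \<le> y \<and> y < Q (J y + 1)" for y
    unfolding J_def by (rule theI'[OF increasing_partition[of Q, OF incQ Q(1)]])
  have Iu: "I x = i" if "P i \<le> x" "x < P (i + 1)" for x i
    unfolding I_def by (rule the1_equality[OF increasing_partition[of P, OF incP P(1)]]) (use that in simp)
  have Ju: "J y = j" if "Q j \<le> y" "y < Q (j + 1)" for y j
    unfolding J_def by (rule the1_equality[OF increasing_partition[of Q, OF incQ Q(1)]]) (use that in simp)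
  have inL: "0 \<le> i \<and> i < L"
    if "\<And>i. R i < R (i + 1)" "R 0 = 0" "2 * L \<le> R L" "R i \<le> x" "x < R (i + 1)" "0 \<le> x" "x < 2 * L"
    for R :: "int \<Rightarrow> int" and i x
  proof -
    have "R 0 < R (i + 1)" "R i < R L" using that by auto
    then show ?thesis using increasing_mono(2)[of R, OF that(1)] by fastforce
  qed
  define v where "v z = (case z of (x, y) \<Rightarrow> cell (w (I x, J y)) (x - P (I x)) (y - Q (J y)))" for z
  have inside: "cell u i j < 19"
      "i + 1 < fst (sub2_a u) \<Longrightarrow> (cell u i j, cell u (i + 1) j) \<in> set H_U"
      "j + 1 < snd (sub2_b u) \<Longrightarrow> (cell u i j, cell u i (j + 1)) \<in> set V_U"
    if "u < 19" "0 \<le> i" "i < fst (sub2_a u)" "0 \<le> j" "j < snd (sub2_b u)" for u i j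
  proof -
    have "u \<in> set [0..<19]" "i \<in> set [0..fst (sub2_a u) - 1]" "j \<in> set [0..snd (sub2_b u) - 1]"
      using that by auto
    then have "cell_ok (cell u i j) (if i + 1 < fst (sub2_a u) then Some (cell u (i + 1) j) else None)
       (if j + 1 < snd (sub2_b u) then Some (cell u i (j + 1)) else None)"
      using sub2_inside unfolding list_all_iff inside_ok_def cell_def by blast
    then show "cell u i j < 19"
      "i + 1 < fst (sub2_a u) \<Longrightarrow> (cell u i j, cell u (i + 1) j) \<in> set H_U"
      "j + 1 < snd (sub2_b u) \<Longrightarrow> (cell u i j, cell u i (j + 1)) \<in> set V_U" by (simp_all add: cell_ok_def)
  qed
  have beside: "(cell u (fst (sub2_a u) - 1) j, cell u' 0 j) \<in> set H_U"
    if "(u, u') \<in> set H_U" "0 \<le> j" "j < snd (sub2_b u)" for u u' j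
  proof -
    have "j \<in> set [0..snd (sub2_b u) - 1]" using that by simp
    then show ?thesis using sub2_beside that(1) unfolding list_all_iff beside_ok_def cell_def by blast
  qed
  have above: "(cell u i (snd (sub2_b u) - 1), cell u' i 0) \<in> set V_U"
    if "(u, u') \<in> set V_U" "0 \<le> i" "i < fst (sub2_a u)" for u u' i
  proof -
    have "i \<in> set [0..fst (sub2_a u) - 1]" using that by simp
    then show ?thesis using sub2_above that(1) unfolding list_all_iff above_ok_def cell_def by blast
  qed
  have "valid_box (2 * L) v"
    unfolding valid_box_def
  proof (intro allI impI)
    fix x y assume xy: "0 \<le> x \<and> x < 2 * L \<and> 0 \<le> y \<and> y < 2 * L"
    let ?i = "I x" and ?j = "J y"
    have i: "0 \<le> ?i" "?i < L" and j: "0 \<le> ?j" "?j < L"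
      using inL[of P ?i x] inL[of Q ?j y] incP incQ P(1) Q(1) PL QL I[of x] J[of y] xy by blast+
    let ?u = "w (?i, ?j)"
    have u: "?u < 19" by (rule W[OF i j])
    have ca: "fst (sub2_a ?u) = c ?i" and db: "snd (sub2_b ?u) = d ?j" using c[OF i j] d[OF j i] by simp_all
    have r: "0 \<le> x - P ?i" "x - P ?i < fst (sub2_a ?u)" and s: "0 \<le> y - Q ?j" "y - Q ?j < snd (sub2_b ?u)"
      using I[of x] J[of y] P(2)[of ?i] Q(2)[of ?j] ca db by simp_all
    note ins = inside[OF u r s]
    have "(v (x, y), v (x + 1, y)) \<in> set H_U" if "x + 1 < 2 * L"
    proof (cases "x + 1 < P (?i + 1)")
      case True
      then have "I (x + 1) = ?i" using I[of x] by (intro Iu) auto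
      then show ?thesis using ins(2) True P(2)[of ?i] ca by (simp add: v_def algebra_simps)
    next
      case False
      then have e: "x + 1 = P (?i + 1)" using I[of x] by simp
      then have I1: "I (x + 1) = ?i + 1" using incP[of "?i + 1"] by (intro Iu) auto
      have "?i + 1 < L" using inL[of P "?i + 1" "x + 1"] incP P(1) PL I[of "x + 1"] I1 that xy by simp
      then have "(w (?i, ?j), w (?i + 1, ?j)) \<in> set H_U" using WH i(1) j by blast
      then have "(cell ?u (fst (sub2_a ?u) - 1) (y - Q ?j), cell (w (?i + 1, ?j)) 0 (y - Q ?j)) \<in> set H_U"
        by (rule beside[OF _ s])
      moreover have "x - P ?i = fst (sub2_a ?u) - 1" "x + 1 - P (?i + 1) = 0" using e P(2)[of ?i] ca by simp_all
      ultimately show ?thesis by (simp only: v_def prod.case I1)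
    qed
    moreover have "(v (x, y), v (x, y + 1)) \<in> set V_U" if "y + 1 < 2 * L"
    proof (cases "y + 1 < Q (?j + 1)")
      case True
      then have "J (y + 1) = ?j" using J[of y] by (intro Ju) auto
      then show ?thesis using ins(3) True Q(2)[of ?j] db by (simp add: v_def algebra_simps)
    next
      case False
      then have e: "y + 1 = Q (?j + 1)" using J[of y] by simp
      then have J1: "J (y + 1) = ?j + 1" using incQ[of "?j + 1"] by (intro Ju) auto
      have "?j + 1 < L" using inL[of Q "?j + 1" "y + 1"] incQ Q(1) QL J[of "y + 1"] J1 that xy by simp
      then have "(w (?i, ?j), w (?i, ?j + 1)) \<in> set V_U" using WV i j(1) by blast
      then have "(cell ?u (x - P ?i) (snd (sub2_b ?u) - 1), cell (w (?i, ?j + 1)) (x - P ?i) 0) \<in> set V_U"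
        by (rule above[OF _ r])
      moreover have "y - Q ?j = snd (sub2_b ?u) - 1" "y + 1 - Q (?j + 1) = 0" using e Q(2)[of ?j] db by simp_all
      ultimately show ?thesis by (simp only: v_def prod.case J1)
    qed
    ultimately show "v (x, y) < 19 \<and> (x + 1 < 2 * L \<longrightarrow> (v (x, y), v (x + 1, y)) \<in> set H_U) \<and>
        (y + 1 < 2 * L \<longrightarrow> (v (x, y), v (x, y + 1)) \<in> set V_U)"
      using ins(1) by (simp add: v_def)
  qed
  then show ?thesis by blast
qed

text \<open>Repeated doubling of a single cell yields squares that satisfy the domino conditions on
  any finite window; compactness joins the windows.\<close>

lemma shift_U_nonempty: "shift_U \<noteq> {}"
proof -
  have big: "\<exists>w. valid_box (2 ^ k) w" for k
  proof (induction k)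
    case 0
    have "valid_box 1 (\<lambda>_. 0)" by (simp add: valid_box_def)
    then show ?case by auto
  next
    case (Suc k) then show ?case using valid_box_double[of "2 ^ k"] by auto
  qed
  define A where "A G = {w \<in> full_shift {..<19}. \<forall>n\<in>G. (w n, w (n + e1)) \<in> set H_U \<and> (w n, w (n + e2)) \<in> set V_U}"
    for G :: "point set"
  obtain w where w: "\<And>G. finite G \<Longrightarrow> w \<in> A G"
  proof (rule compactness[of "{..<19}" A])
    show "A G \<noteq> {}" if "finite G" for G
    proof -
      define K where "K = Max (insert 0 ((\<lambda>z. \<bar>fst z\<bar> + \<bar>snd z\<bar>) ` G)) + 1"
      have K: "\<bar>fst z\<bar> + \<bar>snd z\<bar> < K" if "z \<in> G" for z
        using Max_ge[of "insert 0 ((\<lambda>z. \<bar>fst z\<bar> + \<bar>snd z\<bar>) ` G)" "\<bar>fst z\<bar> + \<bar>snd z\<bar>"] that \<open>finite G\<close>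
        unfolding K_def by auto
      have "2 * K + 1 < 2 ^ nat (2 * K + 1)"
        using of_nat_less_two_power[of "nat (2 * K + 1)", where 'a = int] by linarith
      then obtain L u where L: "2 * K + 1 < L" "valid_box L u" using big by blast
      \<comment> \<open>The square is centred by the translation; letters that are out of range
        beyond it are replaced by 0 to stay in the alphabet.\<close>
      define w where "w z = (if u (z + (K, K)) < 19 then u (z + (K, K)) else 0)" for z
      have "w \<in> full_shift {..<19}" by (simp add: full_shift_def w_def)
      moreover have "(w n, w (n + e1)) \<in> set H_U \<and> (w n, w (n + e2)) \<in> set V_U" if "n \<in> G" for n
      proof -
        obtain i j where n: "n = (i, j)" by (cases n)
        have ij: "\<bar>i\<bar> + \<bar>j\<bar> < K" using K[OF that] n by simp
        have val: "w (i', j') = u (i' + K, j' + K)" if "0 \<le> i' + K" "i' + K < L" "0 \<le> j' + K" "j' + K < L" for i' j'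
          using L(2) that unfolding valid_box_def w_def by simp
        have "0 \<le> i + K" "i + K + 1 < L" "0 \<le> j + K" "j + K + 1 < L" using ij L(1) by linarith+
        then have u: "(u (i + K, j + K), u (i + K + 1, j + K)) \<in> set H_U"
            "(u (i + K, j + K), u (i + K, j + K + 1)) \<in> set V_U"
          and v: "w (i, j) = u (i + K, j + K)" "w (i + 1, j) = u (i + 1 + K, j + K)"
            "w (i, j + 1) = u (i + K, j + 1 + K)"
          using L(2) val[of i j] val[of "i + 1" j] val[of i "j + 1"] unfolding valid_box_def by simp_all
        have "i + 1 + K = i + K + 1" "j + 1 + K = j + K + 1" by simp_all
        then show ?thesis using u unfolding n e1_def e2_def add_Pair add_0_right v by (simp only: simp_thms)
      qed
      ultimately show ?thesis unfolding A_def by blast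
    qed
    show "\<exists>F. finite F \<and> (\<forall>y\<in>full_shift {..<19}. (\<forall>g\<in>F. y g = x g) \<longrightarrow> y \<notin> A G)"
      if x: "x \<in> full_shift {..<19}" "x \<notin> A G" for G x
    proof -
      obtain n where n: "n \<in> G" "\<not> ((x n, x (n + e1)) \<in> set H_U \<and> (x n, x (n + e2)) \<in> set V_U)"
        using x unfolding A_def by blast
      have "y \<notin> A G" if "\<forall>g\<in>{n, n + e1, n + e2}. y g = x g" for y
      proof
        assume "y \<in> A G"
        then have "(y n, y (n + e1)) \<in> set H_U \<and> (y n, y (n + e2)) \<in> set V_U" using n(1) unfolding A_def by blast
        then show False using n(2) that by simp
      qed
      then show ?thesis by (intro exI[of _ "{n, n + e1, n + e2}"]) simp
    qed
  qed (auto simp: A_def)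
  have "w \<in> shift_U" unfolding shift_U_def nn_shift_def using w[of "{_}"] by (simp add: A_def)
  then show ?thesis by blast
qed

text \<open>\<open>embeds\<close> speaks only about letters of actual configurations. This transfers
  its conclusions to each of the 19 patches.\<close>

lemma letter_occurs:
  assumes "u < 19"
  obtains w n where "w \<in> shift_U" "w n = u"
proof -
  obtain w where w: "w \<in> shift_U" using shift_U_nonempty by blast
  have "list_all (\<lambda>u. list_ex (\<lambda>q. fst q = u) quad_list) [0..<19]" by code_simp
  then have "\<exists>q\<in>set quad_list. fst q = u" using assms unfolding list_all_iff list_ex_iff by simp
  then obtain q where "q \<in> set quad_list" "fst q = u" by blast
  then have "sub.universal q" using listed_universal by (metis in_set_conv_nth)
  then obtain n where "quad w n = q" using w unfolding sub.universal_def by blast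
  then have "w n = u" using \<open>fst q = u\<close> by (auto simp: quad_def)
  then show ?thesis using that w by blast
qed

section \<open>From tilings by U to Jeandel--Rao tilings\<close>

text \<open>Letters with the same image under \<open>r\<close> must be separated by the images of their right neighbours or of their
  left neighbours.\<close>

definition shear_ok :: "nat list \<Rightarrow> dominoes \<Rightarrow> dominoes \<Rightarrow> dominoes \<Rightarrow> dominoes \<Rightarrow> bool" where
  "shear_ok r H V H' V' \<longleftrightarrow>
     list_all (\<lambda>(u, v). u < length r \<and> (r ! u, r ! v) \<in> set H') H \<and>
     list_all (\<lambda>(s, u). list_all (\<lambda>(x, v). if x = s then (r ! u, r ! v) \<in> set V' else True) V) H \<and>
     list_all (\<lambda>u. list_all (\<lambda>v. if r ! u = r ! v then (if u = v then True else
       if list_all (\<lambda>(x, s). if x = u then list_all (\<lambda>(y, t). if y = v then r ! s \<noteq> r ! t else True) H else True) H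
       then True else
       list_all (\<lambda>(s, x). if x = u then list_all (\<lambda>(t, y). if y = v then r ! s \<noteq> r ! t else True) H else True) H)
       else True) [0..<length r]) [0..<length r]"

text \<open>Columns are mapped to diagonals by \<open>q\<close>. A step up in the sheared array from
  \<open>s\<close> to \<open>v\<close> corresponds to a step right, to the neighbour
  \<open>u\<close> of \<open>s\<close>, followed by a step up; so \<open>r ! u\<close> and
  \<open>r ! v\<close> must match vertically.\<close>

lemma embeds_shear:
  assumes ok: "shear_ok r H V H' V'"
  shows "embeds (nn_shift H V) (nn_shift H' V') (\<lambda>u. [(0, r ! u)]) (\<lambda>_. (1, 0)) (\<lambda>_. (1, 1))"
proof -
  let ?I = "image_by (\<lambda>u. [(0, r ! u)]) (\<lambda>_. (1, 0)) (\<lambda>_. (1, 1))"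
  define q :: "point \<Rightarrow> point" where "q n = (fst n + snd n, snd n)" for n
  define y where "y w z = r ! w (fst z - snd z, snd z)" for w :: "point \<Rightarrow> nat" and z :: "point"
  have hor: "u < length r" "(r ! u, r ! v) \<in> set H'" if "(u, v) \<in> set H" for u v
    using ok that unfolding shear_ok_def list_all_iff by blast+
  have ver: "(r ! u, r ! v) \<in> set V'" if "(s, u) \<in> set H" "(s, v) \<in> set V" for s u v
    using ok that unfolding shear_ok_def list_all_iff by fastforce
  have sep: "(\<forall>s t. (u, s) \<in> set H \<longrightarrow> (v, t) \<in> set H \<longrightarrow> r ! s \<noteq> r ! t) \<or>
      (\<forall>s t. (s, u) \<in> set H \<longrightarrow> (t, v) \<in> set H \<longrightarrow> r ! s \<noteq> r ! t)"
    if "u < length r" "v < length r" "r ! u = r ! v" "u \<noteq> v" for u v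
  proof -
    have "u \<in> set [0..<length r]" "v \<in> set [0..<length r]" using that by auto
    then have "if list_all (\<lambda>(x, s). if x = u then list_all (\<lambda>(y, t). if y = v then r ! s \<noteq> r ! t else True) H else True) H
       then True else
       list_all (\<lambda>(s, x). if x = u then list_all (\<lambda>(t, y). if y = v then r ! s \<noteq> r ! t else True) H else True) H"
      using ok that(3,4) unfolding shear_ok_def list_all_iff[of _ "[0..<length r]"] by presburger
    then show ?thesis unfolding list_all_iff by (auto split: if_splits)
  qed
  have I: "?I w q (y w)" for w
  proof -
    have "\<exists>!n. z - q n = 0" for z
      by (rule ex1I[of _ "(fst z - snd z, snd z)"]) (auto simp: q_def prod_eq_iff)
    then have "placed_supports_partition (support (\<lambda>u. [(0, r ! u)])) w q"
      by (simp add: partition_iff support_def)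
    moreover have "position_map (\<lambda>_. (1, 0)) (\<lambda>_. (1, 1)) w q"
      by (simp add: position_map_def q_def e1_def e2_def zero_prod_def)
    moreover have "y w (q n) = r ! w n" for n by (simp add: y_def q_def)
    ultimately show ?thesis by (simp add: image_by_def)
  qed
  have Y: "y w \<in> nn_shift H' V'" if w: "w \<in> nn_shift H V" for w
    unfolding nn_shift_def
  proof (intro CollectI allI conjI)
    fix n :: "point"
    obtain i j where n: "n = (i, j)" by (cases n)
    have h: "(w (k, j), w (k + 1, j)) \<in> set H" and v: "(w (k, j), w (k, j + 1)) \<in> set V" for k j
      using nn_shiftD[OF w, of "(k, j)"] by (simp_all add: e1_def e2_def)
    have yv: "y w (i, j) = r ! w (i - j, j)" "y w (i + 1, j) = r ! w (i - j + 1, j)"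
      "y w (i, j + 1) = r ! w (i - j - 1, j + 1)" by (simp_all add: y_def algebra_simps)
    show "(y w n, y w (n + e1)) \<in> set H'" using hor(2)[OF h] yv by (simp add: n e1_def)
    show "(y w n, y w (n + e2)) \<in> set V'"
      using ver[OF _ v[of "i - j - 1" j], of "w (i - j, j)"] h[of "i - j - 1" j] yv by (simp add: n e2_def)
  qed
  have "w = w'" if w: "w \<in> nn_shift H V" "w' \<in> nn_shift H V" and eq: "y w = y w'" for w w'
  proof (rule ext, rule ccontr)
    fix n assume ne: "w n \<noteq> w' n"
    have req: "r ! w m = r ! w' m" for m
      using fun_cong[OF eq, of "q m"] by (simp add: y_def q_def)
    have lt: "w n < length r" "w' n < length r" using hor(1) nn_shiftD(1) w by blast+
    have "(w n, w (n + e1)) \<in> set H" "(w' n, w' (n + e1)) \<in> set H"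
      "(w (n - e1), w n) \<in> set H" "(w' (n - e1), w' n) \<in> set H"
      using nn_shiftD(1)[OF w(1), of n] nn_shiftD(1)[OF w(2), of n]
        nn_shiftD(1)[OF w(1), of "n - e1"] nn_shiftD(1)[OF w(2), of "n - e1"] by simp_all
    then show False using sep[OF lt req ne] req by blast
  qed
  then have "w = w' \<and> k = k'"
    if "w \<in> nn_shift H V" "w' \<in> nn_shift H V" "?I w p x" "?I w' p' x'"
      "k \<in> support (\<lambda>u. [(0, r ! u)]) (w 0)" "k' \<in> support (\<lambda>u. [(0, r ! u)]) (w' 0)"
      "shift k x = shift k' x'" for w w' p p' x x' k k'
    using that image_by_unique[OF I] by (auto simp: support_def)
  moreover have "\<exists>p x. ?I w p x \<and> x \<in> nn_shift H' V'" if "w \<in> nn_shift H V" for w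
    using I Y[OF that] by blast
  ultimately show ?thesis unfolding embeds_def by (simp only: list.map distinct_singleton) blast
qed

text \<open>The step \<open>(1, 1)\<close> is taken as up and then right: \<open>b\<close> of the
  letter, plus the horizontal advance, which is \<open>(1, 0)\<close> everywhere.\<close>

lemma embeds_shear_cells:
  assumes ok: "shear_ok r H V H' V'" and emb: "embeds (nn_shift H' V') (X :: (point \<Rightarrow> 'a) set) C (\<lambda>_. (1, 0)) b"
  shows "embeds (nn_shift H V) X (\<lambda>u. C (r ! u)) (\<lambda>_. (1, 0)) (\<lambda>u. b (r ! u) + (1, 0))"
proof -
  have "compose_patches (\<lambda>u. [(0, r ! u)]) (\<lambda>_ _. 0) C = (\<lambda>u. C (r ! u))"
  proof
    have "map (\<lambda>(s, c). (0 + s, c)) xs = xs" for xs :: "(point \<times> 'a) list"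
      by (rule map_idI) auto
    then show "compose_patches (\<lambda>u. [(0, r ! u)]) (\<lambda>_ _. 0) C u = C (r ! u)" for u
      by (simp add: compose_patches_def)
  qed
  moreover have "composable (nn_shift H V) (nn_shift H' V') X (\<lambda>u. [(0, r ! u)]) (\<lambda>_. (1, 0)) (\<lambda>_. (1, 1))
    C (\<lambda>_. (1, 0)) b (\<lambda>_ _. 0) (\<lambda>_. (1, 0)) (\<lambda>u. b (r ! u) + (1, 0))"
  proof
    show "embeds (nn_shift H V) (nn_shift H' V') (\<lambda>u. [(0, r ! u)]) (\<lambda>_. (1, 0)) (\<lambda>_. (1, 1))"
      by (rule embeds_shear[OF ok])
    show "embeds (nn_shift H' V') X C (\<lambda>_. (1, 0)) b" by (rule emb)
    show "shift n y \<in> nn_shift H' V'" if "y \<in> nn_shift H' V'" for n y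
      using nn_shift_closed[of y False] that by (simp add: nn_def)
  next
    fix w q y p x n
    assume q: "image_by (\<lambda>u. [(0, r ! u)]) (\<lambda>_. (1, 0)) (\<lambda>_. (1, 1)) w q y"
      and p: "image_by C (\<lambda>_. (1, 0)) b y p x"
    have v: "y (q n) = r ! w n" using image_by_value[OF q, of 0 "r ! w n" n] by simp
    show "p (q n + (1, 0)) = p (q n) + (1, 0)" using image_by_position(2)[OF p, of "q n"] by (simp add: e1_def)
    have e: "q n + (1, 1) = q n + e2 + e1" by (simp add: e1_def e2_def prod_eq_iff)
    show "p (q n + (1, 1)) = p (q n) + (b (r ! w n) + (1, 0))"
      unfolding e image_by_position(2,3)[OF p] v by (rule add.assoc)
  qed auto
  ultimately show ?thesis using composable.composed by metis
qed

text \<open>Level 1 is the sheared array of the words in \<open>tab_rows\<close>, level \<open>k + 1\<close> arises from level \<open>k\<close> by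
  the words in \<open>tab_k\<close>, and level 7 is \<open>\<U>\<close>.\<close>

definition tab_rows :: "nat list list" where
  "tab_rows =
    [[0,9,3,7], [0,9,7,5], [0,9,10,4], [1,3,3,7], [1,3,7,6], [1,3,8,7], [1,7,2,5], [1,7,5,5],
    [1,7,5,6], [1,8,7,5], [1,8,10,4], [1,10,4,5], [1,10,4,6], [0,9,3,3,7], [0,9,3,7,6],
    [0,9,3,8,7], [0,9,7,2,5], [0,9,7,2,6], [0,9,7,5,5], [0,9,7,5,6], [0,9,8,7,5], [0,9,8,10,4],
    [0,9,10,4,6], [1,3,3,7,6], [1,3,8,7,6], [1,7,2,5,6], [1,8,10,4,6], [1,10,4,5,6]]"

text \<open>Two words occur twice. The copies 19 and 20 of word 19 are told apart by their left
  neighbours, the words 20 and 24; the copies 23 and 24 of word 22 by their right neighbours, the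
  words 13 and 27.\<close>

definition row_letter :: "nat list" where
  "row_letter =
    [0,1,2,3,4,5,6,7,8,9,10,11,12,13,14,15,16,17,18,19,19,20,21,22,22,23,24,25,26,27]"

text \<open>A selection of the dominoes permitted by the colours, without (8, 6) for instance.
  Images only have to lie in the Jeandel-Rao shift, so it is enough to contain the dominoes that the
  words produce.\<close>

definition H_tiles :: "dominoes" where
  "H_tiles =
    [(0,0), (0,1), (1,0), (1,1), (2,8), (3,8), (3,9), (3,10), (4,3), (4,5), (5,6), (5,7),
    (6,6), (6,7), (7,2), (7,3), (7,4), (7,5), (8,7), (9,8), (9,9), (9,10), (10,2), (10,3),
    (10,4), (10,5)]"

definition V_tiles :: "dominoes" where
  "V_tiles =
    [(0,9), (1,3), (1,7), (1,8), (1,10), (2,5), (2,6), (3,3), (3,7), (3,8), (4,0), (4,5),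
    (4,6), (5,0), (5,5), (5,6), (6,1), (7,0), (7,2), (7,5), (7,6), (8,7), (8,10), (9,3), (9,7),
    (9,8), (9,10), (10,4)]"

definition H_rows :: "dominoes" where
  "H_rows =
    [(0,2), (0,10), (1,0), (2,11), (3,10), (4,12), (5,1), (5,9), (6,5), (7,4), (8,4), (9,8),
    (10,6), (10,7), (11,3), (12,3), (13,21), (14,22), (14,26), (15,20), (16,15), (17,15),
    (18,14), (19,14), (20,19), (21,16), (21,18), (22,13), (22,27), (23,22), (23,26), (24,17),
    (24,19), (25,24), (26,25), (27,23)]"

definition V_rows :: "dominoes" where
  "V_rows =
    [(0,22), (1,14), (2,13), (3,16), (3,17), (3,18), (3,19), (3,22), (4,25), (4,27), (5,18),
    (5,19), (6,20), (6,21), (6,22), (7,20), (7,21), (7,22), (8,26), (9,14), (10,13), (10,14),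
    (10,15), (11,21), (12,23), (12,24), (13,1), (13,17), (13,19), (13,22), (14,6), (14,11),
    (14,12), (14,25), (14,27), (15,1), (15,18), (15,19), (16,2), (16,20), (16,21), (16,22),
    (17,4), (17,5), (17,24), (18,2), (18,20), (18,21), (18,22), (19,4), (19,5), (19,10),
    (19,24), (19,26), (20,0), (20,14), (21,0), (21,13), (21,14), (21,15), (22,3), (22,5),
    (22,23), (22,24), (23,6), (23,25), (24,6), (24,7), (24,8), (24,25), (25,9), (25,10),
    (25,26), (26,3), (26,5), (26,23), (26,24), (27,10), (27,26)]"

definition H_1 :: "dominoes" where
  "H_1 =
    [(0,2), (0,10), (1,0), (2,11), (3,10), (4,12), (5,1), (5,9), (6,5), (7,4), (8,4), (9,8),
    (10,6), (10,7), (11,3), (12,3), (13,22), (14,23), (14,24), (14,28), (15,21), (16,15),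
    (17,15), (18,14), (19,14), (20,14), (21,19), (22,16), (22,18), (23,13), (24,29), (25,23),
    (25,28), (26,17), (26,20), (27,26), (28,27), (29,25)]"

definition V_1 :: "dominoes" where
  "V_1 =
    [(0,13), (1,23), (2,22), (3,13), (3,14), (3,15), (4,25), (4,26), (5,14), (6,18), (6,19),
    (7,29), (8,27), (9,28), (10,21), (10,22), (10,24), (11,16), (11,18), (12,17), (12,20),
    (12,23), (13,0), (13,13), (13,14), (13,15), (14,3), (14,5), (14,25), (14,26), (15,0),
    (15,14), (16,18), (16,19), (17,1), (17,20), (18,11), (18,29), (19,6), (19,27), (20,12),
    (21,10), (21,28), (22,2), (22,21), (22,22), (22,24), (23,1), (23,17), (23,20), (23,23),
    (24,10), (24,28), (25,5), (25,26), (26,4), (26,5), (26,26), (27,6), (27,7), (27,8),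
    (27,27), (28,9), (28,10), (28,28), (29,6), (29,27)]"

definition tab_1 :: "nat list list" where
  "tab_1 =
    [[2], [9], [10], [21], [22], [24], [28], [1,0], [6,5], [7,4], [8,4], [11,3], [12,3],
    [16,15], [17,15], [18,14], [19,14], [20,14], [23,13], [27,26], [29,25]]"

definition H_2 :: "dominoes" where
  "H_2 =
    [(0,11), (1,10), (2,8), (2,9), (3,16), (4,13), (4,15), (5,20), (6,19), (7,0), (7,2), (8,1),
    (8,7), (9,12), (10,12), (11,2), (12,2), (13,3), (14,3), (15,5), (15,6), (15,18), (16,6),
    (16,18), (17,5), (17,6), (18,4), (19,14), (19,17), (20,6), (20,18)]"

definition V_2 :: "dominoes" where
  "V_2 =
    [(0,4), (1,6), (2,3), (2,4), (2,5), (3,2), (3,6), (4,0), (4,3), (4,4), (4,5), (5,2), (5,6),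
    (6,1), (6,2), (6,6), (7,18), (8,15), (8,16), (9,20), (10,19), (11,13), (11,15), (12,14),
    (12,17), (12,18), (13,15), (13,16), (14,7), (14,17), (15,11), (15,20), (16,8), (16,19),
    (17,12), (18,7), (18,14), (18,17), (18,18), (19,8), (19,9), (19,10), (19,19), (20,8),
    (20,19)]"

definition tab_2 :: "nat list list" where
  "tab_2 =
    [[8], [9], [10], [15], [16], [19], [20], [7,0], [7,2], [8,1], [11,2], [12,2], [13,3],
    [14,3], [15,5], [15,6], [16,6], [17,5], [17,6], [18,4], [20,6]]"

definition H_3 :: "dominoes" where
  "H_3 =
    [(0,7), (0,8), (1,11), (2,11), (3,19), (4,19), (5,13), (5,17), (5,18), (6,19), (7,10),
    (8,0), (8,9), (9,2), (10,0), (10,1), (11,0), (11,1), (11,9), (12,4), (13,4), (13,16),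
    (14,6), (15,5), (16,5), (17,6), (17,20), (18,5), (19,3), (19,12), (19,14), (19,15), (20,5)]"

definition V_3 :: "dominoes" where
  "V_3 =
    [(0,3), (0,4), (1,6), (2,5), (3,6), (4,0), (4,5), (5,0), (5,1), (5,2), (5,5), (6,0), (6,5),
    (7,19), (8,19), (9,15), (9,16), (10,12), (10,14), (11,13), (11,17), (11,19), (12,15),
    (12,16), (13,8), (13,18), (14,10), (14,20), (15,10), (15,20), (16,9), (17,11), (18,11),
    (19,7), (19,13), (19,17), (19,19), (20,9)]"

definition tab_3 :: "nat list list" where
  "tab_3 =
    [[7], [8], [11], [13], [17], [19], [8,0], [9,2], [10,0], [10,1], [11,0], [11,1], [12,4],
    [13,4], [14,6], [15,5], [16,5], [17,6], [18,5], [19,3], [20,5]]"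

definition H_4 :: "dominoes" where
  "H_4 =
    [(0,8), (0,9), (1,7), (2,7), (3,16), (4,20), (5,12), (5,14), (5,15), (6,0), (7,2), (7,10),
    (7,11), (8,0), (8,1), (8,6), (9,2), (9,10), (10,0), (10,1), (11,2), (12,5), (12,19),
    (13,5), (14,5), (14,19), (15,3), (15,4), (15,13), (15,17), (16,4), (16,17), (17,5), (18,3),
    (18,4), (19,5), (20,4), (20,17), (20,18)]"

definition V_4 :: "dominoes" where
  "V_4 =
    [(0,5), (1,5), (2,3), (2,5), (3,1), (4,2), (5,0), (5,3), (5,4), (5,5), (6,19), (7,15),
    (7,16), (8,12), (9,14), (10,13), (10,19), (11,17), (12,15), (12,16), (13,6), (13,18),
    (14,8), (14,20), (15,8), (15,9), (15,20), (16,7), (17,10), (18,10), (18,11), (19,17),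
    (20,7)]"

definition tab_4 :: "nat list list" where
  "tab_4 =
    [[7], [8], [9], [12], [14], [15], [16], [20], [6,0], [7,2], [8,0], [8,1], [9,2], [10,0],
    [10,1], [11,2], [12,5], [13,5], [14,5], [15,3], [15,4], [16,4], [17,5], [18,3], [18,4],
    [19,5], [20,4]]"

definition H_5 :: "dominoes" where
  "H_5 =
    [(0,13), (0,14), (0,15), (1,8), (2,13), (3,25), (4,25), (5,17), (5,22), (6,22), (7,22),
    (7,23), (7,24), (8,1), (8,10), (8,11), (9,0), (10,1), (10,2), (11,0), (12,0), (13,1),
    (13,2), (13,11), (13,12), (14,0), (14,9), (15,0), (15,9), (16,3), (16,4), (16,5), (17,3),
    (17,4), (17,5), (17,16), (17,18), (17,19), (18,5), (19,6), (20,7), (21,7), (22,5), (22,19),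
    (22,20), (23,6), (23,21), (24,7), (24,26), (25,3), (25,16), (26,7)]"

definition V_5 :: "dominoes" where
  "V_5 =
    [(0,5), (0,6), (1,3), (2,4), (3,5), (3,6), (4,7), (5,1), (5,2), (5,7), (6,0), (7,0),
    (8,25), (9,19), (10,16), (11,16), (12,18), (13,17), (13,25), (14,17), (15,22), (16,19),
    (16,20), (16,21), (17,8), (17,23), (17,24), (18,10), (18,26), (19,11), (20,12), (21,9),
    (22,13), (23,14), (24,15), (25,22), (26,9)]"

definition tab_5 :: "nat list list" where
  "tab_5 =
    [[3], [4], [5], [16], [17], [18], [25], [5,1], [5,2], [6,0], [7,0], [17,8], [18,10],
    [19,11], [20,12], [21,9], [22,13], [23,14], [24,15], [26,9]]"

definition H_6 :: "dominoes" where
  "H_6 =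
    [(0,6), (1,6), (2,4), (3,0), (3,1), (3,2), (4,0), (4,1), (4,2), (4,3), (4,5), (5,2), (6,0),
    (6,3), (7,11), (8,16), (9,16), (10,16), (10,17), (10,18), (11,7), (11,12), (11,13), (12,7),
    (12,8), (13,9), (14,10), (15,10), (16,7), (16,8), (16,13), (16,14), (17,9), (17,15),
    (18,10), (18,19), (19,10)]"

definition V_6 :: "dominoes" where
  "V_6 =
    [(0,8), (0,9), (1,10), (2,10), (3,13), (3,14), (3,15), (4,17), (4,18), (5,19), (6,16),
    (7,0), (8,1), (9,2), (9,7), (10,2), (10,7), (10,8), (10,9), (11,6), (12,3), (13,3), (14,5),
    (14,12), (15,13), (16,4), (16,6), (16,11), (17,4), (17,11), (18,16), (19,13)]"

definition tab_6 :: "nat list list" where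
  "tab_6 =
    [[9], [10], [17], [16], [15], [19], [18], [14], [7,0], [9,2], [10,2], [8,1], [17,4],
    [13,3], [16,4], [12,3], [11,6], [16,6], [14,5]]"

definition jr_list :: "nat tile list" where
  "jr_list = [(2,4,2,1), (2,2,2,0), (1,1,3,1), (1,2,3,2), (3,1,3,3), (0,1,3,1),
     (0,0,0,1), (3,1,0,2), (0,2,1,2), (1,2,1,4), (3,3,1,2)]"

lemma set_jr_list: "set jr_list = jeandel_rao_tiles"
  by (simp add: jr_list_def jeandel_rao_tiles_def)

lemma tiles_match:
  "list_all (\<lambda>(u, v). u < 11 \<and> right_color (jr_list ! u) = left_color (jr_list ! v)) H_tiles"
  "list_all (\<lambda>(u, v). top_color (jr_list ! u) = bottom_color (jr_list ! v)) V_tiles"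
  by code_simp+

lemma embeds_tiles:
  "embeds (nn_shift H_tiles V_tiles) (wang_shift jeandel_rao_tiles) (\<lambda>u. [(0, jr_list ! u)]) (\<lambda>_. (1, 0)) (\<lambda>_. (0, 1))"
proof -
  have m: "w n < 11 \<and> right_color (jr_list ! w n) = left_color (jr_list ! w (n + e1)) \<and>
      top_color (jr_list ! w n) = bottom_color (jr_list ! w (n + e2))"
    if "w \<in> nn_shift H_tiles V_tiles" for w n
    using nn_shiftD[OF that, of n] tiles_match unfolding list_all_iff by blast
  have l: "length jr_list = 11" "distinct jr_list" by (simp_all add: jr_list_def)
  have "embeds (nn_shift H_tiles V_tiles) (wang_shift jeandel_rao_tiles) (\<lambda>u. [(0, jr_list ! u)]) (\<lambda>_. e1) (\<lambda>_. e2)"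
  proof (rule embeds_relabel)
    show "inj_on ((!) jr_list) {..<11}" using l by (simp add: inj_on_nth)
    show "w n \<in> {..<11}" if "w \<in> nn_shift H_tiles V_tiles" for w n using m[OF that] by simp
    show "(!) jr_list \<circ> w \<in> wang_shift jeandel_rao_tiles" if "w \<in> nn_shift H_tiles V_tiles" for w
      using m[OF that] nth_mem[of _ jr_list] l unfolding wang_shift_def set_jr_list by simp
  qed
  then show ?thesis by (simp add: e1_def e2_def)
qed

lemma word_ok_rows: "word_ok tab_rows V_rows H_rows V_tiles H_tiles" by code_simp
lemma shear_ok_rows: "shear_ok row_letter H_1 V_1 H_rows V_rows" by code_simp
lemma word_ok_1: "word_ok tab_1 H_2 V_2 H_1 V_1" by code_simp
lemma word_ok_2: "word_ok tab_2 H_3 V_3 H_2 V_2" by code_simp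
lemma word_ok_3: "word_ok tab_3 H_4 V_4 H_3 V_3" by code_simp
lemma word_ok_4: "word_ok tab_4 H_5 V_5 H_4 V_4" by code_simp
lemma word_ok_5: "word_ok tab_5 V_6 H_6 V_5 H_5" by code_simp
lemma word_ok_6: "word_ok tab_6 V_U H_U V_6 H_6" by code_simp

text \<open>A level is kept as a triple of patches, horizontal advances and vertical advances, so
  that steps compose as functions.\<close>

definition widen where
  "widen tab = (\<lambda>(C, a, b). (word_cells False tab C a b, adv_a False tab a, adv_b False tab b))"

definition heighten where
  "heighten tab = (\<lambda>(C, a, b). (word_cells True tab C a b, adv_a True tab a, adv_b True tab b))"

definition row_level where
  "row_level = heighten tab_rows (\<lambda>u. [(0, jr_list ! u)], \<lambda>_. (1, 0), \<lambda>_. (0, 1))"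

definition sheared_level where
  "sheared_level = (case row_level of (C, a, b) \<Rightarrow>
     (\<lambda>u. C (row_letter ! u), \<lambda>_ :: nat. (1, 0) :: point, \<lambda>u. b (row_letter ! u) + (1, 0)))"

definition jr_level where
  "jr_level = heighten tab_6 (heighten tab_5 (widen tab_4 (widen tab_3 (widen tab_2 (widen tab_1 sheared_level)))))"

definition "jr_cells = fst jr_level"
definition "jr_a = fst (snd jr_level)"
definition "jr_b = snd (snd jr_level)"

abbreviation embeds_level where
  "embeds_level Y X l \<equiv> (case l of (C, a, b) \<Rightarrow> embeds Y X C a b)"

lemma embeds_widen:
  "word_ok tab H V H' V' \<Longrightarrow> embeds_level (nn_shift H' V') X l \<Longrightarrow> embeds_level (nn_shift H V) X (widen tab l)"
  using embeds_word_cells[where d = False] by (auto simp: widen_def nn_def split: prod.splits)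

lemma embeds_heighten:
  "word_ok tab V H V' H' \<Longrightarrow> embeds_level (nn_shift H' V') X l \<Longrightarrow> embeds_level (nn_shift H V) X (heighten tab l)"
  using embeds_word_cells[where d = True] by (auto simp: heighten_def nn_def split: prod.splits)

lemma embeds_jr: "embeds shift_U (wang_shift jeandel_rao_tiles) jr_cells jr_a jr_b"
proof -
  let ?J = "wang_shift jeandel_rao_tiles"
  have 0: "embeds_level (nn_shift H_tiles V_tiles) ?J (\<lambda>u. [(0, jr_list ! u)], \<lambda>_. (1, 0), \<lambda>_. (0, 1))"
    using embeds_tiles by simp
  have 1: "embeds_level (nn_shift H_rows V_rows) ?J row_level"
    unfolding row_level_def by (rule embeds_heighten[OF word_ok_rows 0])
  obtain C a b where l: "row_level = (C, a, b)" by (cases row_level)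
  \<comment> \<open>Stacking tiles vertically leaves the horizontal advance at one column, the form
    required by the shear.\<close>
  have "a = (\<lambda>_. (1, 0))" using l by (auto simp: row_level_def heighten_def adv_a_def)
  then have "embeds_level (nn_shift H_1 V_1) ?J sheared_level"
    using embeds_shear_cells[OF shear_ok_rows] 1 by (simp add: l sheared_level_def)
  then have "embeds_level (nn_shift H_2 V_2) ?J (widen tab_1 sheared_level)" by (rule embeds_widen[OF word_ok_1])
  then have "embeds_level shift_U ?J jr_level"
    unfolding jr_level_def shift_U_def
    by (intro embeds_heighten[OF word_ok_6] embeds_heighten[OF word_ok_5] embeds_widen[OF word_ok_4]
        embeds_widen[OF word_ok_3] embeds_widen[OF word_ok_2])
  then show ?thesis by (simp add: jr_cells_def jr_a_def jr_b_def case_prod_unfold)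
qed

section \<open>The nineteen patches\<close>

text \<open>The values at the five sample positions (\<open>None\<close> outside the patch) tell all 19 patches apart.\<close>

definition signature_of :: "(point \<times> nat tile) list \<Rightarrow> nat \<times> point \<times> nat tile option list" where
  "signature_of L = (length L, fst (hd L), map (map_of L) [(5, 3), (2, 12), (0, 4), (0, 0), (1, 6)])"

definition signature :: "nat \<Rightarrow> nat \<times> point \<times> nat tile option list" where
  "signature u = signature_of (jr_cells u)"

definition signatures_ok :: "(nat \<times> point \<times> nat tile option list) list \<Rightarrow> bool" where
  "signatures_ok R \<longleftrightarrow>
     map fst R = [45, 45, 72, 72, 72, 72, 72, 72, 70, 70, 70, 70, 112, 112, 112, 112, 112, 112, 112] \<and>
     list_all (\<lambda>r. fst (snd r) = (0, 0)) R \<and> distinct (map (\<lambda>r. snd (snd r)) R)"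

lemma signatures: "signatures_ok (map signature [0..<19])"
  by code_simp

section \<open>Passing between the tiles of U and their numbers\<close>

lemma length_tile_list: "length tile_list = 19" by (simp add: tile_list_def)
lemma set_tile_list: "set tile_list = tiles_U" by (simp add: tile_list_def tiles_U_def)
lemma distinct_tile_list: "distinct tile_list" by code_simp

definition tile_index :: "letter tile \<Rightarrow> nat" where
  "tile_index t = (THE i. i < 19 \<and> tile_list ! i = t)"

lemma tile_index:
  assumes "t \<in> tiles_U" shows "tile_index t < 19" "tile_list ! tile_index t = t"
proof -
  have "\<exists>!i. i < 19 \<and> tile_list ! i = t"
    using assms distinct_tile_list
    by (metis in_set_conv_nth length_tile_list nth_eq_iff_index_eq set_tile_list)
  then have "tile_index t < 19 \<and> tile_list ! tile_index t = t"
    unfolding tile_index_def by (rule theI')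
  then show "tile_index t < 19" "tile_list ! tile_index t = t" by blast+
qed

lemma tile_list_in: "u < 19 \<Longrightarrow> tile_list ! u \<in> tiles_U"
  using nth_mem[of u tile_list] by (simp add: length_tile_list set_tile_list)

lemma tile_index_nth: "u < 19 \<Longrightarrow> tile_index (tile_list ! u) = u"
  using tile_index[OF tile_list_in] distinct_tile_list by (metis length_tile_list nth_eq_iff_index_eq)

lemma tile_index_inj: "inj_on tile_index tiles_U"
  using tile_index(2) by (metis inj_onI)

lemma index_in_shift_U:
  assumes w: "w \<in> wang_shift tiles_U" shows "tile_index \<circ> w \<in> shift_U"
proof (rule color_shift_U)
  fix n
  have "w m \<in> tiles_U" "right_color (w m) = left_color (w (m + e1))" "top_color (w m) = bottom_color (w (m + e2))" for m
    using w unfolding wang_shift_def by blast+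
  then show "(tile_index \<circ> w) n < 19"
    "h_match [] ((tile_index \<circ> w) n) ((tile_index \<circ> w) (n + e1))"
    "v_match [] ((tile_index \<circ> w) n) ((tile_index \<circ> w) (n + e2))"
    using tile_index by (simp_all add: h_match_iff v_match_iff)
qed

lemma shift_U_colors:
  "list_all (\<lambda>(u, v). h_match [] u v) H_U" "list_all (\<lambda>(u, v). v_match [] u v) V_U"
  by code_simp+

lemma shift_U_tiles:
  assumes v: "v \<in> shift_U"
  shows "(!) tile_list \<circ> v \<in> wang_shift tiles_U" "tile_index \<circ> ((!) tile_list \<circ> v) = v"
proof -
  have "h_match [] (v n) (v (n + e1))" "v_match [] (v n) (v (n + e2))" for n
    using nn_shiftD[OF v[unfolded shift_U_def], of n] shift_U_colors unfolding list_all_iff by blast+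
  then show "(!) tile_list \<circ> v \<in> wang_shift tiles_U"
    using tile_list_in[OF shift_U_letter[OF v]] by (simp add: wang_shift_def h_match_iff v_match_iff)
  show "tile_index \<circ> ((!) tile_list \<circ> v) = v"
    using tile_index_nth[OF shift_U_letter[OF v]] by auto
qed

lemma wang_shift_closed: "x \<in> wang_shift T \<Longrightarrow> shift n x \<in> wang_shift T"
proof -
  assume x: "x \<in> wang_shift T"
  have "m + e1 + n = m + n + e1" "m + e2 + n = m + n + e2" for m by (simp_all add: ac_simps)
  then show ?thesis using x unfolding wang_shift_def shift_def mem_Collect_eq by (simp only:) blast
qed

interpretation jr: realization shift_U 19 "wang_shift jeandel_rao_tiles" jeandel_rao_tiles jr_cells jr_a jr_b
proof
  show "embeds shift_U (wang_shift jeandel_rao_tiles) jr_cells jr_a jr_b" by (rule embeds_jr)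
  show "wang_shift jeandel_rao_tiles \<subseteq> full_shift jeandel_rao_tiles"
    unfolding wang_shift_def full_shift_def by blast
  show "shift_U \<subseteq> full_shift {..<19}" using shift_U_letter by (auto simp: full_shift_def)
  show "\<exists>F. finite F \<and> (\<forall>v. (\<forall>g\<in>F. v g = w g) \<longrightarrow> v \<notin> shift_U)" if w: "w \<notin> shift_U" for w
  proof -
    obtain n where n: "\<not> ((w n, w (n + e1)) \<in> set H_U \<and> (w n, w (n + e2)) \<in> set V_U)"
      using w unfolding shift_U_def nn_shift_def by blast
    have "v \<notin> shift_U" if "\<forall>g\<in>{n, n + e1, n + e2}. v g = w g" for v
      using that n nn_shiftD[of v H_U V_U n] unfolding shift_U_def by auto
    then show ?thesis by (intro exI[of _ "{n, n + e1, n + e2}"]) simp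
  qed
  show "\<exists>m. \<forall>z\<in>G. v (z + m) = w z" if "w \<in> shift_U" "v \<in> shift_U" "finite G" for w v G
    using shift_U_recurrent[OF that] by metis
  show "n = 0" if "w \<in> shift_U" "shift n w = w" for w n by (rule shift_U_aperiodic[OF that])
qed (simp_all add: shift_U_closed wang_shift_closed shift_U_nonempty)

lemma jr_cells_distinct: "u < 19 \<Longrightarrow> distinct (map fst (jr_cells u))"
  using letter_occurs embeds_distinct[OF embeds_jr] by metis

text \<open>The patch is seen inside an actual Jeandel-Rao tiling, from which its values are
  read.\<close>

lemma jr_cells_values:
  assumes "u < 19" "(s, c) \<in> set (jr_cells u)" shows "c \<in> jeandel_rao_tiles"
proof -
  obtain w n where w: "w \<in> shift_U" "w n = u" by (rule letter_occurs[OF assms(1)])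
  obtain p x where x: "image_by jr_cells jr_a jr_b w p x" "x \<in> wang_shift jeandel_rao_tiles"
    by (rule embeds_image[OF embeds_jr w(1)])
  have "x (p n + s) = c" by (rule image_by_value[OF x(1)]) (simp add: w(2) assms(2))
  then show ?thesis using x(2) unfolding wang_shift_def by blast
qed

definition patch_support :: "letter tile \<Rightarrow> point set" where
  "patch_support u = support jr_cells (tile_index u)"

definition patch :: "letter tile \<Rightarrow> point \<Rightarrow> nat tile" where
  "patch u = restrict (\<lambda>s. the (map_of (jr_cells (tile_index u)) s)) (patch_support u)"

lemma patch_value:
  assumes "u \<in> tiles_U" "(s, c) \<in> set (jr_cells (tile_index u))"
  shows "s \<in> patch_support u" "patch u s = c"
proof -
  show s: "s \<in> patch_support u" using assms(2) by (force simp: patch_support_def support_def)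
  have "map_of (jr_cells (tile_index u)) s = Some c"
    using map_of_is_SomeI[OF jr_cells_distinct[OF tile_index(1)[OF assms(1)]] assms(2)] .
  then show "patch u s = c" using s by (simp add: patch_def)
qed

lemma card_patch_support:
  assumes "u \<in> tiles_U"
  shows "card (patch_support u) = fst (signature (tile_index u))"
  using distinct_card[OF jr_cells_distinct[OF tile_index(1)[OF assms]]]
  by (simp add: patch_support_def support_def signature_def signature_of_def)

lemma count_patches:
  "card {u \<in> tiles_U. card (patch_support u) = k} =
     length (filter (\<lambda>m. m = k) [45, 45, 72, 72, 72, 72, 72, 72, 70, 70, 70, 70, 112, 112, 112, 112, 112, 112, 112])"
proof -
  let ?I = "{i. i < 19 \<and> fst (signature i) = k}"
  have "{u \<in> tiles_U. card (patch_support u) = k} = (!) tile_list ` ?I"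
  proof (intro set_eqI iffI)
    fix u assume "u \<in> {u \<in> tiles_U. card (patch_support u) = k}"
    then show "u \<in> (!) tile_list ` ?I"
      using card_patch_support[of u] tile_index[of u] by (intro image_eqI[of _ _ "tile_index u"]) auto
  next
    fix u assume "u \<in> (!) tile_list ` ?I"
    then obtain i where i: "i < 19" "fst (signature i) = k" "u = tile_list ! i" by blast
    then show "u \<in> {u \<in> tiles_U. card (patch_support u) = k}"
      using card_patch_support[of u] tile_list_in[of i] tile_index_nth[of i] by simp
  qed
  moreover have "inj_on ((!) tile_list) ?I"
    using distinct_tile_list by (auto simp: inj_on_def nth_eq_iff_index_eq length_tile_list)
  ultimately have "card {u \<in> tiles_U. card (patch_support u) = k} = card ?I" by (simp add: card_image)
  also have "?I = set (filter (\<lambda>i. fst (signature i) = k) [0..<19])" by auto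
  also have "card \<dots> = length (filter (\<lambda>i. fst (signature i) = k) [0..<19])" by (rule distinct_card) simp
  also have "\<dots> = length (filter (\<lambda>m. m = k) (map fst (map signature [0..<19])))"
    by (simp add: filter_map comp_def)
  also have "map fst (map signature [0..<19]) =
      [45, 45, 72, 72, 72, 72, 72, 72, 70, 70, 70, 70, 112, 112, 112, 112, 112, 112, 112]"
    using signatures unfolding signatures_ok_def by blast
  finally show ?thesis .
qed

text \<open>Support and values together amount to the partial map \<open>map_of\<close>, and the
  signature samples this map.\<close>

lemma patches_inj: "inj_on (\<lambda>u. (patch_support u, patch u)) tiles_U"
proof (rule inj_onI)
  fix u v assume uv: "u \<in> tiles_U" "v \<in> tiles_U" "(patch_support u, patch u) = (patch_support v, patch v)"
  have mo: "map_of (jr_cells (tile_index u)) s = (if s \<in> patch_support u then Some (patch u s) else None)" for u s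
    by (auto simp: patch_def patch_support_def support_def map_of_eq_None_iff dest: weak_map_of_SomeI)
  have "map_of (jr_cells (tile_index u)) = map_of (jr_cells (tile_index v))"
  proof
    fix s
    show "map_of (jr_cells (tile_index u)) s = map_of (jr_cells (tile_index v)) s"
      unfolding mo[of u s] mo[of v s] using uv(3) by simp
  qed
  then have "snd (snd (signature (tile_index u))) = snd (snd (signature (tile_index v)))"
    by (simp add: signature_def signature_of_def)
  moreover have "distinct (map (\<lambda>i. snd (snd (signature i))) [0..<19])"
    using signatures unfolding signatures_ok_def map_map comp_def by blast
  ultimately have "tile_index u = tile_index v"
    using tile_index(1)[OF uv(1)] tile_index(1)[OF uv(2)]
    by (auto simp: distinct_map inj_on_def simp del: upt_rec_numeral)
  then show "u = v" using tile_index_inj uv by (meson inj_onD)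
qed

theorem theorem1:
  "\<exists>(X0 :: (int \<times> int \<Rightarrow> nat tile) set)
     (S :: letter tile \<Rightarrow> (int \<times> int) set)
     (P :: letter tile \<Rightarrow> int \<times> int \<Rightarrow> nat tile)
     (a :: letter tile \<Rightarrow> int \<times> int) (b :: letter tile \<Rightarrow> int \<times> int).
     X0 \<subseteq> wang_shift jeandel_rao_tiles \<and>
     minimal_subshift jeandel_rao_tiles X0 \<and> aperiodic X0 \<and>
     (\<forall>u\<in>tiles_U. finite (S u) \<and> 0 \<in> S u \<and> P u \<in> S u \<rightarrow>\<^sub>E jeandel_rao_tiles) \<and>
     inj_on (\<lambda>u. (S u, P u)) tiles_U \<and>
     card {u \<in> tiles_U. card (S u) = 45} = 2 \<and>
     card {u \<in> tiles_U. card (S u) = 70} = 4 \<and>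
     card {u \<in> tiles_U. card (S u) = 72} = 6 \<and>
     card {u \<in> tiles_U. card (S u) = 112} = 7 \<and>
     (\<exists>(p :: (int \<times> int \<Rightarrow> letter tile) \<Rightarrow> int \<times> int \<Rightarrow> int \<times> int)
       (\<Psi> :: (int \<times> int \<Rightarrow> letter tile) \<Rightarrow> int \<times> int \<Rightarrow> nat tile).
       (\<forall>w\<in>wang_shift tiles_U.
          position_map a b w (p w) \<and>
          placed_supports_partition S w (p w) \<and>
          (\<forall>n. \<forall>s\<in>S (w n). \<Psi> w (p w n + s) = P (w n) s) \<and>
          \<Psi> w \<in> X0) \<and>
       (\<forall>x\<in>X0. \<exists>!(w, k). w \<in> wang_shift tiles_U \<and> k \<in> S (w 0) \<and> x = shift k (\<Psi> w)))"
proof -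
  let ?W = "wang_shift tiles_U" and ?i = "\<lambda>w. tile_index \<circ> w"
  have "\<exists>p x. image_by jr_cells jr_a jr_b (?i w) p x" if "w \<in> ?W" for w
    by (rule embeds_image[OF embeds_jr index_in_shift_U[OF that]]) blast
  \<comment> \<open>One image is chosen for each tiling; by \<open>image_by_unique\<close> the
    choice is forced.\<close>
  then obtain p \<Psi> where I: "image_by jr_cells jr_a jr_b (?i w) (p w) (\<Psi> w)" if "w \<in> ?W" for w
    by metis
  have patches: "finite (patch_support u) \<and> 0 \<in> patch_support u \<and> patch u \<in> patch_support u \<rightarrow>\<^sub>E jeandel_rao_tiles"
    if u: "u \<in> tiles_U" for u
  proof (intro conjI)
    show "finite (patch_support u)" by (simp add: patch_support_def support_def)
    let ?r = "signature (tile_index u)"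
    have r: "?r \<in> set (map signature [0..<19])" using tile_index(1)[OF u] by simp
    then have "fst ?r \<in> set (map fst (map signature [0..<19]))" unfolding set_map by (rule imageI)
    moreover have "map fst (map signature [0..<19]) =
        [45, 45, 72, 72, 72, 72, 72, 72, 70, 70, 70, 70, 112, 112, 112, 112, 112, 112, 112]"
      using signatures unfolding signatures_ok_def by blast
    ultimately have "fst ?r \<noteq> 0" by (simp only:) auto
    moreover have "fst (snd ?r) = (0, 0)" using signatures r unfolding signatures_ok_def list_all_iff by blast
    ultimately show "0 \<in> patch_support u"
      by (cases "jr_cells (tile_index u)")
        (auto simp: signature_def signature_of_def patch_support_def support_def zero_prod_def)
    show "patch u \<in> patch_support u \<rightarrow>\<^sub>E jeandel_rao_tiles"
    proof
      fix s assume "s \<in> patch_support u"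
      then obtain c where "(s, c) \<in> set (jr_cells (tile_index u))" by (auto simp: patch_support_def support_def)
      then show "patch u s \<in> jeandel_rao_tiles"
        using patch_value(2)[OF u] jr_cells_values[OF tile_index(1)[OF u]] by metis
    qed (simp add: patch_def)
  qed
  have unique: "\<exists>!(w, k). w \<in> ?W \<and> k \<in> patch_support (w 0) \<and> x = shift k (\<Psi> w)" if x: "x \<in> jr.image_shift" for x
  proof -
    obtain v q y k where v: "v \<in> shift_U" "k \<in> support jr_cells (v 0)" "image_by jr_cells jr_a jr_b v q y" "x = shift k y"
      using x unfolding jr.image_shift_def by blast
    define w where "w = (!) tile_list \<circ> v"
    have w: "w \<in> ?W" "?i w = v" unfolding w_def by (rule shift_U_tiles[OF v(1)])+
    have "\<Psi> w = y" using image_by_unique[OF I[OF w(1)]] v(3) w(2) by metis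
    then have eq: "x = shift k (\<Psi> w)" using v(4) by simp
    have k: "k \<in> patch_support (w 0)" using v(2) w(2) unfolding patch_support_def by (metis comp_apply)
    have uniq: "w' = w \<and> k' = k" if "w' \<in> ?W" "k' \<in> patch_support (w' 0)" "x = shift k' (\<Psi> w')" for w' k'
    proof -
      \<comment> \<open>Uniqueness of the pair is recognizability of the composed
        decomposition.\<close>
      have "?i w' = v \<and> k' = k"
        by (rule embeds_recognizable[OF embeds_jr index_in_shift_U[OF that(1)] v(1) I[OF that(1)] v(3) _ v(2)])
          (use that v(4) in \<open>simp_all add: patch_support_def\<close>)
      moreover have "w' = w" if i: "?i w' = ?i w"
      proof
        fix n
        have "w' n \<in> tiles_U" "w n \<in> tiles_U" using \<open>w' \<in> ?W\<close> w(1) unfolding wang_shift_def by blast+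
        then show "w' n = w n" using tile_index_inj fun_cong[OF i, of n] by (simp add: inj_on_eq_iff)
      qed
      ultimately show ?thesis using w(2) by simp
    qed
    show ?thesis
    proof (rule ex1I[of _ "(w, k)"])
      show "case (w, k) of (w, k) \<Rightarrow> w \<in> ?W \<and> k \<in> patch_support (w 0) \<and> x = shift k (\<Psi> w)"
        unfolding prod.case using w(1) k eq by blast
      fix z assume z: "case z of (w, k) \<Rightarrow> w \<in> ?W \<and> k \<in> patch_support (w 0) \<and> x = shift k (\<Psi> w)"
      obtain w' k' where z': "z = (w', k')" by (rule prod.exhaust)
      show "z = (w, k)" using uniq[of w' k'] z unfolding z' prod.case by blast
    qed
  qed
  show ?thesis
  proof (rule exI[of _ jr.image_shift], rule exI[of _ patch_support], rule exI[of _ patch],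
      rule exI[of _ "jr_a \<circ> tile_index"], rule exI[of _ "jr_b \<circ> tile_index"],
      intro conjI exI[of _ p] exI[of _ \<Psi>] ballI)
    show "jr.image_shift \<subseteq> wang_shift jeandel_rao_tiles" by (rule jr.image_shift_subset)
    show "minimal_subshift jeandel_rao_tiles jr.image_shift" by (rule jr.minimal_image_shift)
    show "aperiodic jr.image_shift" by (rule jr.aperiodic_image_shift)
    show "inj_on (\<lambda>u. (patch_support u, patch u)) tiles_U" by (rule patches_inj)
    show "card {u \<in> tiles_U. card (patch_support u) = 45} = 2"
      "card {u \<in> tiles_U. card (patch_support u) = 70} = 4"
      "card {u \<in> tiles_U. card (patch_support u) = 72} = 6"
      "card {u \<in> tiles_U. card (patch_support u) = 112} = 7"
      unfolding count_patches by simp_all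
  next
    fix u assume "u \<in> tiles_U"
    then show "finite (patch_support u)" "0 \<in> patch_support u"
      "patch u \<in> patch_support u \<rightarrow>\<^sub>E jeandel_rao_tiles" using patches by blast+
  next
    fix w assume w: "w \<in> ?W"
    note J = I[OF w, unfolded image_by_def position_map_def placed_supports_partition_def]
    show "position_map (jr_a \<circ> tile_index) (jr_b \<circ> tile_index) w (p w)"
      using J unfolding position_map_def comp_apply by blast
    show "placed_supports_partition patch_support w (p w)"
      using J unfolding placed_supports_partition_def patch_support_def comp_apply by blast
    show "\<forall>n. \<forall>s\<in>patch_support (w n). \<Psi> w (p w n + s) = patch (w n) s"
    proof (intro allI ballI)
      fix n s assume "s \<in> patch_support (w n)"
      then obtain c where c: "(s, c) \<in> set (jr_cells (tile_index (w n)))" by (auto simp: patch_support_def support_def)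
      have "w n \<in> tiles_U" using w unfolding wang_shift_def by blast
      then show "\<Psi> w (p w n + s) = patch (w n) s"
        using patch_value(2)[OF _ c] image_by_value[OF I[OF w], of s c n] c by simp
    qed
    show "\<Psi> w \<in> jr.image_shift"
      using jr.image_shiftI[OF index_in_shift_U[OF w] I[OF w], of 0] by simp
  next
    fix x assume "x \<in> jr.image_shift"
    then show "\<exists>!(w, k). w \<in> ?W \<and> k \<in> patch_support (w 0) \<and> x = shift k (\<Psi> w)" by (rule unique)
  qed
qed

end
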